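(* Let $X\subset\mathbb{R}^N$ and $Y\subset\mathbb{R}^P$ be locally finite geometric simplicial complexes and let $f\colon X\to Y$ be a surjective simplicial map with finite fibres. 1. The second spectral sequence of the double complex $C_{p,q}=C_p(W^{q+1}(f))$ ($p,q\ge0$), with $d'=\partial^{q+1}_p$ and $d''=\varrho^{q+1}_p$, converges to $H_*(Y)$: $${}^{II}E^1_{p,q}\cong H_q(W^{p+1}(f))\Longrightarrow H_{p+q}(Y),$$ with differentials (on the first page) given by $(\varrho^{p+1}_q)_*$. 2. The second spectral sequence of the double complex $C_{p,q}=C_p^{\mathrm{Alt}}(D^{q+1}(f))$ ($p,q\ge0$), with $d'=\partial^{q+1}_p$ and $d''=\epsilon^{q+1}_p$, converges to $H_*(Y)$: $${}^{II}E^1_{p,q}\cong AH_q(D^{p+1}(f))\Longrightarrow H_{p+q}(Y),$$ with differentials (on the first page) given by $(\epsilon^{p+1}_q)_*$. (In both cases $d''=0$ on $C_{p,0}$.)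
   Context: A simplicial map sends the vertices of each simplex to vertices of a simplex and is affine on each simplex. For $k\ge 1$, $W^k(f)=\{(x_1,\dots,x_k)\in X^k : f(x_1)=\dots=f(x_k)\}$, and $D^k(f)$ is the closure in $X^k$ of $\{(x_1,\dots,x_k)\in X^k : f(x_1)=\dots=f(x_k),\ x_i\ne x_j \text{ for } i\neq j\}$; by convention $W^1(f)=D^1(f)=X$. The symmetric group $S_k$ acts on both by permuting components. $\pi_\ell$ is the $\ell$-th projection to $X$; $\varepsilon^{i,k}$ forgets the $i$-th component (mapping $W^k(f)\to W^{k-1}(f)$ and $D^k(f)\to D^{k-1}(f)$), and $\varepsilon^k=\varepsilon^{k,k}$. Associated triangulation: for a point $x$ of a simplicial complex let $\Gamma_x$ be the unique geometric simplex containing $x$ in its interior. Let $\mathbf{x}\in W^k(f)$, $y=f(\pi_1(\mathbf{x}))$ and let $w_0,\dots,w_n$ be the vertices of $\Gamma_y$. For each $\ell$, $f$ maps $\Gamma_{\pi_\ell(\mathbf{x})}$ isomorphically onto $\Gamma_y$; let $v^{(\ell)}_j$ be the vertex of $\Gamma_{\pi_\ell(\mathbf{x})}$ with $f(v^{(\ell)}_j)=w_j$. Let $\Gamma^{(k)}_{\mathbf{x}}$ be the geometric $n$-simplex with vertices $(v^{(1)}_j,\dots,v^{(k)}_j)$, $j=0,\dots,n$. The simplices of $W^k(f)$ (resp. $D^k(f)$) are the $\Gamma^{(k)}_{\mathbf{x}}$ with $\mathbf{x}\in W^k(f)$ (resp. $\mathbf{x}\in D^k(f)$). This makes $W^k(f)$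 and $D^k(f)$ simplicial complexes, and the $\varepsilon^{i,k}$ simplicial maps. An ordered $n$-simplex $[v_0,\dots,v_n]$ is a geometric $n$-simplex together with an ordering of its vertices. $C_n(\cdot)$ denotes the group of simplicial $n$-chains, namely the free abelian group generated by the ordered $n$-simplices; simplicial maps that are injective on simplices induce chain maps (subscript $\#$, and $\#,n$ in degree $n$) by acting on vertices. $\partial^k_n$ is the usual simplicial boundary on $W^k(f)$ or $D^k(f)$, and $H_*$ is the homology of the complex of simplicial chains $C_\bullet$ with the usual boundary. $C_n^{\mathrm{Alt}}(D^k(f))=\{c\in C_n(D^k(f)) : \sigma_\#(c)=\mathrm{sign}(\sigma)c\ \text{for all }\sigma\in S_k\}$, giving a subcomplex of $C_\bullet(D^k(f))$, and $AH_*(D^k(f))$ is the homology of $(C_\bullet^{\mathrm{Alt}}(D^k(f)),\partial^k_\bullet)$ (alternating homology). For $k\ge 2$, $\varrho^k_n=(-1)^n\sum_{i=1}^k(-1)^{i-1}\varepsilon^{i,k}_{\#,n}$ on $C_n(W^k(f))$ and $\epsilon^k_n=(-1)^n\varepsilon^k_{\#,n}$ on $C_n^{\mathrm{Alt}}(D^k(f))$; a subscript $*$ denotes the map induced on homology. For a first quadrant double complex $(C_{p,q},d',d'')$ with $d'\colon C_{p,q}\to C_{p-1,q}$, $d''\colon C_{p,q}\to C_{p,q-1}$, $d'd''+d''d'=0$, the total complex is $\mathrm{Tot}(C)_n=\bigoplus_{p+q=n}C_{p,q}$ with differential $d'+d''$. The second spectral sequence is the one of the filtration ${}^{II}F^p(\mathrm{Tot}(C)_n)=\bigoplus_{j\le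 p}C_{n-j,j}$; it has ${}^{II}E^0_{p,q}=C_{q,p}$ and ${}^{II}E^1_{p,q}=H_q(C_{*,p},d')$ with $d^1$ induced by $d''$. A first quadrant spectral sequence converges to a graded module $H_*$, written $E^1_{p,q}\Rightarrow H_{p+q}$, if each $H_n$ has a finite filtration $0=F_{-1}H_n\subset F_0H_n\subset\dots\subset F_nH_n=H_n$ with $E^\infty_{p,q}\cong F_pH_{p+q}/F_{p-1}H_{p+q}$. *)

theory Defs
  imports
    "HOL-Analysis.Analysis"
    "HOL-Algebra.Free_Abelian_Groups"
    "HOL-Combinatorics.Permutations"
begin

section \<open>Geometric simplicial complexes and simplicial maps\<close>

definition geometric_complex :: "'a::euclidean_space set set \<Rightarrow> bool" where
  "geometric_complex K \<longleftrightarrow>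
     (\<forall>S\<in>K. \<exists>n::nat. int n simplex S) \<and>
     (\<forall>S\<in>K. \<forall>F. F face_of S \<and> F \<noteq> {} \<longrightarrow> F \<in> K) \<and>
     (\<forall>S\<in>K. \<forall>T\<in>K. (S \<inter> T) face_of S)"

definition locally_finite_complex :: "'a::euclidean_space set set \<Rightarrow> bool" where
  "locally_finite_complex K \<longleftrightarrow> locally_finite_in (top_of_set (\<Union>K)) K"

definition vertices :: "'a::euclidean_space set \<Rightarrow> 'a set" where
  "vertices S = {v. v extreme_point_of S}"

definition simplicial_map ::
  "'a::euclidean_space set set \<Rightarrow> 'b::euclidean_space set set \<Rightarrow> ('a \<Rightarrow> 'b) \<Rightarrow> bool" where
  "simplicial_map K L f \<longleftrightarrow>
     (\<forall>S\<in>K. (\<exists>T\<in>L. f ` vertices S \<subseteq> vertices T) \<and>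
        (\<forall>x\<in>S. \<forall>y\<in>S. \<forall>u\<in>{0..1}. f ((1 - u) *\<^sub>R x + u *\<^sub>R y) = (1 - u) *\<^sub>R f x + u *\<^sub>R f y))"

text \<open>The simplex \<open>\<Gamma>\<^sub>x\<close> containing \<open>x\<close> in its (relative) interior.\<close>

definition supporting_simplex :: "'a::euclidean_space set set \<Rightarrow> 'a \<Rightarrow> 'a set" where
  "supporting_simplex K x = (THE S. S \<in> K \<and> x \<in> rel_interior S)"


section \<open>Multiple point spaces and their triangulations\<close>

text \<open>Points of \<open>X\<^sup>k\<close> are extensional functions on \<open>{..<k}\<close>, so components are numbered from 0;
  the formulas give \<open>W\<^sup>1(f) = D\<^sup>1(f) = X\<^sup>1\<close>. The closure is taken in the product topology
  of \<open>X\<^sup>k\<close>.\<close>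

definition multi_points :: "'a::euclidean_space set set \<Rightarrow> ('a \<Rightarrow> 'b) \<Rightarrow> nat \<Rightarrow> (nat \<Rightarrow> 'a) set" where
  "multi_points K f k = {x \<in> {..<k} \<rightarrow>\<^sub>E \<Union>K. \<forall>i<k. \<forall>j<k. f (x i) = f (x j)}"

definition strict_closure_points ::
  "'a::euclidean_space set set \<Rightarrow> ('a \<Rightarrow> 'b) \<Rightarrow> nat \<Rightarrow> (nat \<Rightarrow> 'a) set" where
  "strict_closure_points K f k =
     (product_topology (\<lambda>_. top_of_set (\<Union>K)) {..<k}) closure_of
       {x \<in> multi_points K f k. inj_on x {..<k}}"

text \<open>From here on a geometric simplex is represented by its vertex set, which determines it,
  and a complex by the set of the vertex sets of its simplices. \<open>multi_simplex\<close> is the vertex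
  set of \<open>\<Gamma>\<^bsup>(k)\<^esup>\<^sub>x\<close>: to every vertex \<open>w\<close> of \<open>\<Gamma>\<^bsub>f(x\<^sub>1)\<^esub>\<close> belongs the tuple of the vertices
  over \<open>w\<close> of the simplices supporting the components of \<open>x\<close>.\<close>

definition lifted_vertex ::
  "'a::euclidean_space set set \<Rightarrow> ('a \<Rightarrow> 'b) \<Rightarrow> nat \<Rightarrow> (nat \<Rightarrow> 'a) \<Rightarrow> 'b \<Rightarrow> nat \<Rightarrow> 'a" where
  "lifted_vertex K f k x w =
     (\<lambda>l\<in>{..<k}. THE v. v \<in> vertices (supporting_simplex K (x l)) \<and> f v = w)"

definition multi_simplex ::
  "'a::euclidean_space set set \<Rightarrow> 'b::euclidean_space set set \<Rightarrow> ('a \<Rightarrow> 'b) \<Rightarrow> nat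
     \<Rightarrow> (nat \<Rightarrow> 'a) \<Rightarrow> (nat \<Rightarrow> 'a) set" where
  "multi_simplex K L f k x =
     lifted_vertex K f k x ` vertices (supporting_simplex L (f (x 0)))"

definition W_complex ::
  "'a::euclidean_space set set \<Rightarrow> 'b::euclidean_space set set \<Rightarrow> ('a \<Rightarrow> 'b) \<Rightarrow> nat
     \<Rightarrow> (nat \<Rightarrow> 'a) set set" where
  "W_complex K L f k = multi_simplex K L f k ` multi_points K f k"

definition D_complex ::
  "'a::euclidean_space set set \<Rightarrow> 'b::euclidean_space set set \<Rightarrow> ('a \<Rightarrow> 'b) \<Rightarrow> nat
     \<Rightarrow> (nat \<Rightarrow> 'a) set set" where
  "D_complex K L f k = multi_simplex K L f k ` strict_closure_points K f k"

text \<open>\<open>forget i k\<close> drops the component with index \<open>i < k\<close>; with components numbered from 1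
  this is \<open>\<epsilon>\<^bsup>i+1,k\<^esup>\<close>.\<close>

definition forget :: "nat \<Rightarrow> nat \<Rightarrow> (nat \<Rightarrow> 'a) \<Rightarrow> nat \<Rightarrow> 'a" where
  "forget i k x = (\<lambda>j\<in>{..<k - 1}. if j < i then x j else x (Suc j))"


section \<open>Simplicial chains\<close>

text \<open>An ordered \<open>n\<close>-simplex is the list of its \<open>n + 1\<close> distinct vertices. As the chain groups
  are free on these lists, different orderings of one geometric simplex are independent
  generators.\<close>

definition ordered_simplices :: "nat \<Rightarrow> 'v set set \<Rightarrow> 'v list set" where
  "ordered_simplices n V = {vs. length vs = Suc n \<and> distinct vs \<and> set vs \<in> V}"

type_synonym 'v simp_chain = "'v list \<Rightarrow>\<^sub>0 int"

definition simplicial_chains :: "'v set set \<Rightarrow> nat \<Rightarrow> 'v simp_chain monoid" where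
  "simplicial_chains V n = free_Abelian_group (ordered_simplices n V)"

definition simplicial_boundary :: "nat \<Rightarrow> 'v simp_chain \<Rightarrow> 'v simp_chain" where
  "simplicial_boundary n c =
     (if n = 0 then 0
      else frag_extend (\<lambda>vs. \<Sum>i\<le>n. frag_cmul ((-1) ^ i) (frag_of (take i vs @ drop (Suc i) vs))) c)"

definition simplicial_push :: "('v \<Rightarrow> 'w) \<Rightarrow> 'v simp_chain \<Rightarrow> 'w simp_chain" where
  "simplicial_push g = frag_extend (\<lambda>vs. frag_of (map g vs))"

definition alternating_chains ::
  "nat \<Rightarrow> (nat \<Rightarrow> 'a) set set \<Rightarrow> nat \<Rightarrow> (nat \<Rightarrow> 'a) simp_chain monoid" where
  "alternating_chains k V n = (simplicial_chains V n)
     \<lparr>carrier := {c \<in> carrier (simplicial_chains V n).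
        \<forall>\<sigma>. \<sigma> permutes {..<k} \<longrightarrow> simplicial_push (\<lambda>x. x \<circ> \<sigma>) c = frag_cmul (sign \<sigma>) c}\<rparr>"

definition W_chains ::
  "'a::euclidean_space set set \<Rightarrow> 'b::euclidean_space set set \<Rightarrow> ('a \<Rightarrow> 'b) \<Rightarrow> nat \<Rightarrow> nat
     \<Rightarrow> (nat \<Rightarrow> 'a) simp_chain monoid" where
  "W_chains K L f k n = simplicial_chains (W_complex K L f k) n"

definition D_alt_chains ::
  "'a::euclidean_space set set \<Rightarrow> 'b::euclidean_space set set \<Rightarrow> ('a \<Rightarrow> 'b) \<Rightarrow> nat \<Rightarrow> nat
     \<Rightarrow> (nat \<Rightarrow> 'a) simp_chain monoid" where
  "D_alt_chains K L f k n = alternating_chains k (D_complex K L f k) n"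

text \<open>\<open>\<varrho>\<^sup>k\<^sub>n\<close> and \<open>\<epsilon>\<^sup>k\<^sub>n\<close> for \<open>k \<ge> 2\<close>; the value 0 for \<open>k \<le> 1\<close> gives \<open>d'' = 0\<close> on \<open>C\<^bsub>p,0\<^esub>\<close>.\<close>

definition rho :: "nat \<Rightarrow> nat \<Rightarrow> (nat \<Rightarrow> 'a) simp_chain \<Rightarrow> (nat \<Rightarrow> 'a) simp_chain" where
  "rho k n c =
     (if k \<le> 1 then 0
      else frag_cmul ((-1) ^ n) (\<Sum>i<k. frag_cmul ((-1) ^ i) (simplicial_push (forget i k) c)))"

definition eps :: "nat \<Rightarrow> nat \<Rightarrow> (nat \<Rightarrow> 'a) simp_chain \<Rightarrow> (nat \<Rightarrow> 'a) simp_chain" where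
  "eps k n c =
     (if k \<le> 1 then 0 else frag_cmul ((-1) ^ n) (simplicial_push (forget (k - 1) k) c))"


section \<open>Homology of chain complexes of Abelian groups\<close>

text \<open>A chain complex is given by groups \<open>C n\<close> and maps \<open>d n\<close> from \<open>C n\<close> to \<open>C (n - 1)\<close>;
  here \<open>d 0\<close> is the trivial map.\<close>

definition cycles :: "(nat \<Rightarrow> 'c monoid) \<Rightarrow> (nat \<Rightarrow> 'c \<Rightarrow> 'c) \<Rightarrow> nat \<Rightarrow> 'c set" where
  "cycles C d n = {c \<in> carrier (C n). d n c = \<one>\<^bsub>C (n - 1)\<^esub>}"

definition boundaries :: "(nat \<Rightarrow> 'c monoid) \<Rightarrow> (nat \<Rightarrow> 'c \<Rightarrow> 'c) \<Rightarrow> nat \<Rightarrow> 'c set" where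
  "boundaries C d n = d (Suc n) ` carrier (C (Suc n))"

definition homology :: "(nat \<Rightarrow> 'c monoid) \<Rightarrow> (nat \<Rightarrow> 'c \<Rightarrow> 'c) \<Rightarrow> nat \<Rightarrow> 'c set monoid" where
  "homology C d n = (C n)\<lparr>carrier := cycles C d n\<rparr> Mod boundaries C d n"

text \<open>\<open>coset_map G N g\<close> sends the coset of \<open>x\<close> to the coset \<open>N #>\<^bsub>G\<^esub> g x\<close>, for a homomorphism
  \<open>g\<close> into \<open>G\<close> that carries the subgroup divided out in the source into \<open>N\<close>.\<close>

definition coset_map :: "'c monoid \<Rightarrow> 'c set \<Rightarrow> ('b \<Rightarrow> 'c) \<Rightarrow> 'b set \<Rightarrow> 'c set" where
  "coset_map G N g X = N <#>\<^bsub>G\<^esub> (g ` X)"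

text \<open>The map into degree \<open>n\<close> homology of the complex \<open>(C, d)\<close> induced by \<open>g\<close>.\<close>

definition homology_map ::
  "(nat \<Rightarrow> 'c monoid) \<Rightarrow> (nat \<Rightarrow> 'c \<Rightarrow> 'c) \<Rightarrow> nat \<Rightarrow> ('b \<Rightarrow> 'c) \<Rightarrow> 'b set \<Rightarrow> 'c set" where
  "homology_map C d n g = coset_map (C n) (boundaries C d n) g"


section \<open>Double complexes and the second spectral sequence\<close>

definition double_complex ::
  "(nat \<Rightarrow> nat \<Rightarrow> 'c monoid) \<Rightarrow> (nat \<Rightarrow> nat \<Rightarrow> 'c \<Rightarrow> 'c) \<Rightarrow> (nat \<Rightarrow> nat \<Rightarrow> 'c \<Rightarrow> 'c) \<Rightarrow> bool" where
  "double_complex C d' d'' \<longleftrightarrow>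
     (\<forall>p q. comm_group (C p q)) \<and>
     (\<forall>p q. d' (Suc p) q \<in> hom (C (Suc p) q) (C p q)) \<and>
     (\<forall>p q. d'' p (Suc q) \<in> hom (C p (Suc q)) (C p q)) \<and>
     (\<forall>q. \<forall>c\<in>carrier (C 0 q). d' 0 q c = \<one>\<^bsub>C 0 q\<^esub>) \<and>
     (\<forall>p. \<forall>c\<in>carrier (C p 0). d'' p 0 c = \<one>\<^bsub>C p 0\<^esub>) \<and>
     (\<forall>p q. \<forall>c\<in>carrier (C (Suc (Suc p)) q). d' (Suc p) q (d' (Suc (Suc p)) q c) = \<one>\<^bsub>C p q\<^esub>) \<and>
     (\<forall>p q. \<forall>c\<in>carrier (C p (Suc (Suc q))). d'' p (Suc q) (d'' p (Suc (Suc q)) c) = \<one>\<^bsub>C p q\<^esub>) \<and>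
     (\<forall>p q. \<forall>c\<in>carrier (C (Suc p) (Suc q)).
        d' (Suc p) q (d'' (Suc p) (Suc q) c) \<otimes>\<^bsub>C p q\<^esub> d'' p (Suc q) (d' (Suc p) (Suc q) c)
          = \<one>\<^bsub>C p q\<^esub>)"

text \<open>The component of a chain of the total complex with index \<open>j\<close> is the one in \<open>C\<^bsub>n-j,j\<^esub>\<close>.\<close>

definition tot :: "(nat \<Rightarrow> nat \<Rightarrow> 'c monoid) \<Rightarrow> nat \<Rightarrow> (nat \<Rightarrow> 'c) monoid" where
  "tot C n = sum_group {..n} (\<lambda>j. C (n - j) j)"

definition tot_diff ::
  "(nat \<Rightarrow> nat \<Rightarrow> 'c monoid) \<Rightarrow> (nat \<Rightarrow> nat \<Rightarrow> 'c \<Rightarrow> 'c) \<Rightarrow> (nat \<Rightarrow> nat \<Rightarrow> 'c \<Rightarrow> 'c) \<Rightarrow>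
     nat \<Rightarrow> (nat \<Rightarrow> 'c) \<Rightarrow> nat \<Rightarrow> 'c" where
  "tot_diff C d' d'' n x =
     (if n = 0 then \<one>\<^bsub>tot C 0\<^esub>
      else (\<lambda>j\<in>{..n - 1}. d' (n - j) j (x j) \<otimes>\<^bsub>C (n - 1 - j) j\<^esub>
                            d'' (n - 1 - j) (Suc j) (x (Suc j))))"

text \<open>The filtration degree \<open>s\<close> is an integer, so that \<open>tot_filt C s n\<close> is trivial for \<open>s < 0\<close>.\<close>

definition tot_filt :: "(nat \<Rightarrow> nat \<Rightarrow> 'c monoid) \<Rightarrow> int \<Rightarrow> nat \<Rightarrow> (nat \<Rightarrow> 'c) set" where
  "tot_filt C s n = {x \<in> carrier (tot C n). \<forall>j\<le>n. int j > s \<longrightarrow> x j = \<one>\<^bsub>C (n - j) j\<^esub>}"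

text \<open>The pages are the usual ones of a filtered complex,
  \<open>Z\<^sup>r\<^sub>s = {x \<in> F\<^sub>s. D x \<in> F\<^bsub>s-r\<^esub>}\<close> and
  \<open>E\<^sup>r\<^sub>p = Z\<^sup>r\<^sub>p / (Z\<^bsup>r-1\<^esup>\<^bsub>p-1\<^esub> + D Z\<^bsup>r-1\<^esup>\<^bsub>p+r-1\<^esub>)\<close>; in \<open>ss_Z\<close>, \<open>n\<close> is the total degree.\<close>

definition ss_Z ::
  "(nat \<Rightarrow> nat \<Rightarrow> 'c monoid) \<Rightarrow> (nat \<Rightarrow> nat \<Rightarrow> 'c \<Rightarrow> 'c) \<Rightarrow> (nat \<Rightarrow> nat \<Rightarrow> 'c \<Rightarrow> 'c) \<Rightarrow>
     int \<Rightarrow> int \<Rightarrow> nat \<Rightarrow> (nat \<Rightarrow> 'c) set" where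
  "ss_Z C d' d'' r s n =
     {x \<in> tot_filt C s n. tot_diff C d' d'' n x \<in> tot_filt C (s - r) (n - 1)}"

definition ss_B ::
  "(nat \<Rightarrow> nat \<Rightarrow> 'c monoid) \<Rightarrow> (nat \<Rightarrow> nat \<Rightarrow> 'c \<Rightarrow> 'c) \<Rightarrow> (nat \<Rightarrow> nat \<Rightarrow> 'c \<Rightarrow> 'c) \<Rightarrow>
     nat \<Rightarrow> nat \<Rightarrow> nat \<Rightarrow> (nat \<Rightarrow> 'c) set" where
  "ss_B C d' d'' r p q =
     ss_Z C d' d'' (int r - 1) (int p - 1) (p + q) <#>\<^bsub>tot C (p + q)\<^esub>
     tot_diff C d' d'' (p + q + 1) ` ss_Z C d' d'' (int r - 1) (int p + int r - 1) (p + q + 1)"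

definition ss_E ::
  "(nat \<Rightarrow> nat \<Rightarrow> 'c monoid) \<Rightarrow> (nat \<Rightarrow> nat \<Rightarrow> 'c \<Rightarrow> 'c) \<Rightarrow> (nat \<Rightarrow> nat \<Rightarrow> 'c \<Rightarrow> 'c) \<Rightarrow>
     nat \<Rightarrow> nat \<Rightarrow> nat \<Rightarrow> (nat \<Rightarrow> 'c) set monoid" where
  "ss_E C d' d'' r p q =
     (tot C (p + q))\<lparr>carrier := ss_Z C d' d'' (int r) (int p) (p + q)\<rparr> Mod ss_B C d' d'' r p q"

text \<open>The differential from \<open>E\<^sup>r\<^bsub>p,q\<^esub>\<close> to \<open>E\<^sup>r\<^bsub>p-r,q+r-1\<^esub>\<close>, for \<open>1 \<le> r \<le> p\<close>; for \<open>p < r\<close> the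
  target is zero.\<close>

definition ss_d ::
  "(nat \<Rightarrow> nat \<Rightarrow> 'c monoid) \<Rightarrow> (nat \<Rightarrow> nat \<Rightarrow> 'c \<Rightarrow> 'c) \<Rightarrow> (nat \<Rightarrow> nat \<Rightarrow> 'c \<Rightarrow> 'c) \<Rightarrow>
     nat \<Rightarrow> nat \<Rightarrow> nat \<Rightarrow> (nat \<Rightarrow> 'c) set \<Rightarrow> (nat \<Rightarrow> 'c) set" where
  "ss_d C d' d'' r p q =
     coset_map (tot C (p + q - 1)) (ss_B C d' d'' r (p - r) (q + r - 1)) (tot_diff C d' d'' (p + q))"

text \<open>The identification of \<open>E\<^sup>1\<^bsub>p,q\<^esub>\<close> with \<open>H\<^sub>q(C\<^bsub>*,p\<^esub>, d')\<close>: the class of a chain of the total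
  complex is sent to the class of its component in \<open>C\<^bsub>q,p\<^esub>\<close>.\<close>

definition ss_E1_map ::
  "(nat \<Rightarrow> nat \<Rightarrow> 'c monoid) \<Rightarrow> (nat \<Rightarrow> nat \<Rightarrow> 'c \<Rightarrow> 'c) \<Rightarrow> nat \<Rightarrow> nat \<Rightarrow> (nat \<Rightarrow> 'c) set \<Rightarrow> 'c set" where
  "ss_E1_map C d' p q = homology_map (\<lambda>n. C n p) (\<lambda>n. d' n p) q (\<lambda>x. x p)"

text \<open>For \<open>r > max p (q + 1)\<close> the page \<open>E\<^sup>r\<^bsub>p,q\<^esub>\<close> no longer depends on \<open>r\<close>, see \<open>ss_E_stable\<close>.\<close>

definition ss_E_infinity ::
  "(nat \<Rightarrow> nat \<Rightarrow> 'c monoid) \<Rightarrow> (nat \<Rightarrow> nat \<Rightarrow> 'c \<Rightarrow> 'c) \<Rightarrow> (nat \<Rightarrow> nat \<Rightarrow> 'c \<Rightarrow> 'c) \<Rightarrow>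
     nat \<Rightarrow> nat \<Rightarrow> (nat \<Rightarrow> 'c) set monoid" where
  "ss_E_infinity C d' d'' p q = ss_E C d' d'' (p + q + 2) p q"

lemma tot_filt_neg: "s < 0 \<Longrightarrow> t < 0 \<Longrightarrow> tot_filt C s n = tot_filt C t n"
  by (force simp: tot_filt_def)

lemma tot_filt_top: "int n \<le> s \<Longrightarrow> int n \<le> t \<Longrightarrow> tot_filt C s n = tot_filt C t n"
  by (force simp: tot_filt_def)

lemma ss_E_stable:
  assumes "r > max p (q + 1)"
  shows "ss_E C d' d'' r p q = ss_E_infinity C d' d'' p q"
proof -
  have a: "tot_filt C (int p - int r) m = tot_filt C (int p - int (p + q + 2)) m" for m
    using assms by (intro tot_filt_neg) auto
  have b: "tot_filt C (int p + int r - 1) (p + q + 1)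
         = tot_filt C (int p + int (p + q + 2) - 1) (p + q + 1)"
    using assms by (intro tot_filt_top) auto
  have "ss_Z C d' d'' (int r) (int p) (p + q)
      = ss_Z C d' d'' (int (p + q + 2)) (int p) (p + q)"
    unfolding ss_Z_def by (simp only: a)
  moreover have "ss_B C d' d'' r p q = ss_B C d' d'' (p + q + 2) p q"
  proof -
    have "ss_Z C d' d'' (int r - 1) (int p - 1) (p + q)
        = ss_Z C d' d'' (int (p + q + 2) - 1) (int p - 1) (p + q)"
      using a[of "p + q - 1"] unfolding ss_Z_def by simp
    moreover have "ss_Z C d' d'' (int r - 1) (int p + int r - 1) (p + q + 1)
        = ss_Z C d' d'' (int (p + q + 2) - 1) (int p + int (p + q + 2) - 1) (p + q + 1)"
      using b unfolding ss_Z_def by simp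
    ultimately show ?thesis unfolding ss_B_def by simp
  qed
  ultimately show ?thesis
    unfolding ss_E_infinity_def ss_E_def by simp
qed

definition converges_to :: "(nat \<Rightarrow> nat \<Rightarrow> 'e monoid) \<Rightarrow> (nat \<Rightarrow> 'h monoid) \<Rightarrow> bool" where
  "converges_to E H \<longleftrightarrow>
     (\<forall>n. \<exists>F :: int \<Rightarrow> 'h set.
        F (-1) = {\<one>\<^bsub>H n\<^esub>} \<and> F (int n) = carrier (H n) \<and>
        (\<forall>p\<in>{-1..int n}. subgroup (F p) (H n)) \<and>
        (\<forall>p\<in>{0..int n}. F (p - 1) \<subseteq> F p) \<and>
        (\<forall>p q. p + q = n \<longrightarrow> E p q \<cong> (H n)\<lparr>carrier := F (int p)\<rparr> Mod F (int p - 1)))"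

end

theory Submission
  imports Defs
begin

text \<open>
  Since the fibres are finite, \<open>f\<close> is injective on every simplex, so an ordered simplex of
  \<open>W\<^sup>k(f)\<close> is a \<open>k\<close>-tuple of ordered simplices of \<open>X\<close> with a common image in \<open>Y\<close>. In a
  fixed simplicial degree the complex \<open>C\<^sub>n(W\<^sup>k(f))\<close>, \<open>k \<ge> 1\<close>, augmented by \<open>f\<^sub>#\<close> to
  \<open>C\<^sub>n(Y)\<close>, is therefore a direct sum, over the ordered simplices of \<open>Y\<close>, of complexes of a full
  simplex on the fibre; the alternating chains of \<open>D\<^sup>k(f)\<close> give the corresponding exterior
  powers. Choosing a simplex in every fibre yields a contracting homotopy in both cases (insertion
  as first component, respectively antisymmetrized insertion), so the rows are exact and the
  homology of the total complex is \<open>H\<^sub>*(Y)\<close>. The filtration of \<open>H\<^sub>*(Y)\<close> consists of the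
  images of the cycles of filtration degree at most \<open>p\<close>.
\<close>

section \<open>Maps between quotients of subgroups\<close>

text \<open>Chains are free on vertex lists, so an ordered simplex of a k-fold space is literally a
  matrix whose rows are ordered simplices of the source. Inserting, dropping or permuting rows never
  disturbs the order of the vertices, and no orientation quotient intervenes. The obstacle in the
  alternating case is the closure in the definition of D^k, which can contain simplices with
  repeated components. Alternation removes it: a matrix with two equal rows is fixed by a
  transposition, so its coefficient vanishes, while pairwise distinct rows over one image have
  distinct barycenters and thus come from a strict multiple point. Both double complexes therefore
  live on the same tuples and differ in a symmetry condition and in d'', so one abstract argument
  serves both. That argument works with cycles of the total complex instead of their homology
  classes. A staircase shows that the map induced by the augmentation is onto on cycles and that its
  kernel is exactly the boundaries. This determines the groups divided out on the infinity
  page.\<close>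

lemma coset_map_r_coset:
  assumes "group G" "subgroup Z G" "comm_group G'" "subgroup N' G'"
    and g: "\<And>x. x \<in> Z \<Longrightarrow> g x \<in> carrier G'"
    and gm: "\<And>x y. x \<in> Z \<Longrightarrow> y \<in> Z \<Longrightarrow> g (x \<otimes>\<^bsub>G\<^esub> y) = g x \<otimes>\<^bsub>G'\<^esub> g y"
    and N: "subgroup N G" "N \<subseteq> Z" "\<And>x. x \<in> N \<Longrightarrow> g x \<in> N'"
    and x: "x \<in> Z"
  shows "coset_map G' N' g (N #>\<^bsub>G\<^esub> x) = N' #>\<^bsub>G'\<^esub> g x"
proof -
  interpret G': comm_group G' by fact
  interpret N': subgroup N' G' by fact
  interpret G: group G by fact
  interpret N: subgroup N G by fact
  have gnx: "g (n \<otimes>\<^bsub>G\<^esub> x) = g n \<otimes>\<^bsub>G'\<^esub> g x" if "n \<in> N" for n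
    using gm N(2) x that by blast
  show ?thesis
    unfolding coset_map_def
  proof (intro subset_antisym subsetI)
    fix y assume "y \<in> N' <#>\<^bsub>G'\<^esub> g ` (N #>\<^bsub>G\<^esub> x)"
    then obtain a n where an: "a \<in> N'" "n \<in> N" "y = a \<otimes>\<^bsub>G'\<^esub> g (n \<otimes>\<^bsub>G\<^esub> x)"
      by (auto simp: set_mult_def r_coset_def)
    then have "y = (a \<otimes>\<^bsub>G'\<^esub> g n) \<otimes>\<^bsub>G'\<^esub> g x"
      using gnx[OF an(2)] N(3)[OF an(2)] g[OF x] by (simp add: G'.m_assoc)
    then show "y \<in> N' #>\<^bsub>G'\<^esub> g x"
      using an N(3) by (auto simp: r_coset_def)
  next
    fix y assume "y \<in> N' #>\<^bsub>G'\<^esub> g x"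
    then obtain a where a: "a \<in> N'" "y = a \<otimes>\<^bsub>G'\<^esub> g x" by (auto simp: r_coset_def)
    let ?e = "g \<one>\<^bsub>G\<^esub>"
    have e: "?e \<in> N'" using N(3) by simp
    \<comment> \<open>The element of N chosen is the unit. Its image is only known to lie in N', so
      \<open>a\<close> is corrected by the inverse of that image.\<close>
    have "y = (a \<otimes>\<^bsub>G'\<^esub> inv\<^bsub>G'\<^esub> ?e) \<otimes>\<^bsub>G'\<^esub> g (\<one>\<^bsub>G\<^esub> \<otimes>\<^bsub>G\<^esub> x)"
    proof -
      have "(a \<otimes>\<^bsub>G'\<^esub> inv\<^bsub>G'\<^esub> ?e) \<otimes>\<^bsub>G'\<^esub> ?e = a"
        using e a(1) by (simp add: G'.m_assoc)
      then show ?thesis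
        using gnx[OF N.one_closed] a e g[OF x] by (simp add: G'.m_assoc[symmetric])
    qed
    then show "y \<in> N' <#>\<^bsub>G'\<^esub> g ` (N #>\<^bsub>G\<^esub> x)"
      using e a(1) N.one_closed unfolding set_mult_def r_coset_def by blast
  qed
qed

lemma carrier_subquotient: "carrier (G\<lparr>carrier := Z\<rparr> Mod N) = (\<lambda>x. N #>\<^bsub>G\<^esub> x) ` Z"
  by (auto simp: FactGroup_def RCOSETS_def)

lemma (in comm_group) normal_subquotient:
  assumes "subgroup Z G" "subgroup N G" "N \<subseteq> Z"
  shows "N \<lhd> G\<lparr>carrier := Z\<rparr>"
proof -
  interpret Z: comm_group "G\<lparr>carrier := Z\<rparr>"
    by (rule group.group_comm_groupI[OF subgroup_imp_group[OF assms(1)]])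
      (use m_comm subgroup.mem_carrier[OF assms(1)] in auto)
  show ?thesis
    unfolding Z.normal_iff_subgroup using assms by (simp add: subgroup_incl)
qed

lemma (in comm_group) comm_group_subquotient:
  assumes "subgroup Z G" "subgroup N G" "N \<subseteq> Z"
  shows "comm_group (G\<lparr>carrier := Z\<rparr> Mod N)"
proof -
  interpret Z: comm_group "G\<lparr>carrier := Z\<rparr>"
    by (rule group.group_comm_groupI[OF subgroup_imp_group[OF assms(1)]])
      (use m_comm subgroup.mem_carrier[OF assms(1)] in auto)
  show ?thesis
    using Z.abelian_FactGroup normal_subquotient[OF assms] Z.normal_iff_subgroup by blast
qed

lemma (in comm_group) r_coset_mult:
  assumes "subgroup N G" "x \<in> carrier G" "y \<in> carrier G"
  shows "(N #> x) <#> (N #> y) = N #> (x \<otimes> y)"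
  using normal.rcos_sum[OF _ assms(2,3)] assms(1) normal_iff_subgroup by blast

lemma (in comm_group) r_coset_eq_self_iff:
  assumes "subgroup N G" "x \<in> carrier G"
  shows "N #> x = N \<longleftrightarrow> x \<in> N"
  using coset_join1[OF _ assms(2,1)] coset_join2[OF assms(2,1)] by blast

lemma subgroup_preimage:
  assumes "group G" "subgroup Z G" "group G'" "subgroup N' G'"
    and g: "\<And>x. x \<in> Z \<Longrightarrow> g x \<in> carrier G'"
    and gm: "\<And>x y. x \<in> Z \<Longrightarrow> y \<in> Z \<Longrightarrow> g (x \<otimes>\<^bsub>G\<^esub> y) = g x \<otimes>\<^bsub>G'\<^esub> g y"
  shows "subgroup {x \<in> Z. g x \<in> N'} G"
proof -
  interpret Z: subgroup Z G by fact
  interpret G: group G by fact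
  interpret h: group_hom "G\<lparr>carrier := Z\<rparr>" G' g
    using assms G.subgroup_imp_group[OF assms(2)]
    by (auto simp: group_hom_def group_hom_axioms_def hom_def)
  show ?thesis
  proof (rule G.subgroupI)
    have "g \<one>\<^bsub>G\<^esub> \<in> N'" using h.hom_one subgroup.one_closed[OF assms(4)] by simp
    then show "{x \<in> Z. g x \<in> N'} \<noteq> {}" using Z.one_closed by blast
    fix x assume x: "x \<in> {x \<in> Z. g x \<in> N'}"
    then have "g (inv\<^bsub>G\<^esub> x) = inv\<^bsub>G'\<^esub> g x"
      using h.hom_inv[of x] G.m_inv_consistent[OF assms(2)] by simp
    then show "inv\<^bsub>G\<^esub> x \<in> {x \<in> Z. g x \<in> N'}"
      using x subgroup.m_inv_closed[OF assms(4)] Z.m_inv_closed by simp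
    fix y assume "y \<in> {x \<in> Z. g x \<in> N'}"
    then show "x \<otimes>\<^bsub>G\<^esub> y \<in> {x \<in> Z. g x \<in> N'}"
      using x gm subgroup.m_closed[OF assms(4)] Z.m_closed by simp
  qed (use Z.subset in blast)
qed

text \<open>First isomorphism theorem for x |-> N' + g x on Z: it is onto because g maps Z onto Z',
  and its kernel is N by hypothesis. It identifies the first page with the homology of the columns
  and the infinity page with the graded pieces of the limit. Additivity of g is required on Z alone,
  since the edge map is additive on cycles.\<close>

lemma coset_map_iso:
  assumes G: "comm_group G" "subgroup Z G" and G': "comm_group G'" "subgroup Z' G'"
    and N': "subgroup N' G'" "N' \<subseteq> Z'"
    and g: "g ` Z = Z'"
    and gm: "\<And>x y. x \<in> Z \<Longrightarrow> y \<in> Z \<Longrightarrow> g (x \<otimes>\<^bsub>G\<^esub> y) = g x \<otimes>\<^bsub>G'\<^esub> g y"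
    and N: "N = {x \<in> Z. g x \<in> N'}"
  shows "coset_map G' N' g \<in> iso (G\<lparr>carrier := Z\<rparr> Mod N) (G'\<lparr>carrier := Z'\<rparr> Mod N')"
proof -
  interpret G: comm_group G by fact
  interpret G': comm_group G' by fact
  interpret Z: subgroup Z G by fact
  interpret Z': subgroup Z' G' by fact
  interpret N': subgroup N' G' by fact
  let ?Q = "G'\<lparr>carrier := Z'\<rparr> Mod N'"
  let ?h = "\<lambda>x. N' #>\<^bsub>G'\<^esub> g x"
  have gZ: "\<And>x. x \<in> Z \<Longrightarrow> g x \<in> Z'" using g by blast
  interpret Q: comm_group ?Q by (rule G'.comm_group_subquotient[OF G'(2) N'])
  have hom: "?h \<in> hom (G\<lparr>carrier := Z\<rparr>) ?Q"
  proof (rule homI)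
    show "?h x \<in> carrier ?Q" if "x \<in> carrier (G\<lparr>carrier := Z\<rparr>)" for x
      using that gZ by (auto simp: carrier_subquotient)
    show "?h (x \<otimes>\<^bsub>G\<lparr>carrier := Z\<rparr>\<^esub> y) = ?h x \<otimes>\<^bsub>?Q\<^esub> ?h y"
      if "x \<in> carrier (G\<lparr>carrier := Z\<rparr>)" "y \<in> carrier (G\<lparr>carrier := Z\<rparr>)" for x y
      using that gZ[THEN Z'.mem_carrier] by (simp add: G'.r_coset_mult N' gm)
  qed
  interpret h: group_hom "G\<lparr>carrier := Z\<rparr>" ?Q ?h
    using G.subgroup_imp_group[OF G(2)] Q.is_group hom
    by (simp add: group_hom_def group_hom_axioms_def)
  have one: "\<one>\<^bsub>?Q\<^esub> = N'" by (simp add: FactGroup_def)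
  have ker: "kernel (G\<lparr>carrier := Z\<rparr>) ?Q ?h = N"
    unfolding kernel_def N one using G'.r_coset_eq_self_iff[OF N'(1) gZ[THEN Z'.mem_carrier]] by auto
  have onto: "?h ` carrier (G\<lparr>carrier := Z\<rparr>) = carrier ?Q"
    using g by (auto simp: carrier_subquotient)
  have iso: "(\<lambda>X. the_elem (?h ` X)) \<in> iso (G\<lparr>carrier := Z\<rparr> Mod N) ?Q"
    using h.FactGroup_iso_set[OF onto] ker by simp
  have sub: "subgroup N G"
    unfolding N using gZ gm by (intro subgroup_preimage[OF G.is_group G(2) G'.is_group N'(1)]) auto
  \<comment> \<open>The isomorphism theorem gives the map sending X to the single element of
    \<open>?h\<close> applied to X. It agrees with \<open>coset_map\<close>, so the concrete map is
    itself the isomorphism.\<close>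
  have eq: "coset_map G' N' g X = the_elem (?h ` X)" if "X \<in> carrier (G\<lparr>carrier := Z\<rparr> Mod N)" for X
  proof -
    obtain x where x: "x \<in> Z" "X = N #>\<^bsub>G\<^esub> x" using \<open>X \<in> _\<close> by (auto simp: carrier_subquotient)
    have "coset_map G' N' g X = ?h x"
      unfolding x(2)
      by (rule coset_map_r_coset[where g = g, OF G.is_group G(2) G'(1) N'(1) _ gm sub]) (use gZ N x in auto)
    moreover have "?h ` X = {?h x}"
    proof -
      have "?h (n \<otimes>\<^bsub>G\<^esub> x) = ?h x" if "n \<in> N" for n
      proof -
        have "?h (n \<otimes>\<^bsub>G\<^esub> x) = N' #>\<^bsub>G'\<^esub> g n #>\<^bsub>G'\<^esub> g x"
          using that x N gm gZ N'.subset by (simp add: G'.coset_mult_assoc)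
        also have "N' #>\<^bsub>G'\<^esub> g n = N'" using that N G'.coset_join2[OF _ N'(1)] gZ by simp
        finally show ?thesis .
      qed
      moreover have "x \<in> X" using x sub by (metis G.rcos_self Z.mem_carrier)
      ultimately show ?thesis unfolding x(2) r_coset_def by auto
    qed
    ultimately show ?thesis by simp
  qed
  have "N \<subseteq> Z" by (auto simp: N)
  then have "group (G\<lparr>carrier := Z\<rparr> Mod N)"
    using G.comm_group_subquotient[OF G(2) sub] comm_group_def by blast
  then show ?thesis
    by (rule group.iso_eq[OF _ iso]) (rule eq)
qed

section \<open>The total complex and its filtration\<close>

locale dbl_complex =
  fixes C :: "nat \<Rightarrow> nat \<Rightarrow> 'c monoid" and d' d'' :: "nat \<Rightarrow> nat \<Rightarrow> 'c \<Rightarrow> 'c"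
  assumes double_complex: "double_complex C d' d''"
begin

abbreviation D where "D \<equiv> tot_diff C d' d''"
abbreviation T where "T \<equiv> tot C"
abbreviation F where "F \<equiv> tot_filt C"

sublocale C: comm_group "C p q" for p q
  using double_complex by (simp add: double_complex_def)

lemma hom': "d' (Suc p) q \<in> hom (C (Suc p) q) (C p q)"
  and hom'': "d'' p (Suc q) \<in> hom (C p (Suc q)) (C p q)"
  using double_complex by (simp_all add: double_complex_def)

lemma d'_closed [simp]: "c \<in> carrier (C (Suc p) q) \<Longrightarrow> d' (Suc p) q c \<in> carrier (C p q)"
  and d''_closed [simp]: "c \<in> carrier (C p (Suc q)) \<Longrightarrow> d'' p (Suc q) c \<in> carrier (C p q)"
  by (rule hom_in_carrier[OF hom'], assumption) (rule hom_in_carrier[OF hom''])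

lemma d'_one [simp]: "d' (Suc p) q \<one>\<^bsub>C (Suc p) q\<^esub> = \<one>\<^bsub>C p q\<^esub>"
  and d''_one [simp]: "d'' p (Suc q) \<one>\<^bsub>C p (Suc q)\<^esub> = \<one>\<^bsub>C p q\<^esub>"
  using hom_one[OF hom' C.is_group C.is_group] hom_one[OF hom'' C.is_group C.is_group] by simp_all

lemma d'_0 [simp]: "c \<in> carrier (C 0 q) \<Longrightarrow> d' 0 q c = \<one>\<^bsub>C 0 q\<^esub>"
  using double_complex by (simp add: double_complex_def)

lemma d'_d' [simp]: "c \<in> carrier (C (Suc (Suc p)) q) \<Longrightarrow> d' (Suc p) q (d' (Suc (Suc p)) q c) = \<one>\<^bsub>C p q\<^esub>"
  and d''_d'' [simp]: "c \<in> carrier (C p (Suc (Suc q))) \<Longrightarrow> d'' p (Suc q) (d'' p (Suc (Suc q)) c) = \<one>\<^bsub>C p q\<^esub>"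
  and d'_d'': "c \<in> carrier (C (Suc p) (Suc q)) \<Longrightarrow>
    d' (Suc p) q (d'' (Suc p) (Suc q) c) \<otimes>\<^bsub>C p q\<^esub> d'' p (Suc q) (d' (Suc p) (Suc q) c) = \<one>\<^bsub>C p q\<^esub>"
  using double_complex by (simp_all add: double_complex_def)

lemma d''_d':
  assumes "c \<in> carrier (C (Suc p) (Suc q))"
  shows "d'' p (Suc q) (d' (Suc p) (Suc q) c) = inv\<^bsub>C p q\<^esub> d' (Suc p) q (d'' (Suc p) (Suc q) c)"
  using d'_d''[OF assms] assms by (intro C.inv_equality[symmetric]) (simp_all add: C.m_comm)

lemma d'_inv: "c \<in> carrier (C (Suc p) q) \<Longrightarrow> d' (Suc p) q (inv\<^bsub>C (Suc p) q\<^esub> c) = inv\<^bsub>C p q\<^esub> d' (Suc p) q c"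
  and d''_inv: "c \<in> carrier (C p (Suc q)) \<Longrightarrow> d'' p (Suc q) (inv\<^bsub>C p (Suc q)\<^esub> c) = inv\<^bsub>C p q\<^esub> d'' p (Suc q) c"
  using group_hom.hom_inv[OF group_hom.intro[OF C.is_group C.is_group group_hom_axioms.intro[OF hom']]]
    group_hom.hom_inv[OF group_hom.intro[OF C.is_group C.is_group group_hom_axioms.intro[OF hom'']]]
  by blast+

lemma d'_mult: "x \<in> carrier (C (Suc p) q) \<Longrightarrow> y \<in> carrier (C (Suc p) q) \<Longrightarrow>
    d' (Suc p) q (x \<otimes>\<^bsub>C (Suc p) q\<^esub> y) = d' (Suc p) q x \<otimes>\<^bsub>C p q\<^esub> d' (Suc p) q y"
  and d''_mult: "x \<in> carrier (C p (Suc q)) \<Longrightarrow> y \<in> carrier (C p (Suc q)) \<Longrightarrow>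
    d'' p (Suc q) (x \<otimes>\<^bsub>C p (Suc q)\<^esub> y) = d'' p (Suc q) x \<otimes>\<^bsub>C p q\<^esub> d'' p (Suc q) y"
  using hom' hom'' by (auto simp: hom_def)

lemma carrier_tot: "carrier (T n) = (\<Pi>\<^sub>E j\<in>{..n}. carrier (C (n - j) j))"
  unfolding tot_def by (subst carrier_sum_group) auto

lemma tot_mult: "x \<otimes>\<^bsub>T n\<^esub> y = (\<lambda>j\<in>{..n}. x j \<otimes>\<^bsub>C (n - j) j\<^esub> y j)"
  and tot_one: "\<one>\<^bsub>T n\<^esub> = (\<lambda>j\<in>{..n}. \<one>\<^bsub>C (n - j) j\<^esub>)"
  unfolding tot_def by simp_all

lemma tot_closed: "x \<in> carrier (T n) \<Longrightarrow> j \<le> n \<Longrightarrow> x j \<in> carrier (C (n - j) j)"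
  by (auto simp: carrier_tot)

lemma tot_eqI:
  assumes "x \<in> carrier (T n)" "y \<in> carrier (T n)" "\<And>j. j \<le> n \<Longrightarrow> x j = y j"
  shows "x = y"
  using assms unfolding carrier_tot by (intro PiE_ext[of x _ _ y]) auto

sublocale T: comm_group "T n" for n
proof (rule group.group_comm_groupI)
  show "Group.group (T n)" unfolding tot_def by simp
  fix x y assume "x \<in> carrier (T n)" "y \<in> carrier (T n)"
  then show "x \<otimes>\<^bsub>T n\<^esub> y = y \<otimes>\<^bsub>T n\<^esub> x"
    unfolding tot_mult using C.m_comm tot_closed
    by (intro restrict_ext) auto
qed

lemma tot_inv: "x \<in> carrier (T n) \<Longrightarrow> j \<le> n \<Longrightarrow> (inv\<^bsub>T n\<^esub> x) j = inv\<^bsub>C (n - j) j\<^esub> x j"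
  unfolding tot_def by simp

lemma D_0 [simp]: "D 0 x = \<one>\<^bsub>T 0\<^esub>"
  by (simp add: tot_diff_def)

lemma D_Suc:
  assumes "j \<le> n"
  shows "D (Suc n) x j =
    d' (Suc (n - j)) j (x j) \<otimes>\<^bsub>C (n - j) j\<^esub> d'' (n - j) (Suc j) (x (Suc j))"
  using assms by (simp add: tot_diff_def Suc_diff_le)

lemma D_closed [unfolded One_nat_def, simp]:
  assumes "x \<in> carrier (T n)"
  shows "D n x \<in> carrier (T (n - 1))"
proof (cases n)
  case 0
  then show ?thesis by simp
next
  case (Suc m)
  have "D n x j \<in> carrier (C (m - j) j)" if "j \<le> m" for j
    using tot_closed[OF assms, of j] tot_closed[OF assms, of "Suc j"] that
    by (simp add: D_Suc Suc Suc_diff_le)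
  moreover have "D n x \<in> extensional {..m}" by (simp add: tot_diff_def Suc)
  ultimately show ?thesis by (auto simp: carrier_tot Suc PiE_iff)
qed

lemma D_mult:
  assumes "x \<in> carrier (T n)" "y \<in> carrier (T n)"
  shows "D n (x \<otimes>\<^bsub>T n\<^esub> y) = D n x \<otimes>\<^bsub>T (n - 1)\<^esub> D n y"
proof (rule tot_eqI[of _ "n - 1"])
  fix j assume j: "j \<le> n - 1"
  show "D n (x \<otimes>\<^bsub>T n\<^esub> y) j = (D n x \<otimes>\<^bsub>T (n - 1)\<^esub> D n y) j"
  proof (cases n)
    case 0
    then show ?thesis by simp
  next
    case (Suc m)
    have jm: "j \<le> m" "j \<le> n" "Suc j \<le> n" using j Suc by auto
    note c = tot_closed[OF assms(1) jm(2)] tot_closed[OF assms(1) jm(3)]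
      tot_closed[OF assms(2) jm(2)] tot_closed[OF assms(2) jm(3)]
    have c': "x j \<in> carrier (C (Suc (m - j)) j)" "y j \<in> carrier (C (Suc (m - j)) j)"
      "x (Suc j) \<in> carrier (C (m - j) (Suc j))" "y (Suc j) \<in> carrier (C (m - j) (Suc j))"
      using c jm by (simp_all add: Suc Suc_diff_le)
    have "D n (x \<otimes>\<^bsub>T n\<^esub> y) j = d' (Suc (m - j)) j (x j \<otimes>\<^bsub>C (Suc (m - j)) j\<^esub> y j)
        \<otimes>\<^bsub>C (m - j) j\<^esub> d'' (m - j) (Suc j) (x (Suc j) \<otimes>\<^bsub>C (m - j) (Suc j)\<^esub> y (Suc j))"
      using jm by (simp add: tot_mult Suc D_Suc Suc_diff_le)
    also have "\<dots> = D n x j \<otimes>\<^bsub>C (m - j) j\<^esub> D n y j"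
      using c' jm by (simp add: Suc D_Suc d'_mult d''_mult C.m_ac)
    also have "\<dots> = (D n x \<otimes>\<^bsub>T (n - 1)\<^esub> D n y) j"
      using jm by (simp add: tot_mult Suc)
    finally show ?thesis .
  qed
qed (use assms in simp_all)

lemma hom_D: "D n \<in> hom (T n) (T (n - 1))"
  by (intro homI D_mult) simp_all

lemma D_one [unfolded One_nat_def, simp]: "D n \<one>\<^bsub>T n\<^esub> = \<one>\<^bsub>T (n - 1)\<^esub>"
  using hom_one[OF hom_D T.is_group T.is_group] .

lemma D_inv: "x \<in> carrier (T n) \<Longrightarrow> D n (inv\<^bsub>T n\<^esub> x) = inv\<^bsub>T (n - 1)\<^esub> D n x"
  using group_hom.hom_inv[OF group_hom.intro[OF T.is_group T.is_group group_hom_axioms.intro[OF hom_D]]] .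

lemma D_D:
  assumes "x \<in> carrier (T (Suc n))"
  shows "D n (D (Suc n) x) = \<one>\<^bsub>T (n - 1)\<^esub>"
proof (cases n)
  case (Suc m)
  show ?thesis
  proof (rule tot_eqI[of _ "n - 1"])
    show "D n (D (Suc n) x) \<in> carrier (T (n - 1))"
      using D_closed[OF D_closed[OF assms]] by simp
    fix j assume j: "j \<le> n - 1"
    have jm: "j \<le> m" "j \<le> Suc n" "Suc j \<le> Suc n" "Suc (Suc j) \<le> Suc n" using j Suc by auto
    note c = tot_closed[OF assms jm(2)] tot_closed[OF assms jm(3)] tot_closed[OF assms jm(4)]
    have c': "x j \<in> carrier (C (Suc (Suc (m - j))) j)"
      "x (Suc j) \<in> carrier (C (Suc (m - j)) (Suc j))"
      "x (Suc (Suc j)) \<in> carrier (C (m - j) (Suc (Suc j)))"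
      using c jm by (simp_all add: Suc Suc_diff_le)
    have "D n (D (Suc n) x) j =
        d' (Suc (m - j)) j (d' (Suc (Suc (m - j))) j (x j) \<otimes>\<^bsub>C (Suc (m - j)) j\<^esub>
          d'' (Suc (m - j)) (Suc j) (x (Suc j))) \<otimes>\<^bsub>C (m - j) j\<^esub>
        d'' (m - j) (Suc j) (d' (Suc (m - j)) (Suc j) (x (Suc j)) \<otimes>\<^bsub>C (m - j) (Suc j)\<^esub>
          d'' (m - j) (Suc (Suc j)) (x (Suc (Suc j))))"
      using jm by (simp add: Suc D_Suc Suc_diff_le)
    \<comment> \<open>The outer terms vanish because d' d' and d'' d'' are trivial; the two mixed
      terms cancel by anticommutation.\<close>
    also have "\<dots> = d' (Suc (m - j)) j (d'' (Suc (m - j)) (Suc j) (x (Suc j))) \<otimes>\<^bsub>C (m - j) j\<^esub>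
        d'' (m - j) (Suc j) (d' (Suc (m - j)) (Suc j) (x (Suc j)))"
      using c' by (simp add: d'_mult d''_mult)
    also have "\<dots> = \<one>\<^bsub>T (n - 1)\<^esub> j"
      using c' jm by (simp add: d'_d'' tot_one Suc)
    finally show "D n (D (Suc n) x) j = \<one>\<^bsub>T (n - 1)\<^esub> j" .
  qed (rule T.one_closed)
qed (simp only: D_0 diff_0_eq_0)

definition single :: "nat \<Rightarrow> nat \<Rightarrow> 'c \<Rightarrow> nat \<Rightarrow> 'c" where
  "single n p c = (\<lambda>j\<in>{..n}. if j = p then c else \<one>\<^bsub>C (n - j) j\<^esub>)"

lemma single_closed: "p \<le> n \<Longrightarrow> c \<in> carrier (C (n - p) p) \<Longrightarrow> single n p c \<in> carrier (T n)"
  by (auto simp: single_def carrier_tot)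

lemma single_in_filt: "p \<le> n \<Longrightarrow> c \<in> carrier (C (n - p) p) \<Longrightarrow> int p \<le> s \<Longrightarrow> single n p c \<in> F s n"
  using single_closed by (auto simp: tot_filt_def single_def)

lemma filt_subset: "F s n \<subseteq> carrier (T n)"
  by (auto simp: tot_filt_def)

lemma filtD: "x \<in> F s n \<Longrightarrow> j \<le> n \<Longrightarrow> s < int j \<Longrightarrow> x j = \<one>\<^bsub>C (n - j) j\<^esub>"
  by (auto simp: tot_filt_def)

lemma filt_mono: "s \<le> t \<Longrightarrow> F s n \<subseteq> F t n"
  by (auto simp: tot_filt_def)

lemma filt_top: "int n \<le> s \<Longrightarrow> F s n = carrier (T n)"
  by (auto simp: tot_filt_def)

lemma one_in_filt: "\<one>\<^bsub>T n\<^esub> \<in> F s n"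
proof -
  have "\<one>\<^bsub>T n\<^esub> j = \<one>\<^bsub>C (n - j) j\<^esub>" if "j \<le> n" for j
    using that by (simp only: tot_one restrict_apply atMost_iff if_True)
  then show ?thesis using T.one_closed unfolding tot_filt_def by blast
qed

lemma filt_neg: "s < 0 \<Longrightarrow> F s n = {\<one>\<^bsub>T n\<^esub>}"
proof (intro subset_antisym subsetI)
  fix x assume s: "s < 0" and x: "x \<in> F s n"
  have "x = \<one>\<^bsub>T n\<^esub>"
  proof (rule tot_eqI)
    show "x j = \<one>\<^bsub>T n\<^esub> j" if "j \<le> n" for j
      using filtD[OF x that] s filtD[OF one_in_filt that, of s] by simp
  qed (use x filt_subset in blast, rule T.one_closed)
  then show "x \<in> {\<one>\<^bsub>T n\<^esub>}" by blast
qed (use one_in_filt in blast)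

lemma subgroup_filt: "subgroup (F s n) (T n)"
proof (rule T.subgroupI)
  show "F s n \<noteq> {}" using one_in_filt by blast
  fix x assume x: "x \<in> F s n"
  then have xc: "x \<in> carrier (T n)" using filt_subset by blast
  have "(inv\<^bsub>T n\<^esub> x) j = \<one>\<^bsub>C (n - j) j\<^esub>" if "j \<le> n" "s < int j" for j
    using tot_inv[OF xc that(1)] filtD[OF x that] by simp
  then show "inv\<^bsub>T n\<^esub> x \<in> F s n"
    using T.inv_closed[OF xc] by (simp add: tot_filt_def)
  fix y assume y: "y \<in> F s n"
  then have yc: "y \<in> carrier (T n)" using filt_subset by blast
  have "(x \<otimes>\<^bsub>T n\<^esub> y) j = \<one>\<^bsub>C (n - j) j\<^esub>" if "j \<le> n" "s < int j" for j
    using filtD[OF x that] filtD[OF y that] that by (simp add: tot_mult)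
  then show "x \<otimes>\<^bsub>T n\<^esub> y \<in> F s n"
    using T.m_closed[OF xc yc] by (simp add: tot_filt_def)
qed (rule filt_subset)

text \<open>Component j of D x involves x j and x (j + 1) and no component of smaller index, so D
  never raises the filtration degree.\<close>

lemma D_filt:
  assumes "x \<in> F s n"
  shows "D n x \<in> F s (n - 1)"
proof (cases n)
  case 0
  then show ?thesis using subgroup.one_closed[OF subgroup_filt[of s 0]] by simp
next
  case (Suc m)
  have x: "x \<in> carrier (T n)" using assms filt_subset by blast
  have "D n x j = \<one>\<^bsub>C (m - j) j\<^esub>" if "j \<le> m" "s < int j" for j
  proof -
    have "x j = \<one>\<^bsub>C (n - j) j\<^esub>" "x (Suc j) = \<one>\<^bsub>C (n - Suc j) (Suc j)\<^esub>"
      using filtD[OF assms] that Suc by auto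
    then show ?thesis using that by (simp add: Suc D_Suc Suc_diff_le)
  qed
  then show ?thesis using D_closed[OF x] Suc by (simp add: tot_filt_def)
qed

lemma subgroup_Z: "subgroup (ss_Z C d' d'' r s n) (T n)"
proof -
  have "ss_Z C d' d'' r s n = F s n \<inter> {x \<in> carrier (T n). D n x \<in> F (s - r) (n - 1)}"
    using filt_subset by (auto simp: ss_Z_def)
  moreover have "subgroup {x \<in> carrier (T n). D n x \<in> F (s - r) (n - 1)} (T n)"
  proof (rule T.subgroupI)
    interpret F': subgroup "F (s - r) (n - 1)" "T (n - 1)" by (rule subgroup_filt)
    show "{x \<in> carrier (T n). D n x \<in> F (s - r) (n - 1)} \<noteq> {}"
      using F'.one_closed T.one_closed[of n] D_one[of n] by auto
  qed (auto simp: D_mult D_inv subgroup.m_inv_closed[OF subgroup_filt] subgroup.m_closed[OF subgroup_filt])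
  ultimately show ?thesis
    using T.subgroups_Inter_pair[OF subgroup_filt] by simp
qed

end

section \<open>Cycles, boundaries and homology of a chain complex of abelian groups\<close>

locale chain_complex =
  fixes X :: "nat \<Rightarrow> 'c monoid" and d :: "nat \<Rightarrow> 'c \<Rightarrow> 'c"
  assumes comm_group_X: "comm_group (X n)"
    and d_closed: "c \<in> carrier (X (Suc n)) \<Longrightarrow> d (Suc n) c \<in> carrier (X n)"
    and d_mult: "c \<in> carrier (X (Suc n)) \<Longrightarrow> c' \<in> carrier (X (Suc n)) \<Longrightarrow>
      d (Suc n) (c \<otimes>\<^bsub>X (Suc n)\<^esub> c') = d (Suc n) c \<otimes>\<^bsub>X n\<^esub> d (Suc n) c'"
    and d_0: "c \<in> carrier (X 0) \<Longrightarrow> d 0 c = \<one>\<^bsub>X 0\<^esub>"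
    and d_d: "c \<in> carrier (X (Suc (Suc n))) \<Longrightarrow> d (Suc n) (d (Suc (Suc n)) c) = \<one>\<^bsub>X n\<^esub>"
begin

sublocale X: comm_group "X n" for n
  by (rule comm_group_X)

lemma hom_d: "d (Suc n) \<in> hom (X (Suc n)) (X n)"
  using d_closed d_mult by (intro homI) auto

lemma group_hom_d: "group_hom (X (Suc n)) (X n) (d (Suc n))"
  using hom_d by (intro group_hom.intro group_hom_axioms.intro X.is_group)

lemma subgroup_cycles: "subgroup (cycles X d n) (X n)"
proof (cases n)
  case 0
  then have "cycles X d n = carrier (X n)" by (auto simp: cycles_def d_0)
  then show ?thesis using X.subgroup_self by simp
next
  case (Suc m)
  then have "cycles X d n = kernel (X (Suc m)) (X m) (d (Suc m))"
    by (auto simp: cycles_def kernel_def)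
  then show ?thesis using group_hom.subgroup_kernel[OF group_hom_d] Suc by simp
qed

lemma subgroup_boundaries: "subgroup (boundaries X d n) (X n)"
  unfolding boundaries_def by (rule group_hom.img_is_subgroup[OF group_hom_d])

lemma boundaries_subset_cycles: "boundaries X d n \<subseteq> cycles X d n"
proof -
  have "d n (d (Suc n) c) = \<one>\<^bsub>X (n - 1)\<^esub>" if "c \<in> carrier (X (Suc n))" for c
    using that by (cases n) (simp_all add: d_0 d_d d_closed)
  then show ?thesis by (auto simp: boundaries_def cycles_def d_closed)
qed

lemma comm_group_homology: "comm_group (homology X d n)"
  unfolding homology_def
  by (rule X.comm_group_subquotient[OF subgroup_cycles subgroup_boundaries boundaries_subset_cycles])

end

context dbl_complex
begin

sublocale column: chain_complex "\<lambda>n. C n p" "\<lambda>n. d' n p" for p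
  by unfold_locales (simp_all add: d'_mult)

sublocale tot: chain_complex T D
proof unfold_locales
  show "D (Suc n) c \<in> carrier (T n)" if "c \<in> carrier (T (Suc n))" for n c
    using D_closed[OF that] by simp
  show "D (Suc n) (c \<otimes>\<^bsub>T (Suc n)\<^esub> c') = D (Suc n) c \<otimes>\<^bsub>T n\<^esub> D (Suc n) c'"
    if "c \<in> carrier (T (Suc n))" "c' \<in> carrier (T (Suc n))" for n c c'
    using D_mult[OF that] by simp
  show "D (Suc n) (D (Suc (Suc n)) c) = \<one>\<^bsub>T n\<^esub>" if "c \<in> carrier (T (Suc (Suc n)))" for n c
    using D_D[OF that] by simp
qed simp

lemma Z_0: "ss_Z C d' d'' 0 s n = F s n"
  using D_filt by (auto simp: ss_Z_def)

section \<open>The first page\<close>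

text \<open>The contribution of d'' would come from component p + 1, which is trivial in filtration
  degree p. On leading components D therefore acts as d', and this computes the first page.\<close>

lemma D_component_top:
  assumes "x \<in> F (int p) (Suc (p + q))"
  shows "D (Suc (p + q)) x p = d' (Suc q) p (x p)"
proof -
  have "x (Suc p) = \<one>\<^bsub>C q (Suc p)\<^esub>" using filtD[OF assms, of "Suc p"] by simp
  moreover have "x p \<in> carrier (C (Suc q) p)"
    using tot_closed[of x "Suc (p + q)" p] assms filt_subset by auto
  ultimately show ?thesis by (simp add: D_Suc)
qed

lemma filt_pred_iff:
  assumes "x \<in> F (int p) n" "p \<le> n"
  shows "x \<in> F (int p - 1) n \<longleftrightarrow> x p = \<one>\<^bsub>C (n - p) p\<^esub>"
proof -
  have "x j = \<one>\<^bsub>C (n - j) j\<^esub>" if "x p = \<one>\<^bsub>C (n - p) p\<^esub>" "j \<le> n" "int p - 1 < int j" for j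
  proof (cases "j = p")
    case False
    then have "int p < int j" using that(3) by simp
    then show ?thesis by (rule filtD[OF assms(1) that(2)])
  qed (simp add: that(1))
  moreover have "x \<in> carrier (T n)" using assms(1) filt_subset by blast
  ultimately have "x \<in> F (int p - 1) n" if "x p = \<one>\<^bsub>C (n - p) p\<^esub>"
    using that by (simp add: tot_filt_def)
  then show ?thesis using filtD[of x "int p - 1" n p] assms(2) by fastforce
qed

text \<open>D x drops to filtration degree p - 1 exactly when its leading component, d' applied to x
  p, is trivial.\<close>

lemma Z_1_iff:
  "x \<in> ss_Z C d' d'' 1 (int p) (p + q) \<longleftrightarrow>
    x \<in> F (int p) (p + q) \<and> x p \<in> cycles (\<lambda>n. C n p) (\<lambda>n. d' n p) q"
proof (cases "x \<in> F (int p) (p + q)")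
  case x: True
  then have xc: "x \<in> carrier (T (p + q))" using filt_subset by blast
  then have xp: "x p \<in> carrier (C q p)" using tot_closed[OF xc, of p] by simp
  show ?thesis
  proof (cases q)
    case 0
    \<comment> \<open>For q = 0 the chain D x has total degree p - 1, where filtration degree p - 1
      imposes no condition; likewise every element of C_{0,p} is a cycle.\<close>
    have "D p x \<in> F (int p - 1) (p - 1)"
    proof (cases p)
      case 0 then show ?thesis by (simp add: one_in_filt)
    next
      case (Suc p')
      then show ?thesis using D_closed[OF xc] 0 filt_top[of "p - 1" "int p - 1"] by simp
    qed
    then show ?thesis using 0 x xp by (simp add: ss_Z_def cycles_def)
  next
    case (Suc q')
    then show ?thesis
      using x xp filt_pred_iff[of "D (p + q) x" p "p + q'"] D_filt[OF x] D_component_top[of x p q']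
      by (simp add: ss_Z_def cycles_def)
  qed
qed (simp add: ss_Z_def)

text \<open>For r = 1 the group divided out is F_{p-1} + D F_p. The first summand has trivial
  component p, and the second contributes all d'-boundaries there.\<close>

lemma B_1_iff:
  "x \<in> ss_B C d' d'' 1 p q \<longleftrightarrow>
    x \<in> ss_Z C d' d'' 1 (int p) (p + q) \<and> x p \<in> boundaries (\<lambda>n. C n p) (\<lambda>n. d' n p) q"
proof -
  let ?n = "p + q"
  have B: "ss_B C d' d'' 1 p q = F (int p - 1) ?n <#>\<^bsub>T ?n\<^esub> D (Suc ?n) ` F (int p) (Suc ?n)"
    by (simp add: ss_B_def Z_0)
  show ?thesis
  proof
    assume "x \<in> ss_B C d' d'' 1 p q"
    then obtain a y where a: "a \<in> F (int p - 1) ?n" and y: "y \<in> F (int p) (Suc ?n)"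
      and x: "x = a \<otimes>\<^bsub>T ?n\<^esub> D (Suc ?n) y"
      unfolding B set_mult_def by blast
    have yp: "y p \<in> carrier (C (Suc q) p)"
      using tot_closed[of y "Suc ?n" p] y filt_subset by auto
    have a1: "a p = \<one>\<^bsub>C q p\<^esub>" using filtD[OF a, of p] by simp
    have xF: "x \<in> F (int p) ?n"
      unfolding x using a D_filt[OF y] filt_mono[of "int p - 1" "int p" ?n]
      by (intro subgroup.m_closed[OF subgroup_filt]) auto
    have "x p = d' (Suc q) p (y p)"
      unfolding x tot_mult using a1 D_component_top[OF y] yp by simp
    then have "x p \<in> boundaries (\<lambda>n. C n p) (\<lambda>n. d' n p) q"
      using yp by (auto simp: boundaries_def)
    then show "x \<in> ss_Z C d' d'' 1 (int p) ?n \<and> x p \<in> boundaries (\<lambda>n. C n p) (\<lambda>n. d' n p) q"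
      using xF column.boundaries_subset_cycles by (auto simp: Z_1_iff)
  next
    assume "x \<in> ss_Z C d' d'' 1 (int p) ?n \<and> x p \<in> boundaries (\<lambda>n. C n p) (\<lambda>n. d' n p) q"
    then obtain c where x: "x \<in> F (int p) ?n" and c: "c \<in> carrier (C (Suc q) p)"
      and xp: "x p = d' (Suc q) p c"
      by (auto simp: Z_1_iff boundaries_def)
    define y where "y = single (Suc ?n) p c"
    have y: "y \<in> F (int p) (Suc ?n)" unfolding y_def using c by (intro single_in_filt) auto
    have yp: "y p = c" by (simp add: y_def single_def)
    \<comment> \<open>Subtracting D of a chain concentrated in degree p kills the leading component,
      so the remainder lies one filtration step lower.\<close>
    define a where "a = x \<otimes>\<^bsub>T ?n\<^esub> inv\<^bsub>T ?n\<^esub> D (Suc ?n) y"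
    have Dy: "D (Suc ?n) y \<in> F (int p) ?n" using D_filt[OF y] by simp
    have xc: "x \<in> carrier (T ?n)" and Dyc: "D (Suc ?n) y \<in> carrier (T ?n)"
      using x Dy filt_subset by blast+
    have "a \<in> F (int p) ?n"
      unfolding a_def using x Dy subgroup_filt by (simp add: subgroup.m_closed subgroup.m_inv_closed)
    moreover have "a p = \<one>\<^bsub>C q p\<^esub>"
      unfolding a_def tot_mult using tot_inv[OF Dyc, of p] D_component_top[OF y] xp yp c by simp
    ultimately have a: "a \<in> F (int p - 1) ?n"
      by (subst filt_pred_iff) auto
    have "x = a \<otimes>\<^bsub>T ?n\<^esub> D (Suc ?n) y"
      unfolding a_def using xc Dyc by (simp add: T.m_assoc)
    then show "x \<in> ss_B C d' d'' 1 p q"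
      unfolding B set_mult_def using a y by blast
  qed
qed

theorem ss_E1_iso:
  "ss_E1_map C d' p q \<in> iso (ss_E C d' d'' 1 p q) (homology (\<lambda>n. C n p) (\<lambda>n. d' n p) q)"
  unfolding ss_E1_map_def homology_map_def ss_E_def homology_def
proof (rule coset_map_iso)
  let ?Z = "ss_Z C d' d'' (int 1) (int p) (p + q)"
  show "comm_group (tot C (p + q))" by (rule T.comm_group_axioms)
  show "subgroup ?Z (tot C (p + q))" by (rule subgroup_Z)
  show "comm_group (C q p)" by (rule C.comm_group_axioms)
  show "(\<lambda>x. x p) ` ?Z = cycles (\<lambda>n. C n p) (\<lambda>n. d' n p) q"
  proof (intro subset_antisym subsetI)
    fix c assume c: "c \<in> cycles (\<lambda>n. C n p) (\<lambda>n. d' n p) q"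
    then have "single (p + q) p c \<in> F (int p) (p + q)"
      by (intro single_in_filt) (auto simp: cycles_def)
    then have "single (p + q) p c \<in> ?Z" using c by (simp add: Z_1_iff single_def)
    moreover have "c = single (p + q) p c p" by (simp add: single_def)
    ultimately show "c \<in> (\<lambda>x. x p) ` ?Z" by blast
  qed (auto simp: Z_1_iff)
  show "ss_B C d' d'' 1 p q = {x \<in> ?Z. x p \<in> boundaries (\<lambda>n. C n p) (\<lambda>n. d' n p) q}"
    using B_1_iff by auto
  show "(x \<otimes>\<^bsub>T (p + q)\<^esub> y) p = x p \<otimes>\<^bsub>C q p\<^esub> y p" for x y
    by (simp add: tot_mult)
qed (rule column.subgroup_cycles column.subgroup_boundaries column.boundaries_subset_cycles)+

lemma subgroup_B_1: "subgroup (ss_B C d' d'' 1 p q) (T (p + q))"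
proof -
  have "ss_B C d' d'' 1 p q =
      {x \<in> ss_Z C d' d'' 1 (int p) (p + q). x p \<in> boundaries (\<lambda>n. C n p) (\<lambda>n. d' n p) q}"
    using B_1_iff by auto
  also have "subgroup \<dots> (T (p + q))"
  proof (rule subgroup_preimage[where g = "\<lambda>x. x p"])
    show "x p \<in> carrier (C q p)" if "x \<in> ss_Z C d' d'' 1 (int p) (p + q)" for x
      using that by (auto simp: Z_1_iff cycles_def)
    show "(x \<otimes>\<^bsub>T (p + q)\<^esub> y) p = x p \<otimes>\<^bsub>C q p\<^esub> y p" for x y
      by (simp add: tot_mult)
  qed (rule T.is_group C.is_group subgroup_Z column.subgroup_boundaries)+
  finally show ?thesis .
qed

lemma B_1_subset_Z_1: "ss_B C d' d'' 1 p q \<subseteq> ss_Z C d' d'' 1 (int p) (p + q)"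
  using B_1_iff by blast

lemma ss_E1_map_coset:
  assumes "x \<in> ss_Z C d' d'' 1 (int p) (p + q)"
  shows "ss_E1_map C d' p q (ss_B C d' d'' 1 p q #>\<^bsub>T (p + q)\<^esub> x) =
    boundaries (\<lambda>n. C n p) (\<lambda>n. d' n p) q #>\<^bsub>C q p\<^esub> x p"
  unfolding ss_E1_map_def homology_map_def
proof (rule coset_map_r_coset[where g = "\<lambda>x. x p"])
  show "x p \<in> carrier (C q p)" if "x \<in> ss_Z C d' d'' 1 (int p) (p + q)" for x
    using that column.subgroup_cycles subgroup.subset by (auto simp: Z_1_iff cycles_def)
  show "(x \<otimes>\<^bsub>T (p + q)\<^esub> y) p = x p \<otimes>\<^bsub>C q p\<^esub> y p" for x y
    by (simp add: tot_mult)
  show "x p \<in> boundaries (\<lambda>n. C n p) (\<lambda>n. d' n p) q" if "x \<in> ss_B C d' d'' 1 p q" for x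
    using that B_1_iff by blast
qed (rule T.is_group subgroup_Z C.comm_group_axioms column.subgroup_boundaries subgroup_B_1
    B_1_subset_Z_1 assms)+

lemma D_Z_1:
  assumes "x \<in> ss_Z C d' d'' 1 (int (Suc p)) (Suc (p + q))"
  shows "D (Suc (p + q)) x \<in> ss_Z C d' d'' 1 (int p) (p + q)"
proof -
  have "x \<in> carrier (T (Suc (p + q)))" using assms subgroup.subset[OF subgroup_Z] by blast
  from D_D[OF this] assms show ?thesis
    using one_in_filt[of "p + q - 1"] by (simp add: ss_Z_def)
qed

lemma D_component_pred:
  "D (Suc (p + q)) x p = d' (Suc q) p (x p) \<otimes>\<^bsub>C q p\<^esub> d'' q (Suc p) (x (Suc p))"
  by (simp add: D_Suc)

text \<open>Since d'' d' = - d' d'', the image of a boundary d' b is d' of the inverse of d'' b.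
  This makes the map induced by d'' on column homology well defined.\<close>

lemma d''_boundaries:
  assumes "c \<in> boundaries (\<lambda>n. C n (Suc p)) (\<lambda>n. d' n (Suc p)) q"
  shows "d'' q (Suc p) c \<in> boundaries (\<lambda>n. C n p) (\<lambda>n. d' n p) q"
proof -
  obtain b where b: "b \<in> carrier (C (Suc q) (Suc p))" "c = d' (Suc q) (Suc p) b"
    using assms by (auto simp: boundaries_def)
  then have "d'' q (Suc p) c = d' (Suc q) p (inv\<^bsub>C (Suc q) p\<^esub> d'' (Suc q) (Suc p) b)"
    by (simp add: d''_d' d'_inv)
  then show ?thesis using b by (simp add: boundaries_def)
qed

text \<open>Component p - 1 of D x is d' (x (p - 1)) + d'' (x p). The first summand is a boundary of
  its column, so on classes only d'' of the leading component remains.\<close>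

theorem ss_d1_eq:
  assumes "p \<ge> 1" and \<xi>: "\<xi> \<in> carrier (ss_E C d' d'' 1 p q)"
  shows "ss_E1_map C d' (p - 1) q (ss_d C d' d'' 1 p q \<xi>) =
    homology_map (\<lambda>n. C n (p - 1)) (\<lambda>n. d' n (p - 1)) q (d'' q p) (ss_E1_map C d' p q \<xi>)"
proof -
  obtain p' where p: "p = Suc p'" using assms(1) by (cases p) auto
  let ?Z = "ss_Z C d' d'' 1 (int (Suc p')) (Suc (p' + q))"
  let ?bd = "\<lambda>p. boundaries (\<lambda>n. C n p) (\<lambda>n. d' n p) q"
  obtain x where x: "x \<in> ?Z" and \<xi>: "\<xi> = ss_B C d' d'' 1 p q #>\<^bsub>T (p + q)\<^esub> x"
    using \<xi> by (auto simp: ss_E_def carrier_subquotient p)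
  have xc: "x \<in> carrier (T (Suc (p' + q)))" using x subgroup.subset[OF subgroup_Z] by blast
  have xp: "x p \<in> cycles (\<lambda>n. C n p) (\<lambda>n. d' n p) q" using x Z_1_iff[of x p q] by (simp add: p)
  have xp': "d' (Suc q) p' (x p') \<in> ?bd p'"
    using tot_closed[OF xc, of p'] by (simp add: boundaries_def Suc_diff_le)
  have "ss_d C d' d'' 1 p q \<xi> = ss_B C d' d'' 1 p' q #>\<^bsub>T (p' + q)\<^esub> D (Suc (p' + q)) x"
    unfolding \<xi> ss_d_def p add_Suc add_diff_cancel_right' diff_Suc_1
  proof (rule coset_map_r_coset[where g = "D (Suc (p' + q))" and Z = ?Z])
    show "D (Suc (p' + q)) y \<in> carrier (T (p' + q))" if "y \<in> ?Z" for y
      using that subgroup.subset[OF subgroup_Z] tot.d_closed by blast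
    show "D (Suc (p' + q)) (y \<otimes>\<^bsub>T (Suc (p' + q))\<^esub> z) =
        D (Suc (p' + q)) y \<otimes>\<^bsub>T (p' + q)\<^esub> D (Suc (p' + q)) z" if "y \<in> ?Z" "z \<in> ?Z" for y z
      using that subgroup.subset[OF subgroup_Z] tot.d_mult by blast
    show "subgroup (ss_B C d' d'' 1 (Suc p') q) (T (Suc (p' + q)))"
      using subgroup_B_1[of "Suc p'" q] by simp
    show "ss_B C d' d'' 1 (Suc p') q \<subseteq> ?Z" using B_1_subset_Z_1[of "Suc p'" q] by simp
    fix y assume "y \<in> ss_B C d' d'' 1 (Suc p') q"
    then have yZ: "y \<in> ?Z" and yp: "y (Suc p') \<in> ?bd (Suc p')" using B_1_iff[of y "Suc p'" q] by auto
    have yc: "y \<in> carrier (T (Suc (p' + q)))" using yZ subgroup.subset[OF subgroup_Z] by blast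
    have "d' (Suc q) p' (y p') \<in> ?bd p'"
      using tot_closed[OF yc, of p'] by (simp add: boundaries_def Suc_diff_le)
    then have "D (Suc (p' + q)) y p' \<in> ?bd p'"
      unfolding D_component_pred
      using d''_boundaries[OF yp] by (rule subgroup.m_closed[OF column.subgroup_boundaries])
    then show "D (Suc (p' + q)) y \<in> ss_B C d' d'' 1 p' q"
      using D_Z_1[OF yZ] B_1_iff by blast
  qed (rule T.is_group subgroup_Z T.comm_group_axioms subgroup_B_1 x)+
  then have "ss_E1_map C d' (p - 1) q (ss_d C d' d'' 1 p q \<xi>) =
      ?bd p' #>\<^bsub>C q p'\<^esub> D (Suc (p' + q)) x p'"
    using ss_E1_map_coset[OF D_Z_1[OF x]] by (simp add: p)
  also have "\<dots> = (?bd p' #>\<^bsub>C q p'\<^esub> d' (Suc q) p' (x p')) #>\<^bsub>C q p'\<^esub> d'' q p (x p)"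
    unfolding D_component_pred p using xp xp' subgroup.subset[OF column.subgroup_boundaries[of p' q]]
    by (intro C.coset_mult_assoc[symmetric]) (auto simp: cycles_def p)
  also have "?bd p' #>\<^bsub>C q p'\<^esub> d' (Suc q) p' (x p') = ?bd p'"
    using C.r_coset_eq_self_iff[OF column.subgroup_boundaries] xp'
      subgroup.subset[OF column.subgroup_boundaries[of p' q]] by blast
  also have "?bd p' #>\<^bsub>C q p'\<^esub> d'' q p (x p) =
      homology_map (\<lambda>n. C n p') (\<lambda>n. d' n p') q (d'' q p) (?bd p #>\<^bsub>C q p\<^esub> x p)"
    unfolding homology_map_def
  proof (rule coset_map_r_coset[where g = "d'' q p" and Z = "carrier (C q p)", symmetric])
    show "x p \<in> carrier (C q p)" using xp by (simp add: cycles_def)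
    show "?bd p \<subseteq> carrier (C q p)" by (rule subgroup.subset[OF column.subgroup_boundaries])
    show "d'' q p c \<in> carrier (C q p')" if "c \<in> carrier (C q p)" for c
      using that by (simp add: p)
    show "d'' q p (c \<otimes>\<^bsub>C q p\<^esub> c') = d'' q p c \<otimes>\<^bsub>C q p'\<^esub> d'' q p c'"
      if "c \<in> carrier (C q p)" "c' \<in> carrier (C q p)" for c c'
      using that by (simp add: p d''_mult)
    show "d'' q p c \<in> ?bd p'" if "c \<in> ?bd p" for c
      using d''_boundaries[of c p' q] that by (simp add: p)
  qed (rule C.is_group C.comm_group_axioms C.subgroup_self column.subgroup_boundaries)+
  also have "?bd p #>\<^bsub>C q p\<^esub> x p = ss_E1_map C d' p q \<xi>"
    unfolding \<xi> using ss_E1_map_coset[of x p q] x by (simp add: p)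
  finally show ?thesis by (simp add: p)
qed

end

section \<open>Convergence for double complexes with exact rows\<close>

text \<open>For each n the row C_{n,*} with d'' is a resolution of \<open>A n\<close> with
  augmentation \<open>e n\<close>. Exactness is asked for elementwise, without a homotopy as part of
  the data, so that rows contracted in different ways fit the same locale.\<close>

locale augmented_complex = dbl_complex C d' d'' + target: chain_complex A dA
  for C :: "nat \<Rightarrow> nat \<Rightarrow> 'c monoid" and d' d'' :: "nat \<Rightarrow> nat \<Rightarrow> 'c \<Rightarrow> 'c"
    and A :: "nat \<Rightarrow> 'e monoid" and dA :: "nat \<Rightarrow> 'e \<Rightarrow> 'e" +
  fixes e :: "nat \<Rightarrow> 'c \<Rightarrow> 'e"
  assumes hom_e: "e n \<in> hom (C n 0) (A n)"
    and e_surj: "e n ` carrier (C n 0) = carrier (A n)"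
    and e_chain: "c \<in> carrier (C (Suc n) 0) \<Longrightarrow> e n (d' (Suc n) 0 c) = dA (Suc n) (e (Suc n) c)"
    and e_d'': "c \<in> carrier (C n 1) \<Longrightarrow> e n (d'' n 1 c) = \<one>\<^bsub>A n\<^esub>"
    and exact_0: "c \<in> carrier (C n 0) \<Longrightarrow> e n c = \<one>\<^bsub>A n\<^esub> \<Longrightarrow> \<exists>b\<in>carrier (C n 1). d'' n 1 b = c"
    and exact_Suc: "c \<in> carrier (C n (Suc q)) \<Longrightarrow> d'' n (Suc q) c = \<one>\<^bsub>C n q\<^esub> \<Longrightarrow>
      \<exists>b\<in>carrier (C n (Suc (Suc q))). d'' n (Suc (Suc q)) b = c"
begin

lemma e_group_hom: "group_hom (C n 0) (A n) (e n)"
  using hom_e by (intro group_hom.intro group_hom_axioms.intro C.is_group target.X.is_group)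

lemma e_closed [simp]: "c \<in> carrier (C n 0) \<Longrightarrow> e n c \<in> carrier (A n)"
  using group_hom.hom_closed[OF e_group_hom] .

lemma e_one [simp]: "e n \<one>\<^bsub>C n 0\<^esub> = \<one>\<^bsub>A n\<^esub>"
  using group_hom.hom_one[OF e_group_hom] .

lemma e_mult: "c \<in> carrier (C n 0) \<Longrightarrow> b \<in> carrier (C n 0) \<Longrightarrow>
    e n (c \<otimes>\<^bsub>C n 0\<^esub> b) = e n c \<otimes>\<^bsub>A n\<^esub> e n b"
  using group_hom.hom_mult[OF e_group_hom] .

lemma e_inv: "c \<in> carrier (C n 0) \<Longrightarrow> e n (inv\<^bsub>C n 0\<^esub> c) = inv\<^bsub>A n\<^esub> e n c"
  using group_hom.hom_inv[OF e_group_hom] .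

text \<open>The staircase: \<open>y\<close> is built from \<open>y 0\<close> upwards, and exactness of the rows provides the
  next component.\<close>

lemma lift_step:
  assumes x: "x \<in> cycles T D n" and m: "m \<le> n"
    and y: "\<And>j. j \<le> m \<Longrightarrow> y j \<in> carrier (C (Suc n - j) j)"
    and e0: "e n (x 0) = dA (Suc n) (e (Suc n) (y 0))"
    and xy: "\<And>j. j < m \<Longrightarrow> x j = d' (Suc (n - j)) j (y j) \<otimes>\<^bsub>C (n - j) j\<^esub> d'' (n - j) (Suc j) (y (Suc j))"
  shows "\<exists>b \<in> carrier (C (n - m) (Suc m)).
    x m = d' (Suc (n - m)) m (y m) \<otimes>\<^bsub>C (n - m) m\<^esub> d'' (n - m) (Suc m) b"
proof -
  have xc: "x \<in> carrier (T n)" using x by (simp add: cycles_def)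
  \<comment> \<open>The defect that d'' of the next component of y has to produce.\<close>
  define c where "c = x m \<otimes>\<^bsub>C (n - m) m\<^esub> inv\<^bsub>C (n - m) m\<^esub> d' (Suc (n - m)) m (y m)"
  have xm: "x m \<in> carrier (C (n - m) m)" using tot_closed[OF xc m] .
  have ym: "y m \<in> carrier (C (Suc (n - m)) m)" using y[of m] m by (simp add: Suc_diff_le)
  have cc: "c \<in> carrier (C (n - m) m)" unfolding c_def using xm ym by simp
  have "\<exists>b \<in> carrier (C (n - m) (Suc m)). d'' (n - m) (Suc m) b = c"
  proof (cases m)
    case 0
    have "e n c = \<one>\<^bsub>A n\<^esub>"
      using xm ym e0 target.d_closed[OF e_closed[of "y 0" "Suc n"]] unfolding c_def 0
      by (simp add: e_mult e_inv e_chain)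
    then show ?thesis using exact_0[of c n] cc 0 by simp
  next
    case (Suc k)
    let ?r = "n - Suc k"
    have nk: "n - k = Suc ?r" using m Suc by simp
    have xk: "x k \<in> carrier (C (Suc ?r) k)" using tot_closed[OF xc, of k] m Suc nk by simp
    have yk: "y k \<in> carrier (C (Suc (Suc ?r)) k)" using y[of k] m Suc nk by (simp add: Suc_diff_le)
    have ym': "y (Suc k) \<in> carrier (C (Suc ?r) (Suc k))" using ym Suc by simp
    have xm': "x (Suc k) \<in> carrier (C ?r (Suc k))" using xm Suc by simp
    have "x k = d' (Suc (Suc ?r)) k (y k) \<otimes>\<^bsub>C (Suc ?r) k\<^esub> d'' (Suc ?r) (Suc k) (y (Suc k))"
      using xy[of k] Suc nk by simp
    then have d'xk: "d' (Suc ?r) k (x k) = d' (Suc ?r) k (d'' (Suc ?r) (Suc k) (y (Suc k)))"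
      using yk ym' by (simp add: d'_mult)
    obtain n' where n': "n = Suc n'" using m Suc by (cases n) auto
    have "D n x k = \<one>\<^bsub>C ?r k\<^esub>"
      using x m Suc by (simp add: cycles_def n' tot_one)
    then have Dx: "d' (Suc ?r) k (x k) \<otimes>\<^bsub>C ?r k\<^esub> d'' ?r (Suc k) (x (Suc k)) = \<one>\<^bsub>C ?r k\<^esub>"
      using m Suc by (simp add: D_Suc n')
    \<comment> \<open>Anticommutation turns - d'' d' (y (k + 1)) into d' d'' (y (k + 1)), which
      equals d' (x k) because d' d' (y k) vanishes. The sum is then component k of D x, so the
      defect is a d''-cycle.\<close>
    have "d'' ?r (Suc k) c = d'' ?r (Suc k) (x (Suc k)) \<otimes>\<^bsub>C ?r k\<^esub> d' (Suc ?r) k (x k)"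
      unfolding c_def Suc using xm' ym' d'xk by (simp add: d''_mult d''_inv d''_d')
    also have "\<dots> = \<one>\<^bsub>C ?r k\<^esub>" using Dx xk xm' by (simp add: C.m_comm)
    finally show ?thesis using exact_Suc[of c ?r k] cc Suc by simp
  qed
  then obtain b where b: "b \<in> carrier (C (n - m) (Suc m))" "d'' (n - m) (Suc m) b = c" by blast
  have "x m = d' (Suc (n - m)) m (y m) \<otimes>\<^bsub>C (n - m) m\<^esub> c"
  proof -
    have "d' (Suc (n - m)) m (y m) \<otimes>\<^bsub>C (n - m) m\<^esub> (inv\<^bsub>C (n - m) m\<^esub> d' (Suc (n - m)) m (y m) \<otimes>\<^bsub>C (n - m) m\<^esub> x m) = x m"
      using xm ym by (simp add: C.m_assoc[symmetric])
    then show ?thesis unfolding c_def using xm ym by (simp add: C.m_comm)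
  qed
  then show ?thesis using b by auto
qed

text \<open>Solves D y = x with prescribed bottom component. With x trivial it completes an element
  of C_{n+1,0} to a total cycle; with general x it shows that a cycle whose augmentation bounds is
  itself a boundary.\<close>

lemma lift_boundary:
  assumes x: "x \<in> cycles T D n" and y0: "y0 \<in> carrier (C (Suc n) 0)"
    and e0: "e n (x 0) = dA (Suc n) (e (Suc n) y0)"
  obtains y where "y \<in> carrier (T (Suc n))" "y 0 = y0" "D (Suc n) y = x"
proof -
  have xc: "x \<in> carrier (T n)" using x by (simp add: cycles_def)
  \<comment> \<open>A partial solution: components 0 to m of y are in place, and the equation D y =
    x holds in components below m.\<close>
  define P where "P m y \<longleftrightarrow> y 0 = y0 \<and> (\<forall>j\<le>m. y j \<in> carrier (C (Suc n - j) j)) \<and>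
      (\<forall>j<m. x j = d' (Suc (n - j)) j (y j) \<otimes>\<^bsub>C (n - j) j\<^esub> d'' (n - j) (Suc j) (y (Suc j)))"
    for m and y :: "nat \<Rightarrow> 'c"
  have "\<exists>y. P m y" if "m \<le> Suc n" for m
    using that
  proof (induction m)
    case 0
    have "P 0 (\<lambda>_. y0)" using y0 by (simp add: P_def)
    then show ?case by blast
  next
    case (Suc m)
    then obtain y where y: "P m y" by auto
    obtain b where b: "b \<in> carrier (C (n - m) (Suc m))"
      "x m = d' (Suc (n - m)) m (y m) \<otimes>\<^bsub>C (n - m) m\<^esub> d'' (n - m) (Suc m) b"
      using lift_step[OF x, of m y] y e0 Suc.prems unfolding P_def by auto
    have "P (Suc m) (y(Suc m := b))"
      using y b by (auto simp: P_def less_Suc_eq le_Suc_eq)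
    then show ?case by blast
  qed
  then obtain y where y: "P (Suc n) y" by blast
  define z where "z = restrict y {..Suc n}"
  have zc: "z \<in> carrier (T (Suc n))" using y by (auto simp: z_def P_def carrier_tot)
  moreover have "z 0 = y0" using y by (simp add: z_def P_def)
  moreover have "D (Suc n) z = x"
  proof (rule tot_eqI[OF _ xc])
    show "D (Suc n) z j = x j" if "j \<le> n" for j
      using y that by (simp add: D_Suc z_def P_def)
  qed (use tot.d_closed[OF zc] in blast)
  ultimately show ?thesis using that by blast
qed

text \<open>The edge homomorphism of the spectral sequence. It is written on cycles of the total
  complex, so the homology of that complex never has to be formed.\<close>

definition edge :: "nat \<Rightarrow> (nat \<Rightarrow> 'c) \<Rightarrow> 'e set" where
  "edge n x = boundaries A dA n #>\<^bsub>A n\<^esub> e n (x 0)"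

text \<open>Apply the augmentation to component 0 of D x: it kills d'' (x 1) and turns d' (x 0) into
  the boundary of the augmentation of x 0.\<close>

lemma e_cycles:
  assumes x: "x \<in> cycles T D n"
  shows "e n (x 0) \<in> cycles A dA n"
proof -
  have xc: "x \<in> carrier (T n)" using x by (simp add: cycles_def)
  have x0: "x 0 \<in> carrier (C n 0)" using tot_closed[OF xc, of 0] by simp
  show ?thesis
  proof (cases n)
    case 0
    then show ?thesis using x0 e_closed[OF x0] by (simp add: cycles_def target.d_0)
  next
    case (Suc m)
    have x1: "x 1 \<in> carrier (C m 1)" using tot_closed[OF xc, of 1] Suc by simp
    have "D n x 0 = \<one>\<^bsub>C m 0\<^esub>" using x Suc by (simp add: cycles_def tot_one)
    then have "d' (Suc m) 0 (x 0) \<otimes>\<^bsub>C m 0\<^esub> d'' m 1 (x 1) = \<one>\<^bsub>C m 0\<^esub>"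
      using D_Suc[of 0 m x] Suc by simp
    then have "e m (d' (Suc m) 0 (x 0)) \<otimes>\<^bsub>A m\<^esub> e m (d'' m 1 (x 1)) = \<one>\<^bsub>A m\<^esub>"
      using x0 x1 Suc by (simp flip: e_mult)
    then have "dA n (e n (x 0)) = \<one>\<^bsub>A m\<^esub>"
      using e_d''[OF x1] e_chain[of "x 0" m] x0 e_closed[of "d' (Suc m) 0 (x 0)" m] Suc by simp
    then show ?thesis using x0 Suc by (simp add: cycles_def)
  qed
qed

lemma e_cycles_surj: "(\<lambda>x. e n (x 0)) ` cycles T D n = cycles A dA n"
proof (intro subset_antisym subsetI)
  fix a assume a: "a \<in> cycles A dA n"
  then obtain c where c: "c \<in> carrier (C n 0)" "e n c = a"
  proof -
    have "a \<in> e n ` carrier (C n 0)" using a e_surj[of n] by (simp add: cycles_def)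
    then show ?thesis using that by blast
  qed
  show "a \<in> (\<lambda>x. e n (x 0)) ` cycles T D n"
  proof (cases n)
    case 0
    have "single 0 0 c \<in> cycles T D n"
      using single_closed[of 0 0 c] c 0 by (simp add: cycles_def)
    moreover have "a = e n (single 0 0 c 0)" using c 0 by (simp add: single_def)
    ultimately show ?thesis by blast
  next
    case (Suc m)
    have "\<one>\<^bsub>T m\<^esub> \<in> cycles T D m"
      using subgroup.one_closed[OF tot.subgroup_cycles] .
    moreover have "e m (\<one>\<^bsub>T m\<^esub> 0) = dA (Suc m) (e (Suc m) c)"
    proof -
      have "\<one>\<^bsub>T m\<^esub> 0 = \<one>\<^bsub>C m 0\<^esub>" using filtD[OF one_in_filt, of 0 m "-1"] by simp
      moreover have "dA (Suc m) (e (Suc m) c) = \<one>\<^bsub>A m\<^esub>" using a c Suc by (simp add: cycles_def)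
      ultimately show ?thesis by simp
    qed
    \<comment> \<open>The trivial chain of degree m = n - 1 is the right-hand side: the boundary of
      a vanishes, so \<open>c\<close> satisfies the compatibility condition and extends to a total
      cycle over a.\<close>
    ultimately obtain y where "y \<in> carrier (T (Suc m))" "y 0 = c" "D (Suc m) y = \<one>\<^bsub>T m\<^esub>"
      using lift_boundary[of "\<one>\<^bsub>T m\<^esub>" m c] c Suc by blast
    then have "y \<in> cycles T D n" "a = e n (y 0)" using Suc c by (simp_all add: cycles_def)
    then show ?thesis by blast
  qed
qed (use e_cycles in blast)

lemma group_hom_edge: "group_hom ((T n)\<lparr>carrier := cycles T D n\<rparr>) (homology A dA n) (edge n)"
proof -
  have "edge n \<in> hom ((T n)\<lparr>carrier := cycles T D n\<rparr>) (homology A dA n)"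
  proof (rule homI)
    fix x assume "x \<in> carrier ((T n)\<lparr>carrier := cycles T D n\<rparr>)"
    then have x: "x \<in> cycles T D n" by simp
    show "edge n x \<in> carrier (homology A dA n)"
      unfolding homology_def carrier_subquotient edge_def using e_cycles[OF x] by blast
    fix y assume "y \<in> carrier ((T n)\<lparr>carrier := cycles T D n\<rparr>)"
    then have y: "y \<in> cycles T D n" by simp
    have c: "x 0 \<in> carrier (C n 0)" "y 0 \<in> carrier (C n 0)"
      using x y tot_closed[of _ n 0] by (auto simp: cycles_def)
    then show "edge n (x \<otimes>\<^bsub>(T n)\<lparr>carrier := cycles T D n\<rparr>\<^esub> y) =
        edge n x \<otimes>\<^bsub>homology A dA n\<^esub> edge n y"
      by (simp add: edge_def homology_def tot_mult e_mult target.X.r_coset_mult[OF target.subgroup_boundaries])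
  qed
  then show ?thesis
    using T.subgroup_imp_group[OF tot.subgroup_cycles] comm_group.axioms(2)[OF target.comm_group_homology]
    by (simp add: group_hom_def group_hom_axioms_def)
qed

lemma one_homology: "\<one>\<^bsub>homology A dA n\<^esub> = boundaries A dA n"
  by (simp add: homology_def FactGroup_def)

lemma edge_surj: "edge n ` cycles T D n = carrier (homology A dA n)"
  unfolding homology_def carrier_subquotient e_cycles_surj[symmetric] edge_def by (simp add: image_image)

text \<open>If the augmentation of x 0 is the boundary of some a, surjectivity of \<open>e\<close>
  lifts a to a bottom component y0 and the staircase completes it to y with D y = x. The converse
  holds because the augmentation kills d''.\<close>

lemma edge_kernel:
  assumes "x \<in> cycles T D n"
  shows "edge n x = \<one>\<^bsub>homology A dA n\<^esub> \<longleftrightarrow> x \<in> boundaries T D n"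
proof -
  have c: "e n (x 0) \<in> carrier (A n)" using e_cycles[OF assms] by (simp add: cycles_def)
  have "e n (x 0) \<in> boundaries A dA n \<longleftrightarrow> x \<in> boundaries T D n"
  proof
    assume "e n (x 0) \<in> boundaries A dA n"
    then obtain a where a: "a \<in> carrier (A (Suc n))" "e n (x 0) = dA (Suc n) a"
      by (auto simp: boundaries_def)
    then obtain y0 where "y0 \<in> carrier (C (Suc n) 0)" "a = e (Suc n) y0"
      using e_surj[of "Suc n"] by blast
    then obtain y where "y \<in> carrier (T (Suc n))" "D (Suc n) y = x"
      using lift_boundary[OF assms] a by metis
    then show "x \<in> boundaries T D n" by (auto simp: boundaries_def)
  next
    assume "x \<in> boundaries T D n"
    then obtain y where y: "y \<in> carrier (T (Suc n))" and x: "x = D (Suc n) y"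
      by (auto simp: boundaries_def)
    have c: "y 0 \<in> carrier (C (Suc n) 0)" "y 1 \<in> carrier (C n 1)"
      using tot_closed[OF y, of 0] tot_closed[OF y, of 1] by simp_all
    have "e n (x 0) = dA (Suc n) (e (Suc n) (y 0))"
      unfolding x using c e_d''[OF c(2)] D_Suc[of 0 n y] e_closed[OF c(1)]
      by (simp add: e_mult e_chain target.d_closed)
    then show "e n (x 0) \<in> boundaries A dA n" using c by (auto simp: boundaries_def)
  qed
  then show ?thesis
    unfolding edge_def one_homology using target.X.r_coset_eq_self_iff[OF target.subgroup_boundaries c]
    by simp
qed

section \<open>The infinity page as the graded pieces of the filtration by images of cycles\<close>

abbreviation cycle_filt :: "int \<Rightarrow> nat \<Rightarrow> (nat \<Rightarrow> 'c) set" where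
  "cycle_filt s n \<equiv> cycles T D n \<inter> F s n"

lemma subgroup_cycle_filt: "subgroup (cycle_filt s n) (T n)"
  by (rule T.subgroups_Inter_pair[OF tot.subgroup_cycles subgroup_filt])

lemma ss_Z_large: "s - r < 0 \<Longrightarrow> ss_Z C d' d'' r s n = cycle_filt s n"
  using filt_subset by (auto simp: ss_Z_def filt_neg cycles_def)

text \<open>The group divided out consists of cycles in F_{p-1} plus boundaries lying in F_p. As
  boundaries are the kernel of \<open>edge\<close>, it is the preimage, inside the cycles of F_p, of
  the image of the cycles of F_{p-1}.\<close>

lemma ss_B_infinity:
  assumes "n = p + q"
  shows "ss_B C d' d'' (n + 2) p q =
    {x \<in> cycle_filt (int p) n. edge n x \<in> edge n ` cycle_filt (int p - 1) n}"
proof -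
  interpret edge: group_hom "(T n)\<lparr>carrier := cycles T D n\<rparr>" "homology A dA n" "edge n"
    by (rule group_hom_edge)
  interpret cyc: subgroup "cycles T D n" "T n" by (rule tot.subgroup_cycles)
  \<comment> \<open>With r = n + 2 the source level p + n + 1 is at least the total degree n + 1 and
    imposes nothing; the level demanded of the image is p + r - 1 - (r - 1) = p.\<close>
  have "ss_Z C d' d'' (int (n + 2) - 1) (int p + int (n + 2) - 1) (n + 1) =
      {y \<in> carrier (T (Suc n)). D (Suc n) y \<in> F (int p) n}"
    using filt_top[of "Suc n" "int p + int n + 1"] by (auto simp: ss_Z_def add.commute)
  then have B: "ss_B C d' d'' (n + 2) p q = cycle_filt (int p - 1) n <#>\<^bsub>T n\<^esub>
      D (Suc n) ` {y \<in> carrier (T (Suc n)). D (Suc n) y \<in> F (int p) n}"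
    unfolding ss_B_def using assms by (simp add: ss_Z_large)
  show ?thesis
  proof (intro subset_antisym subsetI)
    fix x assume "x \<in> ss_B C d' d'' (n + 2) p q"
    then obtain z y where z: "z \<in> cycle_filt (int p - 1) n" and y: "y \<in> carrier (T (Suc n))"
      and DyF: "D (Suc n) y \<in> F (int p) n" and x: "x = z \<otimes>\<^bsub>T n\<^esub> D (Suc n) y"
      unfolding B set_mult_def by blast
    have Dy: "D (Suc n) y \<in> boundaries T D n" using y by (auto simp: boundaries_def)
    then have Dyc: "D (Suc n) y \<in> cycles T D n" using tot.boundaries_subset_cycles by blast
    have zp: "z \<in> cycle_filt (int p) n" using z filt_mono[of "int p - 1" "int p" n] by auto
    have "x \<in> cycle_filt (int p) n"
      unfolding x using zp Dyc DyF by (intro subgroup.m_closed[OF subgroup_cycle_filt]) auto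
    moreover have "edge n x = edge n z"
      unfolding x using edge.hom_mult[of z "D (Suc n) y"] z Dyc edge_kernel[OF Dyc] Dy
        edge.hom_closed[of z] by simp
    ultimately show "x \<in> {x \<in> cycle_filt (int p) n. edge n x \<in> edge n ` cycle_filt (int p - 1) n}"
      using z by blast
  next
    fix x assume "x \<in> {x \<in> cycle_filt (int p) n. edge n x \<in> edge n ` cycle_filt (int p - 1) n}"
    then obtain z where x: "x \<in> cycle_filt (int p) n" and z: "z \<in> cycle_filt (int p - 1) n"
      and xz: "edge n x = edge n z" by blast
    have zp: "z \<in> cycle_filt (int p) n" using z filt_mono[of "int p - 1" "int p" n] by auto
    have xc: "x \<in> carrier (T n)" and zc: "z \<in> carrier (T n)" using x z cyc.subset by blast+
    \<comment> \<open>The difference of x and z lies in the kernel of \<open>edge\<close>, so it is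
      a boundary, and it stays in filtration degree p.\<close>
    define b where "b = inv\<^bsub>T n\<^esub> z \<otimes>\<^bsub>T n\<^esub> x"
    have bF: "b \<in> cycle_filt (int p) n"
      unfolding b_def using x zp
      by (intro subgroup.m_closed[OF subgroup_cycle_filt] subgroup.m_inv_closed[OF subgroup_cycle_filt])
    have "edge n b = \<one>\<^bsub>homology A dA n\<^esub>"
    proof -
      have iz: "inv\<^bsub>T n\<^esub> z \<in> cycles T D n" using z by (intro cyc.m_inv_closed) auto
      have "edge n (inv\<^bsub>T n\<^esub> z \<otimes>\<^bsub>T n\<^esub> x) = edge n (inv\<^bsub>T n\<^esub> z) \<otimes>\<^bsub>homology A dA n\<^esub> edge n x"
        using edge.hom_mult[of "inv\<^bsub>T n\<^esub> z" x] x iz by simp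
      also have "\<dots> = edge n (inv\<^bsub>T n\<^esub> z \<otimes>\<^bsub>T n\<^esub> z)"
        using edge.hom_mult[of "inv\<^bsub>T n\<^esub> z" z] z iz xz by simp
      also have "\<dots> = \<one>\<^bsub>homology A dA n\<^esub>" using edge.hom_one zc by simp
      finally show ?thesis unfolding b_def .
    qed
    then have "b \<in> boundaries T D n" using edge_kernel[of b n] bF by simp
    then obtain y where y: "y \<in> carrier (T (Suc n))" "b = D (Suc n) y" by (auto simp: boundaries_def)
    have "x = z \<otimes>\<^bsub>T n\<^esub> b"
      unfolding b_def using xc zc by (simp add: T.m_assoc[symmetric])
    then show "x \<in> ss_B C d' d'' (n + 2) p q"
      unfolding B set_mult_def using z y bF by blast
  qed
qed

text \<open>By construction \<open>edge\<close> maps the cycles in F_p onto step p of the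
  filtration. By \<open>ss_B_infinity\<close> the denominator of the infinity page is the preimage
  of step p - 1, so \<open>coset_map_iso\<close> gives the graded piece.\<close>

theorem converges_to_target: "converges_to (ss_E_infinity C d' d'') (homology A dA)"
  unfolding converges_to_def
proof (intro allI exI conjI ballI impI)
  fix n
  interpret edge: group_hom "(T n)\<lparr>carrier := cycles T D n\<rparr>" "homology A dA n" "edge n"
    by (rule group_hom_edge)
  let ?F = "\<lambda>s. edge n ` cycle_filt s n"
  have sub: "subgroup (?F s) (homology A dA n)" for s
    by (intro edge.subgroup_img_is_subgroup T.subgroup_incl subgroup_cycle_filt tot.subgroup_cycles) simp
  have "cycle_filt (- 1) n = {\<one>\<^bsub>T n\<^esub>}"
    using subgroup.one_closed[OF tot.subgroup_cycles, of n] by (auto simp: filt_neg)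
  then show "?F (- 1) = {\<one>\<^bsub>homology A dA n\<^esub>}" using edge.hom_one by simp
  have "cycle_filt (int n) n = cycles T D n" by (auto simp: filt_top cycles_def)
  then show "?F (int n) = carrier (homology A dA n)" using edge_surj by simp
  show "subgroup (?F p) (homology A dA n)" for p by (rule sub)
  have mono: "?F (p - 1) \<subseteq> ?F p" for p using filt_mono[of "p - 1" p n] by auto
  then show "?F (p - 1) \<subseteq> ?F p" for p .
  fix p q assume pq: "p + q = n"
  have "coset_map (homology A dA n) (?F (int p - 1)) (edge n) \<in>
    iso ((T n)\<lparr>carrier := cycle_filt (int p) n\<rparr> Mod ss_B C d' d'' (n + 2) p q)
      ((homology A dA n)\<lparr>carrier := ?F (int p)\<rparr> Mod ?F (int p - 1))"
    using pq edge.hom_mult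
    by (intro coset_map_iso T.comm_group_axioms subgroup_cycle_filt target.comm_group_homology sub mono
        ss_B_infinity) auto
  moreover have "ss_E_infinity C d' d'' p q =
      (T n)\<lparr>carrier := cycle_filt (int p) n\<rparr> Mod ss_B C d' d'' (n + 2) p q"
    unfolding ss_E_infinity_def ss_E_def pq using pq by (subst ss_Z_large) auto
  ultimately show "ss_E_infinity C d' d'' p q \<cong>
      (homology A dA n)\<lparr>carrier := ?F (int p)\<rparr> Mod ?F (int p - 1)"
    by (auto simp: is_iso_def)
qed

end

section \<open>Linear maps between chain groups\<close>

lemma frag_extend_frag_extend:
  "frag_extend f (frag_extend g c) = frag_extend (\<lambda>x. frag_extend f (g x)) c"
  using subset_UNIV
  by (induction c rule: frag_induction) (auto simp: frag_extend_diff)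

lemma frag_cmul_uminus: "frag_cmul a (- c) = - frag_cmul a c"
  by (rule poly_mapping_eqI) simp

lemma push_0 [simp]: "simplicial_push g 0 = 0"
  and push_add: "simplicial_push g (c + b) = simplicial_push g c + simplicial_push g b"
  and push_cmul: "simplicial_push g (frag_cmul a c) = frag_cmul a (simplicial_push g c)"
  and push_minus: "simplicial_push g (- c) = - simplicial_push g c"
  and push_diff: "simplicial_push g (c - b) = simplicial_push g c - simplicial_push g b"
  by (simp_all add: simplicial_push_def frag_extend_add frag_extend_cmul frag_extend_minus frag_extend_diff)

lemma push_sum: "finite I \<Longrightarrow> simplicial_push g (\<Sum>i\<in>I. c i) = (\<Sum>i\<in>I. simplicial_push g (c i))"
  by (simp add: simplicial_push_def frag_extend_sum)

lemma push_push: "simplicial_push g (simplicial_push h c) = simplicial_push (\<lambda>v. g (h v)) c"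
  by (simp add: simplicial_push_def frag_extend_frag_extend comp_def)

lemma push_cong:
  "(\<And>vs. vs \<in> Poly_Mapping.keys c \<Longrightarrow> map g vs = map h vs) \<Longrightarrow> simplicial_push g c = simplicial_push h c"
  unfolding simplicial_push_def by (intro frag_extend_eq arg_cong[where f = frag_of]) blast

lemma keys_push: "Poly_Mapping.keys (simplicial_push g c) \<subseteq> map g ` Poly_Mapping.keys c"
  unfolding simplicial_push_def by (rule order_trans[OF keys_frag_extend]) auto

lemma boundary_0 [simp]: "simplicial_boundary n 0 = 0"
  and boundary_add: "simplicial_boundary n (c + b) = simplicial_boundary n c + simplicial_boundary n b"
  and boundary_cmul: "simplicial_boundary n (frag_cmul a c) = frag_cmul a (simplicial_boundary n c)"
  and boundary_minus: "simplicial_boundary n (- c) = - simplicial_boundary n c"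
  by (simp_all add: simplicial_boundary_def frag_extend_add frag_extend_cmul frag_extend_minus)

lemma boundary_sum: "finite I \<Longrightarrow> simplicial_boundary n (\<Sum>i\<in>I. c i) = (\<Sum>i\<in>I. simplicial_boundary n (c i))"
  by (simp add: simplicial_boundary_def frag_extend_sum comp_def)

definition face :: "nat \<Rightarrow> 'v list \<Rightarrow> 'v list" where
  "face i vs = take i vs @ drop (Suc i) vs"

lemma map_face: "map g (face i vs) = face i (map g vs)"
  by (simp add: face_def take_map drop_map)

lemma set_face_subset: "set (face i vs) \<subseteq> set vs"
  unfolding face_def using set_take_subset set_drop_subset by fastforce

lemma length_face: "i < length vs \<Longrightarrow> length (face i vs) = length vs - 1"
  by (simp add: face_def)

lemma nth_face: "i < length vs \<Longrightarrow> j < length vs - 1 \<Longrightarrow> face i vs ! j = vs ! (if j < i then j else Suc j)"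
  by (auto simp: face_def nth_append)

text \<open>Deleting position i and then j, with i <= j, removes the original positions i and j + 1,
  which may be done in the other order.\<close>

lemma face_face:
  assumes "i \<le> j" "Suc j < length vs"
  shows "face j (face i vs) = face i (face (Suc j) vs)"
  using assms by (intro nth_equalityI) (auto simp: nth_face length_face)

lemma boundary_Suc:
  "simplicial_boundary (Suc n) c =
    frag_extend (\<lambda>vs. \<Sum>i\<le>Suc n. frag_cmul ((-1) ^ i) (frag_of (face i vs))) c"
  by (simp add: simplicial_boundary_def face_def)

lemma boundary_push: "simplicial_boundary n (simplicial_push g c) = simplicial_push g (simplicial_boundary n c)"
proof (cases n)
  case (Suc m)
  show ?thesis
    unfolding Suc boundary_Suc simplicial_push_def frag_extend_frag_extend
    by (simp add: frag_extend_sum frag_extend_cmul comp_def map_face del: sum.atMost_Suc)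
qed (simp add: simplicial_boundary_def)

lemma keys_boundary:
  assumes "Poly_Mapping.keys c \<subseteq> A" "\<And>vs i. vs \<in> A \<Longrightarrow> i \<le> Suc n \<Longrightarrow> face i vs \<in> B"
  shows "Poly_Mapping.keys (simplicial_boundary (Suc n) c) \<subseteq> B"
proof -
  have "Poly_Mapping.keys (\<Sum>i\<le>Suc n. frag_cmul ((-1) ^ i) (frag_of (face i vs))) \<subseteq> B"
    if "vs \<in> Poly_Mapping.keys c" for vs
  proof -
    have "Poly_Mapping.keys (frag_cmul ((-1) ^ i) (frag_of (face i vs))) \<subseteq> B" if "i \<le> Suc n" for i
      using assms \<open>vs \<in> _\<close> that keys_cmul[of "(-1) ^ i" "frag_of (face i vs)"] by auto
    then show ?thesis by (intro order_trans[OF keys_sum]) blast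
  qed
  then show ?thesis unfolding boundary_Suc by (intro order_trans[OF keys_frag_extend]) blast
qed

text \<open>The cancellation behind both \<open>\<partial>\<partial> = 0\<close> and \<open>\<varrho>\<varrho> = 0\<close>.\<close>

lemma alternating_double_sum:
  fixes t :: "nat \<Rightarrow> nat \<Rightarrow> 'v \<Rightarrow>\<^sub>0 int"
  assumes "\<And>i j. i \<le> j \<Longrightarrow> j \<le> m \<Longrightarrow> t i j = t (Suc j) i"
  shows "(\<Sum>i\<le>Suc m. \<Sum>j\<le>m. frag_cmul ((-1) ^ (i + j)) (t i j)) = 0"
proof -
  let ?g = "\<lambda>(i, j). frag_cmul ((-1) ^ (i + j)) (t i j)"
  let ?U = "{(i, j). i \<le> j \<and> j \<le> m}"
  let ?V = "{(i, j). j < i \<and> i \<le> Suc m}"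
  have UV: "?U \<subseteq> {..m} \<times> {..m}" "?V \<subseteq> {..Suc m} \<times> {..Suc m}" by auto
  have fin: "finite ?U" "finite ?V"
    using finite_subset[OF UV(1)] finite_subset[OF UV(2)] by simp_all
  have "(\<Sum>i\<le>Suc m. \<Sum>j\<le>m. frag_cmul ((-1) ^ (i + j)) (t i j)) = sum ?g ({..Suc m} \<times> {..m})"
    by (simp only: sum.cartesian_product)
  also have "{..Suc m} \<times> {..m} = ?U \<union> ?V" by (auto simp del: atMost_Suc)
  also have "sum ?g (?U \<union> ?V) = sum ?g ?U + sum ?g ?V"
    by (rule sum.union_disjoint[OF fin]) force
  also have "sum ?g ?V = (\<Sum>x\<in>?U. - ?g x)"
  \<comment> \<open>The pair (i, j) with j < i is matched with (j, i - 1). The terms agree by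
    hypothesis, and the index sum drops by one, so the signs are opposite.\<close>
  proof (rule sum.reindex_bij_witness[where i = "\<lambda>(i, j). (Suc j, i)" and j = "\<lambda>(i, j). (j, i - 1)"])
    fix x assume "x \<in> ?V"
    then obtain i j where x: "x = (i, j)" "j < i" "i \<le> Suc m" by auto
    then obtain i' where i: "i = Suc i'" by (cases i) auto
    show "- ?g (case x of (i, j) \<Rightarrow> (j, i - 1)) = ?g x"
      using x assms[of j i'] by (simp add: i add.commute)
  qed auto
  finally show ?thesis by (simp add: sum_negf)
qed

text \<open>The hypothesis on lengths keeps all deleted positions inside the lists, as
  \<open>face_face\<close> requires; beyond the end \<open>face\<close> would delete
  nothing.\<close>

lemma boundary_boundary:
  assumes "\<And>vs. vs \<in> Poly_Mapping.keys c \<Longrightarrow> length vs = Suc (Suc (Suc n))"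
  shows "simplicial_boundary (Suc n) (simplicial_boundary (Suc (Suc n)) c) = 0"
proof -
  have "(\<Sum>i\<le>Suc (Suc n). \<Sum>j\<le>Suc n. frag_cmul ((-1) ^ (i + j)) (frag_of (face j (face i vs)))) = 0"
    if "vs \<in> Poly_Mapping.keys c" for vs
    using assms[OF that] by (intro alternating_double_sum) (simp add: face_face)
  moreover have "frag_extend (\<lambda>vs. \<Sum>j\<le>Suc n. frag_cmul ((-1) ^ j) (frag_of (face j vs)))
      (\<Sum>i\<le>Suc (Suc n). frag_cmul ((-1) ^ i) (frag_of (face i vs))) =
    (\<Sum>i\<le>Suc (Suc n). \<Sum>j\<le>Suc n. frag_cmul ((-1) ^ (i + j)) (frag_of (face j (face i vs))))" for vs :: "'a list"
    by (simp add: frag_extend_sum frag_extend_cmul comp_def frag_cmul_sum power_add del: sum.atMost_Suc)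
  ultimately show ?thesis
    unfolding boundary_Suc frag_extend_frag_extend by - (rule frag_extend_eq_0, simp only:)
qed

lemma frag_eq_minus_self: "c = - c \<Longrightarrow> c = 0" for c :: "'v \<Rightarrow>\<^sub>0 int"
proof (rule poly_mapping_eqI)
  fix k assume "c = - c"
  then have "poly_mapping.lookup c k = - poly_mapping.lookup c k" by (metis lookup_uminus)
  then show "poly_mapping.lookup c k = poly_mapping.lookup 0 k" by simp
qed

section \<open>Tuples of simplices\<close>

text \<open>A list of \<open>k\<close>-tuples is read as a matrix with one column for each vertex; its \<open>k\<close> rows
  are the simplices of \<open>X\<close> over one simplex of \<open>Y\<close>.\<close>

definition row :: "nat \<Rightarrow> (nat \<Rightarrow> 'a) list \<Rightarrow> 'a list" where
  "row l vs = map (\<lambda>v. v l) vs"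

definition tuples :: "('a \<Rightarrow> 'b) \<Rightarrow> 'a list set \<Rightarrow> nat \<Rightarrow> (nat \<Rightarrow> 'a) list set" where
  "tuples f S k = {vs. set vs \<subseteq> extensional {..<k} \<and> (\<forall>l<k. row l vs \<in> S) \<and>
     (\<forall>l<k. map f (row l vs) = map f (row 0 vs))}"

definition insert_row :: "nat \<Rightarrow> nat \<Rightarrow> 'a list \<Rightarrow> (nat \<Rightarrow> 'a) list \<Rightarrow> (nat \<Rightarrow> 'a) list" where
  "insert_row k i u vs = map2 (\<lambda>v a. \<lambda>l\<in>{..<Suc k}. if l < i then v l else if l = i then a else v (l - 1)) vs u"

lemma length_row [simp]: "length (row l vs) = length vs"
  by (simp add: row_def)

text \<open>Extensionality fixes the values outside {..<k}, so a matrix is determined by its rows.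
  Identities between forgetting, inserting and permuting are checked row by row through this
  lemma.\<close>

lemma rows_eqI:
  assumes "length vs = length ws" "set vs \<subseteq> extensional {..<k}" "set ws \<subseteq> extensional {..<k}"
    and "\<And>l. l < k \<Longrightarrow> row l vs = row l ws"
  shows "vs = ws"
proof (rule nth_equalityI)
  fix i assume i: "i < length vs"
  show "vs ! i = ws ! i"
  proof (rule extensionalityI[of _ "{..<k}"])
    fix l assume "l \<in> {..<k}"
    then have "row l vs ! i = row l ws ! i" using assms(4) by simp
    then show "(vs ! i) l = (ws ! i) l" using i assms(1) by (simp add: row_def)
  next
    show "vs ! i \<in> extensional {..<k}" using nth_mem[OF i] assms(2) by blast
    have "i < length ws" using i assms(1) by simp
    then show "ws ! i \<in> extensional {..<k}" using nth_mem assms(3) by blast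
  qed
qed (rule assms(1))

lemma row_insert_row:
  assumes "length u = length vs" "l \<le> k"
  shows "row l (insert_row k i u vs) = (if l < i then row l vs else if l = i then u else row (l - 1) vs)"
  using assms by (intro nth_equalityI) (auto simp: row_def insert_row_def)

lemma length_insert_row [simp]: "length u = length vs \<Longrightarrow> length (insert_row k i u vs) = length vs"
  by (simp add: insert_row_def)

lemma insert_row_extensional: "set (insert_row k i u vs) \<subseteq> extensional {..<Suc k}"
  by (auto simp: insert_row_def extensional_def)

lemma row_forget: "l < k \<Longrightarrow> row l (map (forget i (Suc k)) vs) = row (if l < i then l else Suc l) vs"
  by (auto simp: row_def forget_def)

lemma forget_extensional: "forget i (Suc k) x \<in> extensional {..<k}"
  by (simp add: forget_def)

lemma forget_forget:
  "i \<le> j \<Longrightarrow> j \<le> k \<Longrightarrow> forget j (Suc k) (forget i (Suc (Suc k)) x) = forget i (Suc k) (forget (Suc j) (Suc (Suc k)) x)"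
  by (auto simp: forget_def fun_eq_iff)

lemma row_comp: "row l (map (\<lambda>x. x \<circ> \<sigma>) vs) = row (\<sigma> l) vs"
  by (simp add: row_def)

lemma comp_extensional:
  assumes "\<sigma> permutes {..<k}" "x \<in> extensional {..<k}"
  shows "x \<circ> \<sigma> \<in> extensional {..<k}"
  using assms permutes_in_image[OF assms(1)] by (auto simp: extensional_def)

lemma forget_insert_row_same:
  assumes "length u = length vs" "set vs \<subseteq> extensional {..<k}" "i \<le> k"
  shows "map (forget i (Suc k)) (insert_row k i u vs) = vs"
  using assms forget_extensional[of i k]
  by (intro rows_eqI[of _ _ k]) (auto simp: row_forget row_insert_row)

text \<open>Below a new row 0 the old component i sits at i + 1.\<close>

lemma forget_insert_row_first:
  assumes "length u = length vs" "i \<le> k"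
  shows "map (forget (Suc i) (Suc (Suc k))) (insert_row (Suc k) 0 u vs) = insert_row k 0 u (map (forget i (Suc k)) vs)"
  using assms insert_row_extensional[of k 0 u] forget_extensional[of "Suc i" "Suc k"]
  by (intro rows_eqI[of _ _ "Suc k"]) (auto simp: row_forget row_insert_row)

text \<open>Since i <= k, the inserted row is not the last one, and the last row is the old
  component k. Insertion in last position is the case of
  \<open>forget_insert_row_same\<close>.\<close>

lemma forget_insert_row_last:
  assumes "length u = length vs" "i \<le> k"
  shows "map (forget (Suc k) (Suc (Suc k))) (insert_row (Suc k) i u vs) = insert_row k i u (map (forget k (Suc k)) vs)"
  using assms insert_row_extensional[of k i u] forget_extensional[of "Suc k" "Suc k"]
  by (intro rows_eqI[of _ _ "Suc k"]) (auto simp: row_forget row_insert_row)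

section \<open>Adjacent transpositions of rows and their effect on insertions\<close>

abbreviation adj :: "nat \<Rightarrow> nat \<Rightarrow> nat" where
  "adj a \<equiv> Transposition.transpose a (Suc a)"

lemma insert_row_adj_extensional:
  assumes "a < k"
  shows "set (map (\<lambda>x. x \<circ> adj a) (insert_row k i u vs)) \<subseteq> extensional {..<Suc k}"
  using assms insert_row_extensional[of k i u vs]
    comp_extensional[OF permutes_swap_id[of a "{..<Suc k}" "Suc a"]]
  by auto

lemma adj_insert_row_at:
  assumes "length u = length vs" "a < k"
  shows "map (\<lambda>x. x \<circ> adj a) (insert_row k a u vs) = insert_row k (Suc a) u vs" (is "?L = ?R")
    and "map (\<lambda>x. x \<circ> adj a) (insert_row k (Suc a) u vs) = insert_row k a u vs"
proof -
  show *: "?L = ?R"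
  proof (rule rows_eqI)
    show "row l ?L = row l ?R" if "l < Suc k" for l
      using that assms by (simp add: row_comp row_insert_row Transposition.transpose_def)
  qed (use assms insert_row_adj_extensional insert_row_extensional in simp_all)
  have "map (\<lambda>x. x \<circ> adj a) ?R = map (\<lambda>x. x \<circ> adj a \<circ> adj a) (insert_row k a u vs)"
    unfolding *[symmetric] by simp
  also have "\<dots> = insert_row k a u vs" by (simp add: comp_assoc)
  finally show "map (\<lambda>x. x \<circ> adj a) ?R = insert_row k a u vs" .
qed

lemma adj_insert_row_below:
  assumes "length u = length vs" "Suc a < i" "i \<le> k"
  shows "map (\<lambda>x. x \<circ> adj a) (insert_row k i u vs) = insert_row k i u (map (\<lambda>x. x \<circ> adj a) vs)"
    (is "?L = ?R")
proof (rule rows_eqI)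
  show "row l ?L = row l ?R" if "l < Suc k" for l
  proof (cases "l = a \<or> l = Suc a")
    case True
    then show ?thesis using assms by (auto simp: row_comp row_insert_row)
  next
    case False
    then have "l - 1 \<noteq> a" "l - 1 \<noteq> Suc a" if "\<not> l < i" "l \<noteq> i" using that assms by auto
    then show ?thesis using False that assms by (auto simp: row_comp row_insert_row)
  qed
qed (use assms insert_row_adj_extensional[of a k] insert_row_extensional in simp_all)

text \<open>Insertion moves rows from position i on up by one, so exchanging rows a + 1 and a + 2
  afterwards is exchanging rows a and a + 1 beforehand. In \<open>adj_insert_row_below\<close> the
  exchanged rows precede position i and keep their indices.\<close>

lemma adj_insert_row_above:
  assumes "length u = length vs" "i \<le> a" "Suc a < k"
  shows "map (\<lambda>x. x \<circ> adj (Suc a)) (insert_row k i u vs) = insert_row k i u (map (\<lambda>x. x \<circ> adj a) vs)"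
    (is "?L = ?R")
proof (rule rows_eqI)
  show "row l ?L = row l ?R" if "l < Suc k" for l
  proof (cases "l = Suc a \<or> l = Suc (Suc a)")
    case True
    then show ?thesis using assms by (auto simp: row_comp row_insert_row)
  next
    case False
    then have "l - 1 \<noteq> a" "l - 1 \<noteq> Suc a" if "\<not> l < i" "l \<noteq> i" using that by auto
    then show ?thesis using False that assms by (auto simp: row_comp row_insert_row)
  qed
qed (use assms insert_row_adj_extensional[of "Suc a" k] insert_row_extensional in simp_all)

section \<open>Alternating chains\<close>

text \<open>The symmetry condition of \<open>alternating_chains\<close>, separated from the
  condition on supports so that it can be combined with the tuples of W^k as well as with the
  simplices of D^k.\<close>

definition alternating :: "nat \<Rightarrow> (nat \<Rightarrow> 'a) simp_chain \<Rightarrow> bool" where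
  "alternating k c \<longleftrightarrow>
     (\<forall>\<sigma>. \<sigma> permutes {..<k} \<longrightarrow> simplicial_push (\<lambda>x. x \<circ> \<sigma>) c = frag_cmul (sign \<sigma>) c)"

lemma alternating_transpose:
  assumes "alternating k c" "a < k" "b < k" "a \<noteq> b"
  shows "simplicial_push (\<lambda>x. x \<circ> Transposition.transpose a b) c = - c"
  using assms permutes_swap_id[of a "{..<k}" b]
  by (simp add: alternating_def sign_swap_id)

lemma alternating_adj:
  "alternating k c \<Longrightarrow> Suc a < k \<Longrightarrow> simplicial_push (\<lambda>x. x \<circ> adj a) c = - c"
  by (rule alternating_transpose) auto

lemma push_comp: "simplicial_push (\<lambda>x. x \<circ> (\<sigma> \<circ> \<tau>)) c = simplicial_push (\<lambda>x. x \<circ> \<tau>) (simplicial_push (\<lambda>x. x \<circ> \<sigma>) c)"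
  by (simp add: push_push comp_assoc)

lemma push_id: "simplicial_push (\<lambda>x. x \<circ> id) c = c"
proof -
  have "simplicial_push (\<lambda>x. x \<circ> id) c = frag_extend frag_of c"
    by (simp add: simplicial_push_def)
  then show ?thesis by (metis frag_expansion)
qed

text \<open>Adjacent transpositions generate the symmetric group.\<close>

lemma alternatingI:
  assumes adj: "\<And>a. Suc a < k \<Longrightarrow> simplicial_push (\<lambda>x. x \<circ> adj a) c = - c"
  shows "alternating k c"
proof -
  have less: "simplicial_push (\<lambda>x. x \<circ> Transposition.transpose a b) c = - c" if "a < b" "b < k" for a b
    using that
  proof (induction b)
    case (Suc b)
    show ?case
    proof (cases "a = b")
      case True
      then show ?thesis using adj[OF Suc.prems(2)] by (simp only:)
    next
      case False
      \<comment> \<open>Conjugating the exchange of a and b by that of b and b + 1 gives the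
        exchange of a and b + 1: three sign changes, hence one.\<close>
      then have eq: "Transposition.transpose a (Suc b) =
          adj b \<circ> Transposition.transpose b a \<circ> adj b"
        using transpose_comp_triple[of "Suc b" a b] Suc.prems by (simp add: transpose_commute)
      have "simplicial_push (\<lambda>x. x \<circ> Transposition.transpose b a) c = - c"
        using Suc.IH Suc.prems False unfolding transpose_commute[of b a] by linarith
      then show ?thesis
        by (simp only: eq push_comp push_minus adj[OF Suc.prems(2)] minus_minus)
    qed
  qed simp
  have transp: "simplicial_push (\<lambda>x. x \<circ> Transposition.transpose a b) c = - c"
    if "a < k" "b < k" "a \<noteq> b" for a b
    using less[of a b] less[of b a] that by (metis nat_neq_iff transpose_commute)
  show ?thesis
    unfolding alternating_def
  proof (intro allI impI)
    fix \<sigma> :: "nat \<Rightarrow> nat" assume "\<sigma> permutes {..<k}"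
    from this finite_lessThan show "simplicial_push (\<lambda>x. x \<circ> \<sigma>) c = frag_cmul (sign \<sigma>) c"
    proof (induction rule: permutes_induct)
      case id
      show ?case using push_id[of c] by simp
    next
      case (swap a b p)
      have "permutation p" by (rule permutes_imp_permutation[OF finite_lessThan swap(4)])
      then have sign: "sign (Transposition.transpose a b \<circ> p) = - sign p"
        using swap(3) by (simp add: sign_compose permutation_swap_id sign_swap_id)
      have "a < k" "b < k" using swap(1,2) by simp_all
      then show ?case
        unfolding push_comp sign transp[OF \<open>a < k\<close> \<open>b < k\<close> swap(3)] push_minus swap(5) by simp
    qed
  qed
qed

lemma lookup_push_inj:
  assumes "inj g"
  shows "poly_mapping.lookup (simplicial_push g c) (map g vs) = poly_mapping.lookup c vs"
proof -
  have "Poly_Mapping.keys c \<subseteq> UNIV" by simp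
  then show ?thesis
  proof (induction c rule: frag_induction)
    case (diff a b)
    then show ?case
      by (simp add: simplicial_push_def frag_extend_diff lookup_minus)
  qed (use assms in \<open>auto simp: simplicial_push_def inj_map_eq_map\<close>)
qed

text \<open>The transposition of two equal rows fixes a list and negates its coefficient.\<close>

lemma alternating_rows_distinct:
  assumes "alternating k c" "vs \<in> Poly_Mapping.keys c" "l < k" "m < k" "row l vs = row m vs"
  shows "l = m"
proof (rule ccontr)
  assume "l \<noteq> m"
  let ?t = "Transposition.transpose l m" and ?g = "\<lambda>x :: nat \<Rightarrow> 'a. x \<circ> Transposition.transpose l m"
  have "inj ?g" by (rule inj_on_inverseI[where g = ?g]) (simp add: comp_assoc)
  moreover have "map ?g vs = vs"
  proof -
    have "?g v = v" if "v \<in> set vs" for v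
    proof -
      have "v l = v m" using assms(5) that by (simp add: row_def)
      then show ?thesis by (simp add: fun_eq_iff Transposition.transpose_def)
    qed
    then show ?thesis by (simp add: map_idI)
  qed
  ultimately have "poly_mapping.lookup c vs = poly_mapping.lookup (simplicial_push ?g c) vs"
    using lookup_push_inj by metis
  also have "\<dots> = - poly_mapping.lookup c vs"
    using alternating_transpose[OF assms(1,3,4) \<open>l \<noteq> m\<close>] by simp
  finally show False using assms(2) by (simp add: in_keys_iff)
qed

lemma alternating_0: "alternating k 0"
  and alternating_add: "alternating k c \<Longrightarrow> alternating k b \<Longrightarrow> alternating k (c + b)"
  and alternating_cmul: "alternating k c \<Longrightarrow> alternating k (frag_cmul a c)"
  by (simp_all add: alternating_def push_add push_cmul frag_cmul_distrib2 mult.commute)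

lemma alternating_boundary: "alternating k c \<Longrightarrow> alternating k (simplicial_boundary n c)"
  by (simp add: alternating_def boundary_push[symmetric] boundary_cmul)

text \<open>A permutation of {..<k} is also one of {..<Suc k} that fixes k, with the same sign, and
  it commutes with dropping component k.\<close>

lemma alternating_forget:
  assumes "alternating (Suc k) c"
  shows "alternating k (simplicial_push (forget k (Suc k)) c)"
  unfolding alternating_def
proof (intro allI impI)
  fix \<sigma> :: "nat \<Rightarrow> nat" assume \<sigma>: "\<sigma> permutes {..<k}"
  have eq: "forget k (Suc k) x \<circ> \<sigma> = forget k (Suc k) (x \<circ> \<sigma>)" for x :: "nat \<Rightarrow> 'a"
  proof
    fix l show "(forget k (Suc k) x \<circ> \<sigma>) l = forget k (Suc k) (x \<circ> \<sigma>) l"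
      using permutes_in_image[OF \<sigma>, of l] permutes_not_in[OF \<sigma>, of l] by (auto simp: forget_def)
  qed
  have "\<sigma> permutes {..<Suc k}" by (rule permutes_subset[OF \<sigma>]) auto
  then have "simplicial_push (\<lambda>x. x \<circ> \<sigma>) c = frag_cmul (sign \<sigma>) c"
    using assms by (simp add: alternating_def)
  moreover have "simplicial_push (\<lambda>x. x \<circ> \<sigma>) (simplicial_push (forget k (Suc k)) c) =
      simplicial_push (forget k (Suc k)) (simplicial_push (\<lambda>x. x \<circ> \<sigma>) c)"
    by (simp only: push_push eq)
  ultimately show "simplicial_push (\<lambda>x. x \<circ> \<sigma>) (simplicial_push (forget k (Suc k)) c) =
      frag_cmul (sign \<sigma>) (simplicial_push (forget k (Suc k)) c)"
    by (simp only: push_cmul)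
qed

text \<open>Dropping the last two components does not see their exchange, while the exchange negates
  c. The result equals its own negative and vanishes, as integer coefficients have no
  2-torsion.\<close>

lemma alternating_forget_forget:
  assumes "alternating (Suc (Suc k)) c"
  shows "simplicial_push (forget k (Suc k)) (simplicial_push (forget (Suc k) (Suc (Suc k))) c) = 0"
proof -
  let ?t = "\<lambda>x. forget k (Suc k) (forget (Suc k) (Suc (Suc k)) x)"
  have "?t (x \<circ> adj k) = ?t x" for x :: "nat \<Rightarrow> 'a"
    by (auto simp: forget_def fun_eq_iff Transposition.transpose_def)
  then have "simplicial_push ?t c = simplicial_push ?t (simplicial_push (\<lambda>x. x \<circ> adj k) c)"
    by (simp add: push_push)
  also have "\<dots> = - simplicial_push ?t c"
    using alternating_adj[OF assms, of k] by (simp add: push_minus)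
  finally show ?thesis by (simp add: push_push frag_eq_minus_self)
qed

section \<open>Inserting a section as an extra row\<close>

text \<open>The common image of all rows is read off row 0, and \<open>s\<close> chooses the simplex
  over it that is inserted. These maps are the building blocks of both contracting
  homotopies.\<close>

definition insert_section :: "('a \<Rightarrow> 'b) \<Rightarrow> ('b list \<Rightarrow> 'a list) \<Rightarrow> nat \<Rightarrow> nat \<Rightarrow>
    (nat \<Rightarrow> 'a) simp_chain \<Rightarrow> (nat \<Rightarrow> 'a) simp_chain" where
  "insert_section f s k i = frag_extend (\<lambda>vs. frag_of (insert_row k i (s (map f (row 0 vs))) vs))"

definition singleton_section :: "('b list \<Rightarrow> 'a list) \<Rightarrow> 'b list \<Rightarrow> (nat \<Rightarrow> 'a) list" where
  "singleton_section s w = map (\<lambda>a. \<lambda>l\<in>{..<1}. a) (s w)"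

text \<open>On 1-tuples this is the chain map induced by f. On longer tuples every component would
  give the same value, since the rows have one image.\<close>

definition augment :: "('a \<Rightarrow> 'b) \<Rightarrow> (nat \<Rightarrow> 'a) simp_chain \<Rightarrow> 'b simp_chain" where
  "augment f = simplicial_push (\<lambda>v. f (v 0))"

lemma insert_section_cmul: "insert_section f s k i (frag_cmul a c) = frag_cmul a (insert_section f s k i c)"
  and insert_section_minus: "insert_section f s k i (- c) = - insert_section f s k i c"
  and insert_section_0 [simp]: "insert_section f s k i 0 = 0"
  by (simp_all add: insert_section_def frag_extend_cmul frag_extend_minus)

lemma insert_section_sum: "finite I \<Longrightarrow> insert_section f s k i (\<Sum>j\<in>I. c j) = (\<Sum>j\<in>I. insert_section f s k i (c j))"
  by (simp add: insert_section_def frag_extend_sum comp_def)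

lemma augment_eq: "augment f c = frag_extend (\<lambda>vs. frag_of (map f (row 0 vs))) c"
  by (simp add: augment_def simplicial_push_def row_def comp_def)

lemma tuplesI:
  assumes "set vs \<subseteq> extensional {..<k}" "0 < k"
    and "\<And>l. l < k \<Longrightarrow> row l vs \<in> S \<and> map f (row l vs) = w"
  shows "vs \<in> tuples f S k"
  unfolding tuples_def using assms by fastforce

lemma tuplesD:
  assumes "vs \<in> tuples f S k"
  shows "set vs \<subseteq> extensional {..<k}" "\<And>l. l < k \<Longrightarrow> row l vs \<in> S"
    "\<And>l. l < k \<Longrightarrow> map f (row l vs) = map f (row 0 vs)"
  using assms unfolding tuples_def by blast+

text \<open>One simplicial degree at a time: S stands for the simplices of X given by lists of
  length n, and s is a section of the map induced by f on them. The section need not respect faces,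
  since exactness of a row concerns d'' alone.\<close>

locale section_of_tuples =
  fixes f :: "'a \<Rightarrow> 'b" and S :: "'a list set" and n :: nat and s :: "'b list \<Rightarrow> 'a list"
  assumes length_S: "vs \<in> S \<Longrightarrow> length vs = n"
    and s_in: "u \<in> S \<Longrightarrow> s (map f u) \<in> S"
    and map_s: "u \<in> S \<Longrightarrow> map f (s (map f u)) = map f u"
begin

abbreviation W where "W k \<equiv> tuples f S k"

lemma W_length: "vs \<in> W (Suc k) \<Longrightarrow> length vs = n"
  using length_S[of "row 0 vs"] tuplesD(2)[of vs f S "Suc k" 0] by simp

lemma W_base: "vs \<in> W k \<Longrightarrow> l < k \<Longrightarrow> map f (row l vs) = map f (row 0 vs)"
  by (rule tuplesD(3))

lemma W_section:
  assumes "vs \<in> W (Suc k)"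
  shows "length (s (map f (row 0 vs))) = length vs" "s (map f (row 0 vs)) \<in> S"
    "map f (s (map f (row 0 vs))) = map f (row 0 vs)"
proof -
  have "row 0 vs \<in> S" using tuplesD(2)[OF assms] by simp
  then show "length (s (map f (row 0 vs))) = length vs" "s (map f (row 0 vs)) \<in> S"
    "map f (s (map f (row 0 vs))) = map f (row 0 vs)"
    using s_in map_s length_S[of "s (map f (row 0 vs))"] W_length[OF assms] by auto
qed

lemma insert_row_in_W:
  assumes "vs \<in> W (Suc k)" "i \<le> Suc k"
  shows "insert_row (Suc k) i (s (map f (row 0 vs))) vs \<in> W (Suc (Suc k))"
proof -
  let ?v = "insert_row (Suc k) i (s (map f (row 0 vs))) vs"
  have "row l ?v \<in> S \<and> map f (row l ?v) = map f (row 0 vs)" if "l < Suc (Suc k)" for l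
  proof (cases "l = i")
    case False
    then have "(if l < i then l else l - 1) < Suc k" using that assms(2) by auto
    then have "row (if l < i then l else l - 1) vs \<in> S"
      "map f (row (if l < i then l else l - 1) vs) = map f (row 0 vs)"
      by (rule tuplesD[OF assms(1)])+
    then show ?thesis using W_section[OF assms(1)] that False by (auto simp: row_insert_row split: if_splits)
  qed (use W_section[OF assms(1)] that in \<open>simp add: row_insert_row\<close>)
  then show ?thesis by (intro tuplesI insert_row_extensional) auto
qed

lemma keys_insert_section:
  assumes "Poly_Mapping.keys c \<subseteq> W (Suc k)" "i \<le> Suc k"
  shows "Poly_Mapping.keys (insert_section f s (Suc k) i c) \<subseteq> W (Suc (Suc k))"
  unfolding insert_section_def using assms insert_row_in_W
  by (intro order_trans[OF keys_frag_extend]) auto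

lemma forget_in_W:
  assumes "vs \<in> W (Suc (Suc k))"
  shows "map (forget i (Suc (Suc k))) vs \<in> W (Suc k)"
proof -
  let ?v = "map (forget i (Suc (Suc k))) vs"
  have "row l ?v \<in> S \<and> map f (row l ?v) = map f (row 0 vs)" if "l < Suc k" for l
    unfolding row_forget[OF that] by (intro conjI tuplesD[OF assms]) (use that in auto)
  then show ?thesis by (intro tuplesI) (auto simp: forget_extensional)
qed

lemma base_forget:
  assumes "vs \<in> W (Suc (Suc k))"
  shows "map f (row 0 (map (forget i (Suc (Suc k))) vs)) = map f (row 0 vs)"
  using assms row_forget[of 0 "Suc k" i vs] W_base[OF assms, of "Suc 0"] by auto

lemma push_forget_insert_same:
  assumes "Poly_Mapping.keys c \<subseteq> W (Suc k)" "i \<le> Suc k"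
  shows "simplicial_push (forget i (Suc (Suc k))) (insert_section f s (Suc k) i c) = c"
proof -
  have "simplicial_push (forget i (Suc (Suc k))) (insert_section f s (Suc k) i c) = frag_extend frag_of c"
    unfolding simplicial_push_def insert_section_def frag_extend_frag_extend
  proof (rule frag_extend_eq)
    fix vs assume "vs \<in> Poly_Mapping.keys c"
    then have vs: "vs \<in> W (Suc k)" using assms by blast
    then have "set vs \<subseteq> extensional {..<Suc k}" by (rule tuplesD)
    then show "frag_extend (\<lambda>vs. frag_of (map (forget i (Suc (Suc k))) vs))
        (frag_of (insert_row (Suc k) i (s (map f (row 0 vs))) vs)) = frag_of vs"
      using forget_insert_row_same[of "s (map f (row 0 vs))" vs "Suc k" i] W_section(1)[OF vs] assms(2)
      by simp
  qed
  then show ?thesis by (metis frag_expansion)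
qed

text \<open>The inserted row depends on the common image, which forgetting a component preserves.
  The identity between forgetting and inserting is a hypothesis, so insertion in first position and
  forgetting of the last component are treated together.\<close>

lemma push_forget_insert:
  assumes "Poly_Mapping.keys c \<subseteq> W (Suc (Suc k))"
    and "\<And>u vs :: (nat \<Rightarrow> 'a) list. length u = length vs \<Longrightarrow>
      map (forget i (Suc (Suc (Suc k)))) (insert_row (Suc (Suc k)) j u vs) =
      insert_row (Suc k) j u (map (forget i' (Suc (Suc k))) vs)"
  shows "simplicial_push (forget i (Suc (Suc (Suc k)))) (insert_section f s (Suc (Suc k)) j c) =
    insert_section f s (Suc k) j (simplicial_push (forget i' (Suc (Suc k))) c)"
  unfolding simplicial_push_def insert_section_def frag_extend_frag_extend
proof (rule frag_extend_eq)
  fix vs assume "vs \<in> Poly_Mapping.keys c"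
  then have vs: "vs \<in> W (Suc (Suc k))" using assms by blast
  show "frag_extend (\<lambda>vs. frag_of (map (forget i (Suc (Suc (Suc k)))) vs))
      (frag_of (insert_row (Suc (Suc k)) j (s (map f (row 0 vs))) vs)) =
    frag_extend (\<lambda>vs. frag_of (insert_row (Suc k) j (s (map f (row 0 vs))) vs))
      (frag_of (map (forget i' (Suc (Suc k))) vs))"
    using assms(2)[OF W_section(1)[OF vs]] base_forget[OF vs] by simp
qed

text \<open>When the original row is forgotten, what remains is the chosen simplex over its image,
  so the composite factors through \<open>augment\<close> and vanishes with it.\<close>

lemma push_forget_insert_1:
  assumes c: "Poly_Mapping.keys c \<subseteq> W 1" and e: "augment f c = 0" and ij: "{i, j} = {0, 1}"
  shows "simplicial_push (forget i 2) (insert_section f s 1 j c) = 0"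
proof -
  have "simplicial_push (forget i 2) (insert_section f s 1 j c) =
      frag_extend (\<lambda>vs. frag_of (singleton_section s (map f (row 0 vs)))) c"
    unfolding simplicial_push_def insert_section_def frag_extend_frag_extend
  proof (rule frag_extend_eq)
    fix vs assume "vs \<in> Poly_Mapping.keys c"
    then have vs: "vs \<in> W (Suc 0)" using c by auto
    let ?u = "s (map f (row 0 vs))"
    have "map (forget i (Suc (Suc 0))) (insert_row (Suc 0) j ?u vs) = singleton_section s (map f (row 0 vs))"
    proof (rule rows_eqI[of _ _ "Suc 0"])
      fix l assume "l < Suc 0"
      then have "l = 0" by simp
      have "row 0 (singleton_section s (map f (row 0 vs))) = ?u"
        by (simp add: row_def singleton_section_def comp_def)
      then show "row l (map (forget i (Suc (Suc 0))) (insert_row (Suc 0) j ?u vs)) =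
          row l (singleton_section s (map f (row 0 vs)))"
        using W_section(1)[OF vs] ij unfolding \<open>l = 0\<close>
        by (auto simp: row_forget row_insert_row doubleton_eq_iff)
    qed (use W_section(1)[OF vs] forget_extensional[of i "Suc 0"] in \<open>auto simp: singleton_section_def\<close>)
    then show "frag_extend (\<lambda>vs. frag_of (map (forget i 2) vs)) (frag_of (insert_row 1 j ?u vs)) =
        frag_of (singleton_section s (map f (row 0 vs)))"
      by (simp add: numeral_2_eq_2)
  qed
  also have "\<dots> = frag_extend (\<lambda>w. frag_of (singleton_section s w)) (augment f c)"
    by (simp add: augment_eq frag_extend_frag_extend)
  finally show ?thesis using e by simp
qed

end

section \<open>The contracting homotopies of the two kinds of rows\<close>

context section_of_tuples
begin

lemma rho_exact_1:
  assumes "Poly_Mapping.keys c \<subseteq> W 1" "augment f c = 0"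
  shows "(\<Sum>i<2. frag_cmul ((-1) ^ i) (simplicial_push (forget i 2) (insert_section f s 1 0 c))) = c"
  using assms push_forget_insert_same[of c 0 0] push_forget_insert_1[of c 1 0]
  by (simp add: numeral_2_eq_2 insert_commute)

text \<open>Forgetting the inserted row 0 returns c. Forgetting any later component commutes with
  the insertion with a shifted index, so these terms add up to minus the insertion applied to the
  alternating sum of c, which is 0.\<close>

lemma rho_exact_Suc:
  assumes c: "Poly_Mapping.keys c \<subseteq> W (Suc (Suc k))"
    and 0: "(\<Sum>i<Suc (Suc k). frag_cmul ((-1) ^ i) (simplicial_push (forget i (Suc (Suc k))) c)) = 0"
  shows "(\<Sum>i<Suc (Suc (Suc k)). frag_cmul ((-1) ^ i)
    (simplicial_push (forget i (Suc (Suc (Suc k)))) (insert_section f s (Suc (Suc k)) 0 c))) = c"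
proof -
  let ?b = "insert_section f s (Suc (Suc k)) 0 c"
  have "simplicial_push (forget (Suc i) (Suc (Suc (Suc k)))) ?b =
      insert_section f s (Suc k) 0 (simplicial_push (forget i (Suc (Suc k))) c)"
    if "i < Suc (Suc k)" for i
    using that by (intro push_forget_insert[OF c] forget_insert_row_first) auto
  then have "(\<Sum>i<Suc (Suc k). frag_cmul ((-1) ^ Suc i) (simplicial_push (forget (Suc i) (Suc (Suc (Suc k)))) ?b)) =
      (\<Sum>i<Suc (Suc k). - insert_section f s (Suc k) 0 (frag_cmul ((-1) ^ i) (simplicial_push (forget i (Suc (Suc k))) c)))"
    by (intro sum.cong) (auto simp: insert_section_cmul)
  also have "\<dots> = - insert_section f s (Suc k) 0 (\<Sum>i<Suc (Suc k). frag_cmul ((-1) ^ i) (simplicial_push (forget i (Suc (Suc k))) c))"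
    by (simp only: insert_section_sum finite_lessThan sum_negf)
  also have "\<dots> = 0" by (simp only: 0 insert_section_0 minus_zero)
  finally show ?thesis
    using push_forget_insert_same[OF c, of 0]
    by (subst sum.lessThan_Suc_shift) (simp del: sum.lessThan_Suc)
qed

text \<open>The sign is normalised so that insertion in last position, i = k, has sign +1: this is
  the term that survives when the last component is forgotten.\<close>

definition antisymmetrized_insert :: "nat \<Rightarrow> (nat \<Rightarrow> 'a) simp_chain \<Rightarrow> (nat \<Rightarrow> 'a) simp_chain" where
  "antisymmetrized_insert k c = (\<Sum>i\<le>k. frag_cmul ((-1) ^ (k + i)) (insert_section f s k i c))"

lemma keys_antisymmetrized_insert:
  assumes "Poly_Mapping.keys c \<subseteq> W (Suc k)"
  shows "Poly_Mapping.keys (antisymmetrized_insert (Suc k) c) \<subseteq> W (Suc (Suc k))"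
proof -
  have "Poly_Mapping.keys (frag_cmul ((-1) ^ (Suc k + i)) (insert_section f s (Suc k) i c)) \<subseteq> W (Suc (Suc k))"
    if "i \<le> Suc k" for i
    using keys_insert_section[OF assms that] keys_cmul by blast
  then show ?thesis
    unfolding antisymmetrized_insert_def by (intro order_trans[OF keys_sum]) blast
qed

lemma eps_exact_1:
  assumes "Poly_Mapping.keys c \<subseteq> W 1" "augment f c = 0"
  shows "simplicial_push (forget 1 2) (antisymmetrized_insert 1 c) = c"
  using assms push_forget_insert_same[of c 0 1] push_forget_insert_1[of c 1 0]
  by (simp add: antisymmetrized_insert_def push_add push_minus push_diff numeral_2_eq_2 insert_commute)

text \<open>For insertion before the last position, forgetting the last component passes to c and
  gives 0. Insertion in last position is undone and returns c.\<close>

lemma eps_exact_Suc: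
  assumes c: "Poly_Mapping.keys c \<subseteq> W (Suc (Suc k))"
    and 0: "simplicial_push (forget (Suc k) (Suc (Suc k))) c = 0"
  shows "simplicial_push (forget (Suc (Suc k)) (Suc (Suc (Suc k)))) (antisymmetrized_insert (Suc (Suc k)) c) = c"
proof -
  let ?p = "simplicial_push (forget (Suc (Suc k)) (Suc (Suc (Suc k))))"
  have "?p (insert_section f s (Suc (Suc k)) i c) = 0" if "i \<le> Suc k" for i
  proof -
    have "?p (insert_section f s (Suc (Suc k)) i c) =
        insert_section f s (Suc k) i (simplicial_push (forget (Suc k) (Suc (Suc k))) c)"
      using that by (intro push_forget_insert[OF c] forget_insert_row_last) auto
    then show ?thesis by (simp add: 0)
  qed
  then have "(\<Sum>i\<le>Suc k. frag_cmul ((-1) ^ (Suc (Suc k) + i)) (?p (insert_section f s (Suc (Suc k)) i c))) = 0"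
    by (intro sum.neutral) simp
  moreover have "?p (insert_section f s (Suc (Suc k)) (Suc (Suc k)) c) = c"
    by (rule push_forget_insert_same[OF c]) simp
  moreover have "?p (antisymmetrized_insert (Suc (Suc k)) c) =
      (\<Sum>i\<le>Suc k. frag_cmul ((-1) ^ (Suc (Suc k) + i)) (?p (insert_section f s (Suc (Suc k)) i c))) +
      ?p (insert_section f s (Suc (Suc k)) (Suc (Suc k)) c)"
    unfolding antisymmetrized_insert_def sum.atMost_Suc[of _ "Suc k"]
    by (simp add: push_add push_cmul push_sum comp_def flip: mult_2 del: sum.atMost_Suc)
  ultimately show ?thesis by simp
qed

lemma push_adj_insert_section:
  assumes c: "Poly_Mapping.keys c \<subseteq> W (Suc k)" and alt: "alternating (Suc k) c"
    and a: "a \<le> k" and i: "i \<le> Suc k" "i \<noteq> a" "i \<noteq> Suc a"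
  shows "simplicial_push (\<lambda>x. x \<circ> adj a) (insert_section f s (Suc k) i c) = - insert_section f s (Suc k) i c"
proof -
  \<comment> \<open>The exchanged rows a and a + 1 are old rows; b is the index of the first of them
    before the insertion, one less if the new row precedes them.\<close>
  define b where "b = (if i < a then a - 1 else a)"
  have b: "Suc b < Suc k" using a i by (auto simp: b_def)
  have row: "map (\<lambda>x. x \<circ> adj a) (insert_row (Suc k) i u vs) = insert_row (Suc k) i u (map (\<lambda>x. x \<circ> adj b) vs)"
    if "length u = length vs" for u and vs :: "(nat \<Rightarrow> 'a) list"
  proof (cases "i < a")
    case True
    then obtain a' where "a = Suc a'" by (cases a) auto
    then show ?thesis using adj_insert_row_above[OF that, of i a' "Suc k"] True a by (simp add: b_def)
  next
    case False
    then show ?thesis using adj_insert_row_below[OF that, of a i "Suc k"] i by (simp add: b_def)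
  qed
  have "simplicial_push (\<lambda>x. x \<circ> adj a) (insert_section f s (Suc k) i c) =
      insert_section f s (Suc k) i (simplicial_push (\<lambda>x. x \<circ> adj b) c)"
    unfolding simplicial_push_def insert_section_def frag_extend_frag_extend
  proof (rule frag_extend_eq)
    fix vs assume "vs \<in> Poly_Mapping.keys c"
    then have vs: "vs \<in> W (Suc k)" using c by blast
    have "adj b 0 < Suc k" using b by (auto simp: Transposition.transpose_def)
    then have "map f (row 0 (map (\<lambda>x. x \<circ> adj b) vs)) = map f (row 0 vs)"
      unfolding row_comp using W_base[OF vs] by blast
    then show "frag_extend (\<lambda>vs. frag_of (map (\<lambda>x. x \<circ> adj a) vs))
        (frag_of (insert_row (Suc k) i (s (map f (row 0 vs))) vs)) =
      frag_extend (\<lambda>vs. frag_of (insert_row (Suc k) i (s (map f (row 0 vs))) vs))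
        (frag_of (map (\<lambda>x. x \<circ> adj b) vs))"
      using row[OF W_section(1)[OF vs]] by simp
  qed
  also have "\<dots> = - insert_section f s (Suc k) i c"
    by (simp only: alternating_adj[OF alt b] insert_section_minus)
  finally show ?thesis .
qed

lemma push_adj_insert_section_at:
  assumes c: "Poly_Mapping.keys c \<subseteq> W (Suc k)" and a: "a \<le> k" and i: "i = a \<or> i = Suc a"
  shows "simplicial_push (\<lambda>x. x \<circ> adj a) (insert_section f s (Suc k) i c) = insert_section f s (Suc k) (adj a i) c"
  unfolding simplicial_push_def insert_section_def frag_extend_frag_extend
proof (rule frag_extend_eq)
  fix vs assume "vs \<in> Poly_Mapping.keys c"
  then have vs: "vs \<in> W (Suc k)" using c by blast
  show "frag_extend (\<lambda>vs. frag_of (map (\<lambda>x. x \<circ> adj a) vs))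
      (frag_of (insert_row (Suc k) i (s (map f (row 0 vs))) vs)) =
    frag_of (insert_row (Suc k) (adj a i) (s (map f (row 0 vs))) vs)"
    using adj_insert_row_at[OF W_section(1)[OF vs], of a "Suc k"] a i by auto
qed

text \<open>By \<open>alternatingI\<close> adjacent transpositions suffice. The exchange of rows a
  and a + 1 swaps the insertions at these two positions, which carry opposite signs, and negates
  every other insertion because c is alternating. Reindexing the sum by the same transposition gives
  the negative.\<close>

lemma alternating_antisymmetrized_insert:
  assumes c: "Poly_Mapping.keys c \<subseteq> W (Suc k)" and alt: "alternating (Suc k) c"
  shows "alternating (Suc (Suc k)) (antisymmetrized_insert (Suc k) c)"
proof (rule alternatingI)
  fix a assume "Suc a < Suc (Suc k)"
  then have a: "a \<le> k" by simp
  let ?h = "\<lambda>i. insert_section f s (Suc k) i c"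
  have term_eq: "frag_cmul ((-1) ^ (Suc k + i)) (simplicial_push (\<lambda>x. x \<circ> adj a) (?h i)) =
      - frag_cmul ((-1) ^ (Suc k + adj a i)) (?h (adj a i))" if "i \<le> Suc k" for i
  proof (cases "i = a \<or> i = Suc a")
    case True
    \<comment> \<open>The transposition changes the position by one and so its parity.\<close>
    then have "(-1 :: int) ^ (Suc k + i) = - ((-1) ^ (Suc k + adj a i))" by auto
    then show ?thesis by (simp only: push_adj_insert_section_at[OF c a True] minus_frag_cmul)
  next
    case False
    then have "adj a i = i" by (auto simp: Transposition.transpose_def)
    then show ?thesis
      using push_adj_insert_section[OF c alt a that] False
      by (simp add: frag_cmul_uminus del: minus_frag_cmul)
  qed
  have "simplicial_push (\<lambda>x. x \<circ> adj a) (antisymmetrized_insert (Suc k) c) =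
      (\<Sum>i\<le>Suc k. frag_cmul ((-1) ^ (Suc k + i)) (simplicial_push (\<lambda>x. x \<circ> adj a) (?h i)))"
    by (simp only: antisymmetrized_insert_def push_sum finite_atMost push_cmul)
  also have "\<dots> = (\<Sum>i\<le>Suc k. - frag_cmul ((-1) ^ (Suc k + adj a i)) (?h (adj a i)))"
    by (rule sum.cong[OF refl], rule term_eq) simp
  also have "\<dots> = - (\<Sum>i\<le>Suc k. frag_cmul ((-1) ^ (Suc k + adj a i)) (?h (adj a i)))"
    by (rule sum_negf)
  also have "(\<Sum>i\<le>Suc k. frag_cmul ((-1) ^ (Suc k + adj a i)) (?h (adj a i))) = antisymmetrized_insert (Suc k) c"
  proof -
    have "adj a permutes {..Suc k}" using a by (intro permutes_swap_id) auto
    from sum.permute[OF this, of "\<lambda>i. frag_cmul ((-1) ^ (Suc k + i)) (?h i)"]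
    show ?thesis by (simp only: antisymmetrized_insert_def comp_def)
  qed
  finally show "simplicial_push (\<lambda>x. x \<circ> adj a) (antisymmetrized_insert (Suc k) c) =
      - antisymmetrized_insert (Suc k) c" .
qed

end

section \<open>The two double complexes\<close>

lemma rho_Suc_Suc:
  "rho (Suc (Suc k)) n c = frag_cmul ((-1) ^ n)
    (\<Sum>i<Suc (Suc k). frag_cmul ((-1) ^ i) (simplicial_push (forget i (Suc (Suc k))) c))"
  by (simp add: rho_def)

lemma eps_Suc_Suc:
  "eps (Suc (Suc k)) n c = frag_cmul ((-1) ^ n) (simplicial_push (forget (Suc k) (Suc (Suc k))) c)"
  by (simp add: eps_def)

lemma rho_0 [simp]: "rho (Suc 0) n c = 0"
  and eps_0 [simp]: "eps (Suc 0) n c = 0"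
  by (simp_all add: rho_def eps_def)

lemma rho_add: "rho k n (c + b) = rho k n c + rho k n b"
  by (simp add: rho_def push_add frag_cmul_distrib2 sum.distrib)

lemma eps_add: "eps k n (c + b) = eps k n c + eps k n b"
  by (simp add: eps_def push_add frag_cmul_distrib2)

lemma boundary_rho: "simplicial_boundary m (rho k n c) = rho k n (simplicial_boundary m c)"
  by (simp add: rho_def boundary_cmul boundary_sum boundary_push)

lemma boundary_eps: "simplicial_boundary m (eps k n c) = eps k n (simplicial_boundary m c)"
  by (simp add: eps_def boundary_cmul boundary_push)

text \<open>The factor (-1)^n makes d'' change sign with the simplicial degree. Without it d' and
  d'' would commute instead of anticommuting.\<close>

lemma rho_Suc_degree: "rho k (Suc n) c = - rho k n c"
  and eps_Suc_degree: "eps k (Suc n) c = - eps k n c"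
  by (simp_all add: rho_def eps_def)

lemma rho_rho: "rho (Suc (Suc k)) n (rho (Suc (Suc (Suc k))) n c) = 0"
proof -
  let ?t = "\<lambda>i j. simplicial_push (\<lambda>x. forget j (Suc (Suc k)) (forget i (Suc (Suc (Suc k))) x)) c"
  have "rho (Suc (Suc k)) n (rho (Suc (Suc (Suc k))) n c) = frag_cmul ((-1) ^ n) (frag_cmul ((-1) ^ n)
      (\<Sum>j\<le>Suc k. \<Sum>i\<le>Suc (Suc k). frag_cmul ((-1) ^ (i + j)) (?t i j)))"
    unfolding rho_Suc_Suc lessThan_Suc_atMost
    by (simp add: push_cmul push_sum push_push frag_cmul_sum power_add mult.left_commute mult.commute
        del: sum.atMost_Suc)
  also have "(\<Sum>j\<le>Suc k. \<Sum>i\<le>Suc (Suc k). frag_cmul ((-1) ^ (i + j)) (?t i j)) = 0"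
    \<comment> \<open>Once the component forgotten first is the outer index, the identity
      \<open>forget_forget\<close> has the form that \<open>alternating_double_sum\<close>
      cancels.\<close>
    by (subst sum.swap) (intro alternating_double_sum; simp add: forget_forget)
  finally show ?thesis by simp
qed

lemma keys_rho:
  assumes "Poly_Mapping.keys c \<subseteq> A" "\<And>vs i. vs \<in> A \<Longrightarrow> map (forget i k) vs \<in> B"
  shows "Poly_Mapping.keys (rho k n c) \<subseteq> B"
proof -
  have "Poly_Mapping.keys (frag_cmul ((-1) ^ i) (simplicial_push (forget i k) c)) \<subseteq> B" for i
    using keys_push[of "forget i k" c] assms keys_cmul by blast
  then have "Poly_Mapping.keys (\<Sum>i<k. frag_cmul ((-1) ^ i) (simplicial_push (forget i k) c)) \<subseteq> B"
    by (intro order_trans[OF keys_sum]) blast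
  from order_trans[OF keys_cmul this] show ?thesis unfolding rho_def by simp
qed

lemma keys_eps:
  assumes "Poly_Mapping.keys c \<subseteq> A" "\<And>vs i. vs \<in> A \<Longrightarrow> map (forget i k) vs \<in> B"
  shows "Poly_Mapping.keys (eps k n c) \<subseteq> B"
proof -
  have "Poly_Mapping.keys (simplicial_push (forget (k - 1) k) c) \<subseteq> B"
    using keys_push[of "forget (k - 1) k" c] assms by blast
  from order_trans[OF keys_cmul this] show ?thesis unfolding eps_def by simp
qed

lemma alternating_eps:
  assumes "alternating (Suc (Suc k)) c"
  shows "alternating (Suc k) (eps (Suc (Suc k)) n c)"
  unfolding eps_Suc_Suc by (intro alternating_cmul alternating_forget assms)

lemma eps_eps:
  assumes "alternating (Suc (Suc (Suc k))) c"
  shows "eps (Suc (Suc k)) n (eps (Suc (Suc (Suc k))) n c) = 0"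
  unfolding eps_Suc_Suc by (simp add: push_cmul alternating_forget_forget[OF assms])

lemma augment_add: "augment f (c + b) = augment f c + augment f b"
  by (simp add: augment_def push_add)

lemma augment_boundary: "augment f (simplicial_boundary n c) = simplicial_boundary n (augment f c)"
  by (simp add: augment_def boundary_push)

lemma augment_forget:
  assumes "Poly_Mapping.keys c \<subseteq> tuples f S 2" "i < 2"
  shows "augment f (simplicial_push (forget i 2) c) = augment f c"
  unfolding augment_def push_push
proof (rule push_cong)
  fix vs assume "vs \<in> Poly_Mapping.keys c"
  then have "map f (row 1 vs) = map f (row 0 vs)" using assms(1) tuplesD(3)[of vs f S 2 1] by auto
  then show "map (\<lambda>v. f (forget i 2 v 0)) vs = map (\<lambda>v. f (v 0)) vs"
    using assms(2) by (auto simp: forget_def row_def less_2_cases_iff)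
qed

lemma augment_rho:
  assumes "Poly_Mapping.keys c \<subseteq> tuples f S 2"
  shows "augment f (rho 2 n c) = 0"
proof -
  have "rho 2 n c = frag_cmul ((-1) ^ n) (simplicial_push (forget 0 2) c - simplicial_push (forget 1 2) c)"
    by (simp add: rho_def numeral_2_eq_2)
  then show ?thesis
    using augment_forget[OF assms, of 0] augment_forget[OF assms, of 1]
    by (simp add: augment_def push_cmul push_diff)
qed

text \<open>Already the augmentation of c vanishes: both components have the same image under f, so
  exchanging them changes nothing, while alternation changes the sign.\<close>

lemma augment_eps:
  assumes c: "Poly_Mapping.keys c \<subseteq> tuples f S 2" and alt: "alternating 2 c"
  shows "augment f (eps 2 n c) = 0"
proof -
  have "augment f c = augment f (simplicial_push (forget 0 2) c)"
    using augment_forget[OF c, of 0] by simp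
  also have "\<dots> = augment f (simplicial_push (\<lambda>x. x \<circ> adj 0) c)"
    by (simp add: augment_def push_push forget_def)
  also have "\<dots> = - augment f c"
    using alternating_adj[OF alt, of 0] by (simp add: augment_def push_minus)
  finally have "augment f c = 0" by (rule frag_eq_minus_self)
  then have "augment f (simplicial_push (forget 1 2) c) = 0" using augment_forget[OF c, of 1] by simp
  then show ?thesis by (simp add: eps_def augment_def push_cmul)
qed

lemma comm_group_restricted_frag:
  assumes "P 0" "\<And>x y. P x \<Longrightarrow> P y \<Longrightarrow> P (x + y)" "\<And>x. P x \<Longrightarrow> P (- x)"
  shows "comm_group ((free_Abelian_group A)\<lparr>carrier := {c. P c}\<rparr>)"
proof -
  let ?G = "(free_Abelian_group A)\<lparr>carrier := {c. P c}\<rparr>"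
  have "group ?G"
  proof (rule groupI)
    show "\<exists>y\<in>carrier ?G. y \<otimes>\<^bsub>?G\<^esub> x = \<one>\<^bsub>?G\<^esub>" if "x \<in> carrier ?G" for x
      using that assms by (intro bexI[of _ "- x"]) auto
  qed (use assms in \<open>auto simp: add.assoc\<close>)
  then show ?thesis by (rule group.group_comm_groupI) (simp add: add.commute)
qed

text \<open>The interface between geometry and algebra: S n and R n play the ordered n-simplices of
  X and Y. The condition \<open>image_S\<close> makes \<open>inv_into\<close> a section and the
  augmentation surjective.\<close>

locale fibred_simplices =
  fixes f :: "'a \<Rightarrow> 'b" and S :: "nat \<Rightarrow> 'a list set" and R :: "nat \<Rightarrow> 'b list set"
  assumes length_S: "vs \<in> S n \<Longrightarrow> length vs = Suc n"
    and face_S: "vs \<in> S (Suc n) \<Longrightarrow> i \<le> Suc n \<Longrightarrow> face i vs \<in> S n"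
    and image_S: "map f ` S n = R n"
begin

sublocale section_of_tuples f "S n" "Suc n" "inv_into (S n) (map f)" for n
  by unfold_locales (auto simp: length_S inv_into_into f_inv_into_f)

abbreviation WC :: "nat \<Rightarrow> nat \<Rightarrow> (nat \<Rightarrow> 'a) simp_chain monoid" where
  "WC p q \<equiv> free_Abelian_group (tuples f (S p) (Suc q))"

abbreviation AC :: "nat \<Rightarrow> nat \<Rightarrow> (nat \<Rightarrow> 'a) simp_chain monoid" where
  "AC p q \<equiv> (WC p q)\<lparr>carrier := {c. Poly_Mapping.keys c \<subseteq> tuples f (S p) (Suc q) \<and> alternating (Suc q) c}\<rparr>"

abbreviation TC :: "nat \<Rightarrow> 'b simp_chain monoid" where
  "TC n \<equiv> free_Abelian_group (R n)"

lemma length_R: "w \<in> R n \<Longrightarrow> length w = Suc n"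
  using length_S by (auto simp flip: image_S)

lemma face_R: "w \<in> R (Suc n) \<Longrightarrow> i \<le> Suc n \<Longrightarrow> face i w \<in> R n"
  using face_S by (auto simp: map_face[symmetric] simp flip: image_S)

lemma face_tuples:
  assumes "vs \<in> tuples f (S (Suc n)) (Suc k)" "i \<le> Suc n"
  shows "face i vs \<in> tuples f (S n) (Suc k)"
proof (rule tuplesI)
  show "set (face i vs) \<subseteq> extensional {..<Suc k}"
    using set_face_subset[of i vs] tuplesD(1)[OF assms(1)] by blast
  fix l assume l: "l < Suc k"
  have "row l (face i vs) = face i (row l vs)" for l by (simp add: row_def map_face)
  then show "row l (face i vs) \<in> S n \<and> map f (row l (face i vs)) = face i (map f (row 0 vs))"
    using face_S[OF tuplesD(2)[OF assms(1) l] assms(2)] tuplesD(3)[OF assms(1) l]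
    by (simp add: map_face)
qed simp

lemma keys_boundary_tuples:
  "Poly_Mapping.keys c \<subseteq> tuples f (S (Suc n)) (Suc k) \<Longrightarrow>
    Poly_Mapping.keys (simplicial_boundary (Suc n) c) \<subseteq> tuples f (S n) (Suc k)"
  using keys_boundary face_tuples by metis

lemma boundary_boundary_tuples:
  assumes "Poly_Mapping.keys c \<subseteq> tuples f (S (Suc (Suc n))) (Suc k)"
  shows "simplicial_boundary (Suc n) (simplicial_boundary (Suc (Suc n)) c) = 0"
  using assms W_length by (intro boundary_boundary) blast

lemma target_chain_complex: "chain_complex TC simplicial_boundary"
proof (rule chain_complex.intro)
  show "comm_group (TC n)" for n by (rule abelian_free_Abelian_group)
  show "simplicial_boundary (Suc n) c \<in> carrier (TC n)" if "c \<in> carrier (TC (Suc n))" for n c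
    using that keys_boundary[OF _ face_R] by simp
  show "simplicial_boundary (Suc n) (simplicial_boundary (Suc (Suc n)) c) = \<one>\<^bsub>TC n\<^esub>"
    if "c \<in> carrier (TC (Suc (Suc n)))" for n c
    using that length_R by (simp add: boundary_boundary subset_iff)
qed (simp_all add: boundary_add simplicial_boundary_def[of 0])

text \<open>\<open>P k\<close> selects a subgroup of the chains on \<open>k\<close>-fold tuples and \<open>d k n\<close> is \<open>\<varrho>\<^sup>k\<^sub>n\<close> or \<open>\<epsilon>\<^sup>k\<^sub>n\<close>.\<close>

lemma augmented_complexI:
  fixes P :: "nat \<Rightarrow> (nat \<Rightarrow> 'a) simp_chain \<Rightarrow> bool"
    and d :: "nat \<Rightarrow> nat \<Rightarrow> (nat \<Rightarrow> 'a) simp_chain \<Rightarrow> (nat \<Rightarrow> 'a) simp_chain"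
  assumes P_0: "\<And>k. P k 0" and P_add: "\<And>k c b. P k c \<Longrightarrow> P k b \<Longrightarrow> P k (c + b)"
    and P_minus: "\<And>k c. P k c \<Longrightarrow> P k (- c)"
    and P_boundary: "\<And>k n c. P k c \<Longrightarrow> P k (simplicial_boundary n c)"
    and P_1: "\<And>c. P 1 c"
    and d_1: "\<And>n c. d 1 n c = 0"
    and d_add: "\<And>k n c b. d k n (c + b) = d k n c + d k n b"
    and d_boundary: "\<And>k n m c. simplicial_boundary m (d k n c) = d k n (simplicial_boundary m c)"
    and d_Suc: "\<And>k n c. d k (Suc n) c = - d k n c"
    and d_closed: "\<And>k n m c. Poly_Mapping.keys c \<subseteq> tuples f (S m) (Suc (Suc k)) \<Longrightarrow> P (Suc (Suc k)) c \<Longrightarrow>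
      Poly_Mapping.keys (d (Suc (Suc k)) n c) \<subseteq> tuples f (S m) (Suc k) \<and> P (Suc k) (d (Suc (Suc k)) n c)"
    and d_d: "\<And>k n c. P (Suc (Suc (Suc k))) c \<Longrightarrow> d (Suc (Suc k)) n (d (Suc (Suc (Suc k))) n c) = 0"
    and d_augment: "\<And>n m c. Poly_Mapping.keys c \<subseteq> tuples f (S m) 2 \<Longrightarrow> P 2 c \<Longrightarrow> augment f (d 2 n c) = 0"
    and exact_1: "\<And>n c. Poly_Mapping.keys c \<subseteq> tuples f (S n) 1 \<Longrightarrow> augment f c = 0 \<Longrightarrow>
      \<exists>b. Poly_Mapping.keys b \<subseteq> tuples f (S n) 2 \<and> P 2 b \<and> d 2 n b = c"
    and exact: "\<And>k n c. Poly_Mapping.keys c \<subseteq> tuples f (S n) (Suc (Suc k)) \<Longrightarrow> P (Suc (Suc k)) c \<Longrightarrow>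
      d (Suc (Suc k)) n c = 0 \<Longrightarrow> \<exists>b. Poly_Mapping.keys b \<subseteq> tuples f (S n) (Suc (Suc (Suc k))) \<and>
        P (Suc (Suc (Suc k))) b \<and> d (Suc (Suc (Suc k))) n b = c"
  defines "C \<equiv> \<lambda>p q. (WC p q)\<lparr>carrier := {c. Poly_Mapping.keys c \<subseteq> tuples f (S p) (Suc q) \<and> P (Suc q) c}\<rparr>"
  shows "augmented_complex C (\<lambda>p q. simplicial_boundary p) (\<lambda>p q. d (Suc q) p)
    TC simplicial_boundary (\<lambda>n. augment f)"
proof -
  have carrier: "c \<in> carrier (C p q) \<longleftrightarrow> Poly_Mapping.keys c \<subseteq> tuples f (S p) (Suc q) \<and> P (Suc q) c"
    and mult: "c \<otimes>\<^bsub>C p q\<^esub> b = c + b" and one: "\<one>\<^bsub>C p q\<^esub> = 0" for c b p q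
    by (simp_all add: C_def)
  have comm: "comm_group (C p q)" for p q
    unfolding C_def
  proof (rule comm_group_restricted_frag)
    fix c b :: "(nat \<Rightarrow> 'a) simp_chain"
    assume "Poly_Mapping.keys c \<subseteq> tuples f (S p) (Suc q) \<and> P (Suc q) c"
      "Poly_Mapping.keys b \<subseteq> tuples f (S p) (Suc q) \<and> P (Suc q) b"
    then show "Poly_Mapping.keys (c + b) \<subseteq> tuples f (S p) (Suc q) \<and> P (Suc q) (c + b)"
      using keys_add[of c b] P_add by blast
  qed (simp_all add: P_0 P_minus)
  have bd: "simplicial_boundary (Suc p) c \<in> carrier (C p q)" if "c \<in> carrier (C (Suc p) q)" for p q c
    using that keys_boundary_tuples P_boundary by (simp add: carrier)
  have dc: "d (Suc (Suc q)) p c \<in> carrier (C p q)" if "c \<in> carrier (C p (Suc q))" for p q c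
    using that d_closed[of c p q p] unfolding carrier by blast
  have dbl: "double_complex C (\<lambda>p q. simplicial_boundary p) (\<lambda>p q. d (Suc q) p)"
    unfolding double_complex_def
  proof (intro conjI allI ballI)
    show "comm_group (C p q)" for p q by (rule comm)
    show "simplicial_boundary (Suc p) \<in> hom (C (Suc p) q) (C p q)" for p q
      using bd by (intro homI) (auto simp: mult boundary_add)
    show "d (Suc (Suc q)) p \<in> hom (C p (Suc q)) (C p q)" for p q
      using dc by (intro homI) (auto simp: mult d_add)
    show "simplicial_boundary 0 c = \<one>\<^bsub>C 0 q\<^esub>" for q c by (simp add: simplicial_boundary_def one)
    show "d (Suc 0) p c = \<one>\<^bsub>C p 0\<^esub>" for p c using d_1 by (simp add: one)
    show "simplicial_boundary (Suc p) (simplicial_boundary (Suc (Suc p)) c) = \<one>\<^bsub>C p q\<^esub>"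
      if "c \<in> carrier (C (Suc (Suc p)) q)" for p q c
      using that boundary_boundary_tuples[of c p q] by (simp add: carrier one)
    show "d (Suc (Suc q)) p (d (Suc (Suc (Suc q))) p c) = \<one>\<^bsub>C p q\<^esub>"
      if "c \<in> carrier (C p (Suc (Suc q)))" for p q c
      using that d_d by (simp add: carrier one)
    show "simplicial_boundary (Suc p) (d (Suc (Suc q)) (Suc p) c) \<otimes>\<^bsub>C p q\<^esub>
        d (Suc (Suc q)) p (simplicial_boundary (Suc p) c) = \<one>\<^bsub>C p q\<^esub>" for p q c
      by (simp add: d_boundary d_Suc boundary_minus mult one)
  qed
  have tuple_1: "map (\<lambda>a. \<lambda>l\<in>{..<Suc 0}. a) u \<in> tuples f (S n) (Suc 0)" if "u \<in> S n" for u n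
  proof -
    have "row 0 (map (\<lambda>a. \<lambda>l\<in>{..<Suc 0}. a) u) = u" by (simp add: row_def comp_def)
    then show ?thesis using that by (intro tuplesI) (auto simp: less_Suc_eq)
  qed
  have aug_in: "augment f c \<in> carrier (TC n)" if "c \<in> carrier (C n 0)" for n c
  proof -
    have "map (\<lambda>v. f (v 0)) vs \<in> R n" if "vs \<in> tuples f (S n) (Suc 0)" for vs
    proof -
      have "map f (row 0 vs) \<in> R n" using tuplesD(2)[OF that, of 0] image_S by auto
      then show ?thesis by (simp add: row_def comp_def)
    qed
    then show ?thesis
      using \<open>c \<in> _\<close> keys_push[of "\<lambda>v. f (v 0)" c] unfolding augment_def by (simp add: carrier) blast
  qed
  have surj: "augment f ` carrier (C n 0) = carrier (TC n)" for n
  proof (intro subset_antisym subsetI)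
    fix a assume a: "a \<in> carrier (TC n)"
    \<comment> \<open>A preimage of a: replace each generator by a chosen simplex over it and read
      that simplex as a 1-tuple.\<close>
    define c where "c = simplicial_push (\<lambda>a. \<lambda>l\<in>{..<Suc 0}. a) (frag_extend (\<lambda>w. frag_of (inv_into (S n) (map f) w)) a)"
    have inv: "inv_into (S n) (map f) w \<in> S n \<and> map f (inv_into (S n) (map f) w) = w"
      if "w \<in> Poly_Mapping.keys a" for w
      using that a image_S[of n] inv_into_into f_inv_into_f by (metis carrier_free_Abelian_group_iff subsetD)
    then have "Poly_Mapping.keys (frag_extend (\<lambda>w. frag_of (inv_into (S n) (map f) w)) a) \<subseteq> S n"
      by (intro order_trans[OF keys_frag_extend]) auto
    then have "Poly_Mapping.keys c \<subseteq> tuples f (S n) (Suc 0)"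
      unfolding c_def using tuple_1 by (intro order_trans[OF keys_push]) auto
    then have "c \<in> carrier (C n 0)" using P_1 by (simp add: carrier)
    moreover have "augment f c = frag_extend frag_of a"
      unfolding c_def augment_def push_push unfolding simplicial_push_def frag_extend_frag_extend
      using inv by (intro frag_extend_eq) simp
    then have "a = augment f c" by (metis frag_expansion)
    ultimately show "a \<in> augment f ` carrier (C n 0)" by blast
  qed (use aug_in in blast)
  show ?thesis
  proof (intro augmented_complex.intro dbl_complex.intro dbl target_chain_complex augmented_complex_axioms.intro)
    show "augment f \<in> hom (C n 0) (TC n)" for n
      using aug_in by (intro homI) (auto simp: mult augment_add)
    show "augment f (simplicial_boundary (Suc n) c) = simplicial_boundary (Suc n) (augment f c)" for n c
      by (rule augment_boundary)
    show "augment f (d (Suc 1) n c) = \<one>\<^bsub>TC n\<^esub>" if "c \<in> carrier (C n 1)" for n c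
      using that d_augment[of c n n] by (simp add: carrier numeral_2_eq_2)
    show "\<exists>b\<in>carrier (C n 1). d (Suc 1) n b = c" if "c \<in> carrier (C n 0)" "augment f c = \<one>\<^bsub>TC n\<^esub>" for n c
      using that exact_1[of c n] by (auto simp: carrier numeral_2_eq_2)
    show "\<exists>b\<in>carrier (C n (Suc (Suc q))). d (Suc (Suc (Suc q))) n b = c"
      if "c \<in> carrier (C n (Suc q))" "d (Suc (Suc q)) n c = \<one>\<^bsub>C n q\<^esub>" for n q c
      using that exact[of c n q] by (auto simp: carrier one)
  qed (rule surj)
qed

lemma augmented_W:
  "augmented_complex WC (\<lambda>p q. simplicial_boundary p) (\<lambda>p q. rho (Suc q) p)
    TC simplicial_boundary (\<lambda>n. augment f)"
proof -
  \<comment> \<open>The homotopy inverts the unsigned alternating sum, so the primitive is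
    multiplied by (-1)^n to cancel the sign contained in \<open>rho\<close>.\<close>
  have sign: "rho k n (frag_cmul ((-1) ^ n) b) = c"
    if "k = Suc (Suc k')" "(\<Sum>i<k. frag_cmul ((-1) ^ i) (simplicial_push (forget i k) b)) = c" for k k' n b and c :: "(nat \<Rightarrow> 'a) simp_chain"
  proof -
    have "rho k n (frag_cmul ((-1) ^ n) b) = frag_cmul ((-1) ^ n) (frag_cmul ((-1) ^ n)
        (\<Sum>i<k. frag_cmul ((-1) ^ i) (simplicial_push (forget i k) b)))"
      using that(1) by (simp add: rho_def push_cmul frag_cmul_sum mult.left_commute mult.commute del: sum.lessThan_Suc)
    then show ?thesis unfolding that(2) by (simp flip: power_add)
  qed
  \<comment> \<open>The carrier is restricted by a vacuous condition to match the form of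
    \<open>augmented_complexI\<close>; the last line removes it.\<close>
  have "augmented_complex
      (\<lambda>p q. (WC p q)\<lparr>carrier := {c. Poly_Mapping.keys c \<subseteq> tuples f (S p) (Suc q) \<and> True}\<rparr>)
      (\<lambda>p q. simplicial_boundary p) (\<lambda>p q. rho (Suc q) p) TC simplicial_boundary (\<lambda>n. augment f)"
  proof (rule augmented_complexI[where P = "\<lambda>_ _. True" and d = rho])
    show "Poly_Mapping.keys (rho (Suc (Suc k)) n c) \<subseteq> tuples f (S m) (Suc k) \<and> True"
      if "Poly_Mapping.keys c \<subseteq> tuples f (S m) (Suc (Suc k))" for c k n m
      using keys_rho[OF that] forget_in_W by blast
    show "augment f (rho 2 n c) = 0" if "Poly_Mapping.keys c \<subseteq> tuples f (S m) 2" for n m c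
      using that by (rule augment_rho)
    show "\<exists>b. Poly_Mapping.keys b \<subseteq> tuples f (S n) 2 \<and> True \<and> rho 2 n b = c"
      if c: "Poly_Mapping.keys c \<subseteq> tuples f (S n) 1" and 0: "augment f c = 0" for n c
    proof (intro exI conjI)
      let ?b = "insert_section f (inv_into (S n) (map f)) 1 0 c"
      show "rho 2 n (frag_cmul ((-1) ^ n) ?b) = c"
        by (rule sign[OF numeral_2_eq_2 rho_exact_1[OF c 0]])
      have "Poly_Mapping.keys ?b \<subseteq> tuples f (S n) 2"
        using keys_insert_section[of c n 0 0] c by (simp add: numeral_2_eq_2)
      then show "Poly_Mapping.keys (frag_cmul ((-1) ^ n) ?b) \<subseteq> tuples f (S n) 2"
        using keys_cmul by blast
    qed simp
    show "\<exists>b. Poly_Mapping.keys b \<subseteq> tuples f (S n) (Suc (Suc (Suc k))) \<and> True \<and> rho (Suc (Suc (Suc k))) n b = c"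
      if c: "Poly_Mapping.keys c \<subseteq> tuples f (S n) (Suc (Suc k))" and 0: "rho (Suc (Suc k)) n c = 0" for n k c
    proof (intro exI conjI)
      let ?b = "insert_section f (inv_into (S n) (map f)) (Suc (Suc k)) 0 c"
      have "(\<Sum>i<Suc (Suc k). frag_cmul ((-1) ^ i) (simplicial_push (forget i (Suc (Suc k))) c)) = 0"
        using 0 unfolding rho_Suc_Suc by simp
      then show "rho (Suc (Suc (Suc k))) n (frag_cmul ((-1) ^ n) ?b) = c"
        by (intro sign[OF refl] rho_exact_Suc[OF c])
      have "Poly_Mapping.keys ?b \<subseteq> tuples f (S n) (Suc (Suc (Suc k)))"
        by (rule keys_insert_section[OF c]) simp
      then show "Poly_Mapping.keys (frag_cmul ((-1) ^ n) ?b) \<subseteq> tuples f (S n) (Suc (Suc (Suc k)))"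
        using keys_cmul by blast
    qed simp
  qed (simp_all add: rho_add boundary_rho rho_Suc_degree rho_rho)
  then show ?thesis by (simp add: free_Abelian_group_def)
qed

text \<open>The alternating chains are taken on all tuples of W^k. That these are the alternating
  chains of D^k is the content of \<open>D_alt_chains_eq\<close>.\<close>

lemma augmented_A:
  "augmented_complex AC (\<lambda>p q. simplicial_boundary p) (\<lambda>p q. eps (Suc q) p)
    TC simplicial_boundary (\<lambda>n. augment f)"
proof (rule augmented_complexI[where P = alternating and d = eps])
  have sign: "eps k n (frag_cmul ((-1) ^ n) b) = c"
    if "k = Suc (Suc k')" "simplicial_push (forget (Suc k') k) b = c" for k k' n b and c :: "(nat \<Rightarrow> 'a) simp_chain"
    using that by (simp add: eps_def push_cmul flip: power_add)
  show "alternating k (- c)" if "alternating k c" for k and c :: "(nat \<Rightarrow> 'a) simp_chain"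
    using alternating_cmul[OF that, of "-1"] by simp
  show "alternating 1 c" for c :: "(nat \<Rightarrow> 'a) simp_chain"
    by (rule alternatingI) simp
  show "Poly_Mapping.keys (eps (Suc (Suc k)) n c) \<subseteq> tuples f (S m) (Suc k) \<and>
      alternating (Suc k) (eps (Suc (Suc k)) n c)"
    if "Poly_Mapping.keys c \<subseteq> tuples f (S m) (Suc (Suc k))" "alternating (Suc (Suc k)) c" for c k n m
    by (intro conjI keys_eps[OF that(1)] forget_in_W alternating_eps[OF that(2)])
  show "augment f (eps 2 n c) = 0"
    if "Poly_Mapping.keys c \<subseteq> tuples f (S m) 2" "alternating 2 c" for n m c
    using that by (rule augment_eps)
  show "\<exists>b. Poly_Mapping.keys b \<subseteq> tuples f (S n) 2 \<and> alternating 2 b \<and> eps 2 n b = c"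
    if c: "Poly_Mapping.keys c \<subseteq> tuples f (S n) 1" and 0: "augment f c = 0" for n c
  proof (intro exI conjI)
    let ?b = "antisymmetrized_insert n (Suc 0) c"
    have c': "Poly_Mapping.keys c \<subseteq> tuples f (S n) (Suc 0)" using c by simp
    show "eps 2 n (frag_cmul ((-1) ^ n) ?b) = c"
      using eps_exact_1[OF c 0] by (intro sign[OF numeral_2_eq_2]) simp
    show "Poly_Mapping.keys (frag_cmul ((-1) ^ n) ?b) \<subseteq> tuples f (S n) 2"
      using order_trans[OF keys_cmul keys_antisymmetrized_insert[OF c']] by (simp add: numeral_2_eq_2)
    \<comment> \<open>A single index has no adjacent pair, so the criterion is vacuous.\<close>
    have "alternating (Suc 0) c" by (rule alternatingI) simp
    then show "alternating 2 (frag_cmul ((-1) ^ n) ?b)"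
      using alternating_cmul[OF alternating_antisymmetrized_insert[OF c']] by (simp add: numeral_2_eq_2)
  qed
  show "\<exists>b. Poly_Mapping.keys b \<subseteq> tuples f (S n) (Suc (Suc (Suc k))) \<and>
      alternating (Suc (Suc (Suc k))) b \<and> eps (Suc (Suc (Suc k))) n b = c"
    if c: "Poly_Mapping.keys c \<subseteq> tuples f (S n) (Suc (Suc k))" and alt: "alternating (Suc (Suc k)) c"
      and 0: "eps (Suc (Suc k)) n c = 0" for n k c
  proof (intro exI conjI)
    let ?b = "antisymmetrized_insert n (Suc (Suc k)) c"
    have "simplicial_push (forget (Suc k) (Suc (Suc k))) c = 0" using 0 unfolding eps_Suc_Suc by simp
    then show "eps (Suc (Suc (Suc k))) n (frag_cmul ((-1) ^ n) ?b) = c"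
      by (intro sign[OF refl] eps_exact_Suc[OF c])
    show "Poly_Mapping.keys (frag_cmul ((-1) ^ n) ?b) \<subseteq> tuples f (S n) (Suc (Suc (Suc k)))"
      by (rule order_trans[OF keys_cmul keys_antisymmetrized_insert[OF c]])
    show "alternating (Suc (Suc (Suc k))) (frag_cmul ((-1) ^ n) ?b)"
      by (rule alternating_cmul[OF alternating_antisymmetrized_insert[OF c alt]])
  qed
qed (simp_all add: alternating_0 alternating_add alternating_boundary eps_add boundary_eps eps_Suc_degree eps_eps)

end

section \<open>Geometric simplicial complexes\<close>

lemma vertices_convex_hull: "\<not> affine_dependent A \<Longrightarrow> vertices (convex hull A) = A"
  by (simp add: vertices_def extreme_point_of_convex_hull_affine_independent)

text \<open>A canonical interior point. It turns a vertex set back into a point with that supporting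
  simplex, and f preserves it.\<close>

definition barycenter :: "'a::real_vector set \<Rightarrow> 'a" where
  "barycenter A = (\<Sum>v\<in>A. (1 / real (card A)) *\<^sub>R v)"

lemma barycenter_rel_interior:
  fixes A :: "'a::euclidean_space set"
  assumes "\<not> affine_dependent A" "A \<noteq> {}"
  shows "barycenter A \<in> rel_interior (convex hull A)"
proof -
  have "finite A" using assms(1) aff_independent_finite by blast
  then have "card A > 0" using assms(2) by (simp add: card_gt_0_iff)
  then show ?thesis
    unfolding rel_interior_convex_hull_explicit[OF assms(1)] barycenter_def
    by (intro CollectI exI[of _ "\<lambda>_. 1 / real (card A)"]) simp
qed

locale simplicial_complex =
  fixes K :: "'a::euclidean_space set set"
  assumes geometric_complex: "geometric_complex K"
begin

lemma vertices_simplex: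
  assumes "S \<in> K"
  shows "\<not> affine_dependent (vertices S)" "finite (vertices S)" "vertices S \<noteq> {}" "convex hull (vertices S) = S"
proof -
  obtain n where "int n simplex S" using geometric_complex assms by (auto simp: geometric_complex_def)
  then obtain C where C: "\<not> affine_dependent C" "int (card C) = int n + 1" "S = convex hull C"
    by (auto simp: simplex_def)
  then have "vertices S = C" by (simp add: vertices_convex_hull)
  moreover have "C \<noteq> {}" using C(2) by auto
  ultimately show "\<not> affine_dependent (vertices S)" "finite (vertices S)" "vertices S \<noteq> {}" "convex hull (vertices S) = S"
    using C aff_independent_finite by auto
qed

lemma vertex_set:
  assumes "A \<in> vertices ` K"
  shows "\<not> affine_dependent A" "finite A" "A \<noteq> {}" "convex hull A \<in> K" "vertices (convex hull A) = A"
  using assms vertices_simplex vertices_convex_hull by auto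

lemma subset_vertex_set:
  assumes A: "A \<in> vertices ` K" and B: "B \<subseteq> A" "B \<noteq> {}"
  shows "B \<in> vertices ` K"
proof -
  have indep: "\<not> affine_dependent B" using affine_independent_subset vertex_set(1)[OF A] B(1) by blast
  have "(convex hull B) face_of (convex hull A)"
    using face_of_convex_hull_affine_independent[OF vertex_set(1)[OF A]] B(1) by blast
  then have "convex hull B \<in> K"
    using geometric_complex vertex_set(4)[OF A] B(2) by (simp add: geometric_complex_def)
  then show ?thesis using vertices_convex_hull[OF indep] by force
qed

text \<open>If two simplices share a relative interior point, their intersection is a face of each
  that meets the relative interior. A proper face cannot, so the simplices coincide and the
  description is unique.\<close>

lemma supporting_simplex_eq:
  assumes "S \<in> K" "x \<in> rel_interior S"
  shows "supporting_simplex K x = S"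
  unfolding supporting_simplex_def
proof (rule the_equality)
  fix T assume T: "T \<in> K \<and> x \<in> rel_interior T"
  have sub: "A \<subseteq> B" if "A \<in> K" "B \<in> K" "x \<in> rel_interior A" "x \<in> rel_interior B" for A B
  proof (rule ccontr)
    assume "\<not> A \<subseteq> B"
    then have "A \<inter> B \<noteq> A" by blast
    moreover have "(A \<inter> B) face_of A" using geometric_complex that by (simp add: geometric_complex_def)
    ultimately have "(A \<inter> B) \<inter> rel_interior A = {}" by (intro face_of_disjoint_rel_interior)
    moreover have "x \<in> A \<inter> B" using that rel_interior_subset[of A] rel_interior_subset[of B] by auto
    ultimately show False using that(3) by blast
  qed
  show "T = S" by (intro subset_antisym sub) (use T assms in simp_all)
qed (use assms in simp)

lemma supporting_simplex_barycenter:
  assumes "A \<in> vertices ` K"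
  shows "supporting_simplex K (barycenter A) = convex hull A" "barycenter A \<in> \<Union>K"
    "vertices (supporting_simplex K (barycenter A)) = A"
proof -
  have "barycenter A \<in> rel_interior (convex hull A)"
    using vertex_set[OF assms] by (intro barycenter_rel_interior)
  then show "supporting_simplex K (barycenter A) = convex hull A" "barycenter A \<in> \<Union>K"
    using supporting_simplex_eq vertex_set(4)[OF assms] rel_interior_subset by blast+
  then show "vertices (supporting_simplex K (barycenter A)) = A" using vertex_set(5)[OF assms] by simp
qed

lemma supporting_simplex:
  assumes "x \<in> \<Union>K"
  shows "supporting_simplex K x \<in> K" "x \<in> rel_interior (supporting_simplex K x)"
proof -
  obtain S where S: "S \<in> K" "x \<in> S" using assms by blast
  let ?A = "vertices S"
  note v = vertices_simplex[OF S(1)]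
  have "x \<in> convex hull ?A" using S v(4) by simp
  then obtain u where u: "\<forall>a\<in>?A. 0 \<le> u a" "sum u ?A = 1" "(\<Sum>a\<in>?A. u a *\<^sub>R a) = x"
    unfolding convex_hull_finite[OF v(2)] by blast
  \<comment> \<open>The vertices with nonzero barycentric coordinate span the face that has x in its
    relative interior.\<close>
  define B where "B = {a \<in> ?A. u a \<noteq> 0}"
  have sums: "sum u B = 1" "(\<Sum>a\<in>B. u a *\<^sub>R a) = x"
  proof -
    have z: "B \<subseteq> ?A" "\<forall>a\<in>?A - B. u a = 0" "\<forall>a\<in>?A - B. u a *\<^sub>R a = 0" by (simp_all add: B_def)
    show "sum u B = 1" using sum.mono_neutral_right[OF v(2) z(1,2)] u(2) by simp
    show "(\<Sum>a\<in>B. u a *\<^sub>R a) = x" using sum.mono_neutral_right[OF v(2) z(1,3)] u(3) by simp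
  qed
  have B: "B \<in> vertices ` K"
  proof (rule subset_vertex_set)
    show "?A \<in> vertices ` K" using S(1) by (rule imageI)
    show "B \<subseteq> ?A" unfolding B_def by (rule Collect_restrict)
    show "B \<noteq> {}" using sums(1) by auto
  qed
  have "0 < u v" if "v \<in> B" for v
    using that u(1) less_eq_real_def by (auto simp: B_def)
  then have "x \<in> rel_interior (convex hull B)"
    unfolding rel_interior_convex_hull_explicit[OF vertex_set(1)[OF B]]
    using sums by (intro CollectI exI[of _ u]) blast
  then show "supporting_simplex K x \<in> K" "x \<in> rel_interior (supporting_simplex K x)"
    using supporting_simplex_eq[OF vertex_set(4)[OF B]] vertex_set(4)[OF B] by simp_all
qed

end

text \<open>Every function x |-> f x \<bullet> b is convex on S, so Jensen's inequality bounds the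
  difference of the two sides paired with b. Taking b to be this difference shows that its squared
  norm is at most 0.\<close>

lemma affine_on_segments_sum:
  fixes f :: "'a::real_vector \<Rightarrow> 'b::euclidean_space"
  assumes S: "convex S" and aff: "\<And>x y u. x \<in> S \<Longrightarrow> y \<in> S \<Longrightarrow> u \<in> {0..1} \<Longrightarrow>
      f ((1 - u) *\<^sub>R x + u *\<^sub>R y) = (1 - u) *\<^sub>R f x + u *\<^sub>R f y"
    and A: "finite A" "A \<subseteq> S" and u: "sum u A = 1" "\<And>v. v \<in> A \<Longrightarrow> 0 \<le> u v"
  shows "f (\<Sum>v\<in>A. u v *\<^sub>R v) = (\<Sum>v\<in>A. u v *\<^sub>R f v)"
proof -
  have "A \<noteq> {}" using u by auto
  have le: "f (\<Sum>v\<in>A. u v *\<^sub>R v) \<bullet> b \<le> (\<Sum>v\<in>A. u v *\<^sub>R f v) \<bullet> b" for b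
  proof -
    have "convex_on S (\<lambda>x. f x \<bullet> b)"
      using S aff by (intro convex_onI) (auto simp: inner_add_left)
    from convex_on_sum[OF A(1) \<open>A \<noteq> {}\<close> this u(1), of "\<lambda>x. x"] show ?thesis
      using u A by (auto simp: inner_sum_left)
  qed
  let ?d = "f (\<Sum>v\<in>A. u v *\<^sub>R v) - (\<Sum>v\<in>A. u v *\<^sub>R f v)"
  have "?d \<bullet> ?d \<le> 0" using le[of ?d] by (simp add: inner_diff_left)
  then have "?d \<bullet> ?d = 0" using inner_ge_zero by (rule order_antisym)
  then have "?d = 0" by (simp only: inner_eq_zero_iff)
  then show ?thesis by simp
qed

text \<open>The edge vectors from one vertex a are linearly independent, so a linear g takes their
  prescribed values; on the simplex f is then f a + g (x - a).\<close>

lemma continuous_on_affine_simplex: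
  fixes f :: "'a::euclidean_space \<Rightarrow> 'b::euclidean_space"
  assumes A: "\<not> affine_dependent A"
    and f: "\<And>u. sum u A = 1 \<Longrightarrow> (\<And>v. v \<in> A \<Longrightarrow> 0 \<le> u v) \<Longrightarrow> f (\<Sum>v\<in>A. u v *\<^sub>R v) = (\<Sum>v\<in>A. u v *\<^sub>R f v)"
  shows "continuous_on (convex hull A) f"
proof (cases "A = {}")
  case False
  then obtain a where a: "a \<in> A" by blast
  have fin: "finite A" using A aff_independent_finite by blast
  have "independent ((\<lambda>x. - a + x) ` (A - {a}))"
    using A a affine_dependent_iff_dependent[of a "A - {a}"] by (simp add: insert_absorb)
  then obtain g where g: "linear g" "\<And>x. x \<in> (\<lambda>x. - a + x) ` (A - {a}) \<Longrightarrow> g x = f (x + a) - f a"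
    using linear_independent_extend[of _ "\<lambda>x. f (x + a) - f a"] by blast
  have gv: "g (v - a) = f v - f a" if "v \<in> A" for v
  proof (cases "v = a")
    case True then show ?thesis using linear_0[OF g(1)] by simp
  next
    case False then show ?thesis using g(2)[of "- a + v"] that by simp
  qed
  have "f x = f a + g (x - a)" if x: "x \<in> convex hull A" for x
  proof -
    obtain u where u: "\<forall>v\<in>A. 0 \<le> u v" "sum u A = 1" "(\<Sum>v\<in>A. u v *\<^sub>R v) = x"
      using x unfolding convex_hull_finite[OF fin] by blast
    have "x - a = (\<Sum>v\<in>A. u v *\<^sub>R (v - a))"
      using u by (simp add: scaleR_diff_right sum_subtractf flip: scaleR_sum_left)
    then have "g (x - a) = (\<Sum>v\<in>A. u v *\<^sub>R (f v - f a))"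
      using gv by (simp add: linear_sum[OF g(1)] linear_scale[OF g(1)])
    also have "\<dots> = (\<Sum>v\<in>A. u v *\<^sub>R f v) - f a"
      using u by (simp add: scaleR_diff_right sum_subtractf flip: scaleR_sum_left)
    finally show ?thesis using f[of u] u by simp
  qed
  moreover have "continuous_on (convex hull A) (\<lambda>x. f a + g (x - a))"
    by (intro continuous_intros linear_continuous_on_compose[OF _ g(1)])
  ultimately show ?thesis by (simp cong: continuous_on_cong)
qed simp

section \<open>Surjective simplicial maps with finite fibres\<close>

locale finite_simplicial_map = K: simplicial_complex K + L: simplicial_complex L
  for K :: "'a::euclidean_space set set" and L :: "'b::euclidean_space set set" +
  fixes f :: "'a \<Rightarrow> 'b"
  assumes locally_finite: "locally_finite_complex K"
    and simplicial: "simplicial_map K L f"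
    and surj: "f ` \<Union>K = \<Union>L"
    and finite_fibres: "y \<in> \<Union>L \<Longrightarrow> finite {x \<in> \<Union>K. f x = y}"
begin

lemma f_segment:
  assumes "S \<in> K" "x \<in> S" "y \<in> S" "u \<in> {0..1}"
  shows "f ((1 - u) *\<^sub>R x + u *\<^sub>R y) = (1 - u) *\<^sub>R f x + u *\<^sub>R f y"
  using simplicial assms unfolding simplicial_map_def by blast

lemma f_sum:
  assumes A: "A \<in> vertices ` K" and u: "sum u A = 1" "\<And>v. v \<in> A \<Longrightarrow> 0 \<le> u v"
  shows "f (\<Sum>v\<in>A. u v *\<^sub>R v) = (\<Sum>v\<in>A. u v *\<^sub>R f v)"
  using f_segment[OF K.vertex_set(4)[OF A]] u K.vertex_set(2)[OF A]
  by (intro affine_on_segments_sum[of "convex hull A"] hull_subset convex_convex_hull)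

text \<open>Two points with one image would make f constant on the segment between them, so a fibre
  would be infinite.\<close>

lemma inj_on_simplex:
  assumes S: "S \<in> K"
  shows "inj_on f S"
proof (rule inj_onI, rule ccontr)
  fix x y assume x: "x \<in> S" and y: "y \<in> S" and fxy: "f x = f y" and ne: "x \<noteq> y"
  have conv: "convex S" using K.vertices_simplex(4)[OF S] convex_convex_hull by metis
  have "closed_segment x y \<subseteq> {z \<in> \<Union>K. f z = f x}"
  proof
    fix z assume z: "z \<in> closed_segment x y"
    then obtain u where "u \<in> {0..1}" "z = (1 - u) *\<^sub>R x + u *\<^sub>R y" by (auto simp: in_segment)
    then have "f z = f x" using f_segment[OF S x y] fxy by (simp flip: scaleR_add_left)
    moreover have "z \<in> S" using z conv x y by (meson closed_segment_subset subsetD)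
    ultimately show "z \<in> {z \<in> \<Union>K. f z = f x}" using S by blast
  qed
  moreover have "f x \<in> \<Union>L" using surj x S by blast
  ultimately have "finite (closed_segment x y)" using finite_fibres finite_subset by blast
  then show False using ne by simp
qed

lemma inj_on_vertex_set: "A \<in> vertices ` K \<Longrightarrow> inj_on f A"
  using inj_on_simplex[OF K.vertex_set(4)] hull_subset inj_on_subset by metis

lemma image_vertex_set:
  assumes "A \<in> vertices ` K"
  shows "f ` A \<in> vertices ` L"
proof -
  obtain T where T: "T \<in> L" "f ` A \<subseteq> vertices T"
    using assms simplicial unfolding simplicial_map_def by blast
  then show ?thesis using L.subset_vertex_set[of "vertices T" "f ` A"] K.vertex_set(3)[OF assms] by blast
qed

text \<open>The positive barycentric coordinates of x pass along the injection f on vertices to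
  positive coordinates of f x, so f x is interior to the image simplex.\<close>

lemma supporting_simplex_image:
  assumes x: "x \<in> \<Union>K"
  shows "vertices (supporting_simplex L (f x)) = f ` vertices (supporting_simplex K x)"
proof -
  let ?A = "vertices (supporting_simplex K x)"
  have A: "?A \<in> vertices ` K" using K.supporting_simplex(1)[OF x] by blast
  have "x \<in> rel_interior (convex hull ?A)"
    using K.supporting_simplex[OF x] K.vertices_simplex(4) by simp
  then obtain u where u: "\<forall>v\<in>?A. 0 < u v" "sum u ?A = 1" "(\<Sum>v\<in>?A. u v *\<^sub>R v) = x"
    unfolding rel_interior_convex_hull_explicit[OF K.vertex_set(1)[OF A]] by blast
  have inj: "inj_on f ?A" by (rule inj_on_vertex_set[OF A])
  have fx: "f x = (\<Sum>v\<in>?A. u v *\<^sub>R f v)" using f_sum[OF A u(2)] u by (simp add: less_imp_le)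
  have "f x \<in> rel_interior (convex hull (f ` ?A))"
    unfolding rel_interior_convex_hull_explicit[OF L.vertex_set(1)[OF image_vertex_set[OF A]]]
    using u fx inj
    by (intro CollectI exI[of _ "u \<circ> inv_into ?A f"]) (simp add: sum.reindex inv_into_f_f)
  then show ?thesis
    using L.supporting_simplex_eq L.vertex_set(4,5)[OF image_vertex_set[OF A]] by metis
qed

lemma f_barycenter:
  assumes A: "A \<in> vertices ` K"
  shows "f (barycenter A) = barycenter (f ` A)"
proof -
  have "card A > 0" using K.vertex_set(2,3)[OF A] by (simp add: card_gt_0_iff)
  then have "f (barycenter A) = (\<Sum>v\<in>A. (1 / real (card A)) *\<^sub>R f v)"
    unfolding barycenter_def by (intro f_sum[OF A]) auto
  also have "\<dots> = barycenter (f ` A)"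
    unfolding barycenter_def using inj_on_vertex_set[OF A] by (simp add: sum.reindex card_image)
  finally show ?thesis .
qed

text \<open>Surjectivity on points becomes surjectivity on simplices: take the supporting simplex of
  any preimage of the barycenter.\<close>

lemma exists_vertex_set_over:
  assumes B: "B \<in> vertices ` L"
  obtains A where "A \<in> vertices ` K" "f ` A = B"
proof -
  obtain x where x: "x \<in> \<Union>K" "f x = barycenter B"
    using L.supporting_simplex_barycenter(2)[OF B] surj by (metis imageE)
  show thesis
  proof
    show "vertices (supporting_simplex K x) \<in> vertices ` K" using K.supporting_simplex(1)[OF x(1)] by blast
    show "f ` vertices (supporting_simplex K x) = B"
      using supporting_simplex_image[OF x(1)] x(2) L.supporting_simplex_barycenter(3)[OF B] by simp
  qed
qed

text \<open>Each simplex is closed and f is affine on it; local finiteness allows gluing. Continuity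
  is what carries the equations f (x i) = f (x j) over to the closure defining D^k.\<close>

lemma continuous_on_f: "continuous_on (\<Union>K) f"
proof -
  have "continuous_map (top_of_set (\<Union>K)) euclidean f"
  proof (rule pasting_lemma_locally_finite[where I = K and T = "\<lambda>S. S" and f = "\<lambda>_. f"])
    show "\<exists>V. openin (top_of_set (\<Union>K)) V \<and> x \<in> V \<and> finite {S \<in> K. S \<inter> V \<noteq> {}}"
      if "x \<in> topspace (top_of_set (\<Union>K))" for x
      using locally_finite that unfolding locally_finite_complex_def locally_finite_in_def by blast
    fix S assume S: "S \<in> K"
    have A: "vertices S \<in> vertices ` K" using S by blast
    have "compact S" using K.vertices_simplex(2,4)[OF S] finite_imp_compact_convex_hull by metis
    then show "closedin (top_of_set (\<Union>K)) S"
      using S compact_imp_closed closed_subset by (metis Union_upper)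
    have "continuous_on (convex hull (vertices S)) f"
      using f_sum[OF A] by (intro continuous_on_affine_simplex K.vertex_set(1)[OF A]) auto
    then have "continuous_on S f" using K.vertices_simplex(4)[OF S] by simp
    then show "continuous_map (subtopology (top_of_set (\<Union>K)) S) euclidean f"
      using S by (simp add: subtopology_subtopology Int_absorb1 Union_upper)
  qed auto
  then show ?thesis by simp
qed

lemma strict_closure_subset_multi: "strict_closure_points K f k \<subseteq> multi_points K f k"
proof
  let ?X = "product_topology (\<lambda>_. top_of_set (\<Union>K)) {..<k}"
  let ?M = "{x \<in> multi_points K f k. inj_on x {..<k}}"
  fix x assume "x \<in> strict_closure_points K f k"
  then have x: "x \<in> Abstract_Topology.closure_of ?X ?M" unfolding strict_closure_points_def .
  have "x \<in> topspace ?X" using x by (rule subsetD[OF closure_of_subset_topspace])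
  then have "x \<in> {..<k} \<rightarrow>\<^sub>E \<Union>K" by simp
  moreover have "f (x i) = f (x j)" if "i < k" "j < k" for i j
  proof (rule forall_in_closure_of_eq[OF x, where Y = euclidean and f = "\<lambda>x. f (x i)" and g = "\<lambda>x. f (x j)"])
    have "continuous_map ?X euclidean (\<lambda>x. f (x l))" if "l < k" for l
    proof -
      have "continuous_map ?X euclidean (f \<circ> (\<lambda>x. x l))"
        by (rule continuous_map_compose[of _ "top_of_set (\<Union>K)"])
          (use that continuous_on_f in \<open>auto intro!: continuous_map_product_projection\<close>)
      then show ?thesis by (simp add: comp_def)
    qed
    then show "continuous_map ?X euclidean (\<lambda>x. f (x i))" "continuous_map ?X euclidean (\<lambda>x. f (x j))"
      using that by blast+
    show "f (x i) = f (x j)" if "x \<in> ?M" for x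
      using that \<open>i < k\<close> \<open>j < k\<close> unfolding multi_points_def by blast
  qed (rule Hausdorff_space_euclidean)
  ultimately show "x \<in> multi_points K f k" unfolding multi_points_def by blast
qed

end

section \<open>Simplices of the multiple point spaces\<close>

context finite_simplicial_map
begin

abbreviation S where "S n \<equiv> ordered_simplices n (vertices ` K)"
abbreviation R where "R n \<equiv> ordered_simplices n (vertices ` L)"

lemma ordered_simplicesD:
  assumes "vs \<in> S n"
  shows "length vs = Suc n" "distinct vs" "set vs \<in> vertices ` K" "inj_on f (set vs)"
  using assms inj_on_vertex_set by (simp_all add: ordered_simplices_def)

lemma face_ordered:
  assumes "vs \<in> S (Suc n)" "i \<le> Suc n"
  shows "face i vs \<in> S n"
proof -
  note v = ordered_simplicesD[OF assms(1)]
  have len: "length (face i vs) = Suc n" using length_face[of i vs] v(1) assms(2) by simp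
  have "distinct (face i vs)"
    unfolding face_def using v(2) by (simp add: set_take_disj_set_drop_if_distinct)
  moreover have "face i vs \<noteq> []" using len by auto
  then have "set (face i vs) \<in> vertices ` K"
    by (intro K.subset_vertex_set[OF v(3) set_face_subset]) simp
  ultimately show ?thesis using len by (simp add: ordered_simplices_def)
qed

lemma image_ordered: "map f ` S n = R n"
proof (intro subset_antisym subsetI)
  fix w assume "w \<in> map f ` S n"
  then obtain vs where vs: "vs \<in> S n" "w = map f vs" by blast
  note v = ordered_simplicesD[OF vs(1)]
  show "w \<in> R n"
    using v image_vertex_set[OF v(3)] by (simp add: vs(2) ordered_simplices_def distinct_map)
next
  fix w assume "w \<in> R n"
  then have w: "length w = Suc n" "distinct w" "set w \<in> vertices ` L" by (simp_all add: ordered_simplices_def)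
  \<comment> \<open>The inverse of f on this simplex carries the order of w over to its
    vertices.\<close>
  obtain A where A: "A \<in> vertices ` K" "f ` A = set w" using exists_vertex_set_over[OF w(3)] by blast
  let ?g = "inv_into A f"
  have "set (map ?g w) = A" using inv_into_image_cancel inj_on_vertex_set[OF A(1)] A(2)
    by (metis inv_into_image_cancel list.set_map order_refl)
  moreover have "distinct (map ?g w)"
    using w(2) A(2) inj_on_inv_into[of "set w" f A] by (simp add: distinct_map)
  ultimately have "map ?g w \<in> S n" using A(1) w(1) by (simp add: ordered_simplices_def)
  moreover have "map f (map ?g w) = w"
    using A(2) by (simp add: map_idI f_inv_into_f)
  ultimately show "w \<in> map f ` S n" by (metis imageI)
qed

sublocale fibred_simplices f S R
  by unfold_locales (auto simp: ordered_simplicesD face_ordered image_ordered)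

lemma multi_points_D:
  assumes "x \<in> multi_points K f k" "l < k"
  shows "x l \<in> \<Union>K" "f (x l) = f (x 0)"
proof -
  show "x l \<in> \<Union>K" using assms unfolding multi_points_def by blast
  have "0 < k" using assms(2) by simp
  then show "f (x l) = f (x 0)" using assms unfolding multi_points_def by blast
qed

text \<open>The simplex supporting each component maps bijectively on vertices onto the one
  supporting the common image, so the definite description is defined.\<close>

lemma lifted_vertex:
  assumes x: "x \<in> multi_points K f k" and l: "l < k"
    and w: "w \<in> vertices (supporting_simplex L (f (x 0)))"
  shows "lifted_vertex K f k x w l \<in> vertices (supporting_simplex K (x l))"
    "f (lifted_vertex K f k x w l) = w"
proof -
  let ?A = "vertices (supporting_simplex K (x l))"
  have A: "?A \<in> vertices ` K" using K.supporting_simplex(1) multi_points_D(1)[OF x l] by blast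
  have "w \<in> f ` ?A"
    using w supporting_simplex_image[OF multi_points_D(1)[OF x l]] multi_points_D(2)[OF x l] by simp
  then obtain v where v: "v \<in> ?A" "f v = w" by blast
  have "(THE v. v \<in> ?A \<and> f v = w) = v"
    using v inj_on_vertex_set[OF A] by (intro the_equality) (auto dest: inj_onD)
  then show "lifted_vertex K f k x w l \<in> ?A" "f (lifted_vertex K f k x w l) = w"
    using v l by (simp_all add: lifted_vertex_def)
qed

lemma lifted_vertex_eqI:
  assumes x: "x \<in> multi_points K f k" and w: "w \<in> vertices (supporting_simplex L (f (x 0)))"
    and v: "v \<in> extensional {..<k}"
      "\<And>l. l < k \<Longrightarrow> v l \<in> vertices (supporting_simplex K (x l)) \<and> f (v l) = w"
  shows "lifted_vertex K f k x w = v"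
proof (rule extensionalityI[of _ "{..<k}"])
  fix l assume "l \<in> {..<k}"
  then have l: "l < k" by simp
  have "inj_on f (vertices (supporting_simplex K (x l)))"
    using K.supporting_simplex(1)[OF multi_points_D(1)[OF x l]] inj_on_vertex_set by blast
  from inj_onD[OF this] show "lifted_vertex K f k x w l = v l"
    using lifted_vertex[OF x l w] v(2)[OF l] by simp
qed (simp_all add: lifted_vertex_def v(1))

text \<open>Component l maps the vertices of the multiple simplex bijectively onto those of the
  simplex supporting x l, so row l inherits distinctness and has the right vertex set.\<close>

lemma ordered_multi_simplex_tuples:
  assumes x: "x \<in> multi_points K f (Suc k)" and len: "length vs = Suc n" and dist: "distinct vs"
    and set: "set vs = multi_simplex K L f (Suc k) x"
  shows "vs \<in> tuples f (S n) (Suc k)"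
proof (rule tuplesI)
  let ?B = "vertices (supporting_simplex L (f (x 0)))"
  have v: "\<exists>w\<in>?B. v = lifted_vertex K f (Suc k) x w" if "v \<in> set vs" for v
    using that set by (auto simp: multi_simplex_def)
  show "set vs \<subseteq> extensional {..<Suc k}" using v by (auto simp: lifted_vertex_def)
  fix l assume l: "l < Suc k"
  let ?A = "vertices (supporting_simplex K (x l))"
  have xl: "x l \<in> \<Union>K" by (rule multi_points_D(1)[OF x l])
  have A: "?A \<in> vertices ` K" using K.supporting_simplex(1)[OF xl] by blast
  have B: "f ` ?A = ?B" using supporting_simplex_image[OF xl] multi_points_D(2)[OF x l] by simp
  \<comment> \<open>Applying f to one component recovers the vertex w of Y, and w determines the
    whole tuple.\<close>
  have inj: "inj_on (\<lambda>v. v l) (set vs)"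
  proof (rule inj_onI)
    fix u v assume uv: "u \<in> set vs" "v \<in> set vs" "u l = v l"
    then obtain w w' where "w \<in> ?B" "u = lifted_vertex K f (Suc k) x w"
      "w' \<in> ?B" "v = lifted_vertex K f (Suc k) x w'" using v by metis
    then show "u = v" using lifted_vertex(2)[OF x l] uv(3) by metis
  qed
  have "set (row l vs) = ?A"
  proof (intro subset_antisym subsetI)
    fix a assume "a \<in> set (row l vs)"
    then show "a \<in> ?A" using v lifted_vertex(1)[OF x l] by (auto simp: row_def)
  next
    fix a assume a: "a \<in> ?A"
    then have fa: "f a \<in> ?B" using B by blast
    have "lifted_vertex K f (Suc k) x (f a) l = a"
      using lifted_vertex[OF x l fa] a inj_onD[OF inj_on_vertex_set[OF A]] by blast
    moreover have "lifted_vertex K f (Suc k) x (f a) \<in> set vs" using fa set by (simp add: multi_simplex_def)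
    ultimately have "a \<in> (\<lambda>v. v l) ` set vs" by (metis imageI)
    then show "a \<in> set (row l vs)" by (simp add: row_def)
  qed
  moreover have "distinct (row l vs)" unfolding row_def using dist inj by (simp add: distinct_map)
  ultimately have "row l vs \<in> S n" using A len by (simp add: ordered_simplices_def)
  moreover have "f (v l) = f (v 0)" if "v \<in> set vs" for v
    using v[OF that] lifted_vertex(2)[OF x] l by auto
  then have "map f (row l vs) = map f (row 0 vs)" by (simp add: row_def)
  ultimately show "row l vs \<in> S n \<and> map f (row l vs) = map f (row 0 vs)" by blast
qed simp

text \<open>The point of W^k that realises a tuple of simplices. Its components have one image
  because f maps barycenters to barycenters.\<close>

definition row_barycenters :: "nat \<Rightarrow> (nat \<Rightarrow> 'a) list \<Rightarrow> nat \<Rightarrow> 'a" where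
  "row_barycenters k vs = (\<lambda>l\<in>{..<k}. barycenter (set (row l vs)))"

lemma row_barycenters:
  assumes vs: "vs \<in> tuples f (S n) (Suc k)"
  shows "row_barycenters (Suc k) vs \<in> multi_points K f (Suc k)"
    "set vs = multi_simplex K L f (Suc k) (row_barycenters (Suc k) vs)"
    "length vs = Suc n" "distinct vs"
proof -
  let ?x = "row_barycenters (Suc k) vs"
  have r: "set (row l vs) \<in> vertices ` K" if "l < Suc k" for l
    using ordered_simplicesD(3)[OF tuplesD(2)[OF vs that]] .
  have fr: "f ` set (row l vs) = f ` set (row 0 vs)" if "l < Suc k" for l
    using tuplesD(3)[OF vs that] by (metis list.set_map)
  have fx: "f (?x l) = barycenter (f ` set (row 0 vs))" if "l < Suc k" for l
    using f_barycenter[OF r[OF that]] fr[OF that] that by (simp add: row_barycenters_def)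
  have "?x l \<in> \<Union>K" if "l < Suc k" for l
    using K.supporting_simplex_barycenter(2)[OF r[OF that]] that by (simp add: row_barycenters_def)
  then have "?x \<in> {..<Suc k} \<rightarrow>\<^sub>E \<Union>K"
    by (intro PiE_I) (simp_all add: row_barycenters_def)
  then show x: "?x \<in> multi_points K f (Suc k)"
    unfolding multi_points_def by (simp add: fx)
  have A: "vertices (supporting_simplex K (?x l)) = set (row l vs)" if "l < Suc k" for l
    using K.supporting_simplex_barycenter(3)[OF r[OF that]] that by (simp add: row_barycenters_def)
  have B: "vertices (supporting_simplex L (f (?x 0))) = f ` set (row 0 vs)"
    using supporting_simplex_image[OF multi_points_D(1)[OF x, of 0]] A[of 0] by simp
  have lift: "lifted_vertex K f (Suc k) ?x (f (v 0)) = v" if "v \<in> set vs" for v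
  proof (rule lifted_vertex_eqI[OF x])
    show "f (v 0) \<in> vertices (supporting_simplex L (f (?x 0)))"
      unfolding B using that by (auto simp: row_def)
    show "v \<in> extensional {..<Suc k}" using tuplesD(1)[OF vs] that by blast
    fix l assume l: "l < Suc k"
    have "v l \<in> set (row l vs)" using that by (auto simp: row_def)
    moreover have "f (v l) = f (v 0)" using tuplesD(3)[OF vs l] that by (auto simp: row_def)
    ultimately show "v l \<in> vertices (supporting_simplex K (?x l)) \<and> f (v l) = f (v 0)"
      using A[OF l] by simp
  qed
  have "multi_simplex K L f (Suc k) ?x = (\<lambda>v. lifted_vertex K f (Suc k) ?x (f (v 0))) ` set vs"
    unfolding multi_simplex_def B by (simp add: row_def image_image)
  also have "\<dots> = set vs" using lift by simp
  finally show "set vs = multi_simplex K L f (Suc k) ?x" ..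
  have r0: "row 0 vs \<in> S n" using tuplesD(2)[OF vs] by simp
  show "length vs = Suc n" using ordered_simplicesD(1)[OF r0] by simp
  show "distinct vs" using ordered_simplicesD(2)[OF r0] unfolding row_def by (simp add: distinct_map)
qed

lemma ordered_simplices_W: "ordered_simplices n (W_complex K L f (Suc k)) = tuples f (S n) (Suc k)"
proof (intro subset_antisym subsetI)
  fix vs assume "vs \<in> ordered_simplices n (W_complex K L f (Suc k))"
  then show "vs \<in> tuples f (S n) (Suc k)"
    using ordered_multi_simplex_tuples by (auto simp: ordered_simplices_def W_complex_def)
next
  fix vs assume "vs \<in> tuples f (S n) (Suc k)"
  from row_barycenters[OF this] show "vs \<in> ordered_simplices n (W_complex K L f (Suc k))"
    by (auto simp: ordered_simplices_def W_complex_def)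
qed

lemma ordered_simplices_D_subset:
  "ordered_simplices n (D_complex K L f (Suc k)) \<subseteq> tuples f (S n) (Suc k)"
  using ordered_multi_simplex_tuples strict_closure_subset_multi[of "Suc k"]
  by (auto simp: ordered_simplices_def D_complex_def)

text \<open>Distinct rows have distinct barycenters, so the realising point is itself a strict
  multiple point and no limit has to be taken.\<close>

lemma distinct_rows_in_D:
  assumes vs: "vs \<in> tuples f (S n) (Suc k)"
    and rows: "\<And>l m. l < Suc k \<Longrightarrow> m < Suc k \<Longrightarrow> row l vs = row m vs \<Longrightarrow> l = m"
  shows "vs \<in> ordered_simplices n (D_complex K L f (Suc k))"
proof -
  let ?x = "row_barycenters (Suc k) vs"
  let ?X = "product_topology (\<lambda>_. top_of_set (\<Union>K)) {..<Suc k}"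
  let ?M = "{x \<in> multi_points K f (Suc k). inj_on x {..<Suc k}}"
  have "inj_on ?x {..<Suc k}"
  proof (rule inj_onI)
    fix l m assume "l \<in> {..<Suc k}" "m \<in> {..<Suc k}" and eq: "?x l = ?x m"
    then have l: "l < Suc k" and m: "m < Suc k" by simp_all
    note rl = ordered_simplicesD[OF tuplesD(2)[OF vs l]]
    note rm = ordered_simplicesD[OF tuplesD(2)[OF vs m]]
    have bary: "barycenter (set (row l vs)) = barycenter (set (row m vs))"
      using eq l m by (simp add: row_barycenters_def)
    have "set (row l vs) = vertices (supporting_simplex K (barycenter (set (row l vs))))"
      by (rule K.supporting_simplex_barycenter(3)[OF rl(3), symmetric])
    also have "\<dots> = set (row m vs)"
      unfolding bary by (rule K.supporting_simplex_barycenter(3)[OF rm(3)])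
    finally have "set (row l vs) = set (row m vs)" .
    moreover have "map f (row l vs) = map f (row m vs)"
      unfolding tuplesD(3)[OF vs l] tuplesD(3)[OF vs m] ..
    \<comment> \<open>Equal vertex sets alone leave the order open; it is fixed because the image
      lists agree and f is injective on the common vertex set.\<close>
    ultimately have "row l vs = row m vs"
      using rl(4) inj_on_map_eq_map[of f "row l vs" "row m vs"] by simp
    then show "l = m" using rows l m by blast
  qed
  then have "?x \<in> ?M" using row_barycenters(1)[OF vs] by blast
  moreover have "?M \<subseteq> topspace ?X" unfolding multi_points_def by force
  then have "?M \<subseteq> Abstract_Topology.closure_of ?X ?M" by (rule closure_of_subset)
  ultimately have "?x \<in> strict_closure_points K f (Suc k)"
    unfolding strict_closure_points_def by blast
  then show ?thesis
    using row_barycenters[OF vs] by (auto simp: ordered_simplices_def D_complex_def)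
qed

lemma W_chains_eq: "W_chains K L f (Suc q) p = WC p q"
  by (simp add: W_chains_def simplicial_chains_def ordered_simplices_W)

text \<open>Alternating chains only involve tuples of distinct simplices, so their supports in
  \<open>D\<^sup>k(f)\<close> and in \<open>W\<^sup>k(f)\<close> agree.\<close>

lemma D_alt_chains_eq: "D_alt_chains K L f (Suc q) p = AC p q"
proof -
  have "Poly_Mapping.keys c \<subseteq> ordered_simplices p (D_complex K L f (Suc q)) \<longleftrightarrow>
      Poly_Mapping.keys c \<subseteq> tuples f (S p) (Suc q)" if "alternating (Suc q) c" for c
  proof
    assume "Poly_Mapping.keys c \<subseteq> tuples f (S p) (Suc q)"
    then show "Poly_Mapping.keys c \<subseteq> ordered_simplices p (D_complex K L f (Suc q))"
      using distinct_rows_in_D alternating_rows_distinct[OF that] by blast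
  qed (use ordered_simplices_D_subset in blast)
  then have "{c \<in> carrier (simplicial_chains (D_complex K L f (Suc q)) p). alternating (Suc q) c} =
      {c. Poly_Mapping.keys c \<subseteq> tuples f (S p) (Suc q) \<and> alternating (Suc q) c}"
    unfolding simplicial_chains_def by auto
  then show ?thesis
    unfolding D_alt_chains_def alternating_chains_def alternating_def[symmetric]
    by (simp add: simplicial_chains_def free_Abelian_group_def)
qed

end

theorem corollary3p2:
  fixes K :: "'a::euclidean_space set set" and L :: "'b::euclidean_space set set"
    and f :: "'a \<Rightarrow> 'b"
  assumes "geometric_complex K" and "locally_finite_complex K"
    and "geometric_complex L" and "locally_finite_complex L"
    and "simplicial_map K L f"
    and "f ` \<Union>K = \<Union>L"
    and "\<And>y. y \<in> \<Union>L \<Longrightarrow> finite {x \<in> \<Union>K. f x = y}"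
  shows
    "(let C = (\<lambda>p q. W_chains K L f (Suc q) p);
          d' = (\<lambda>p q. simplicial_boundary p);
          d'' = (\<lambda>p q. rho (Suc q) p)
      in double_complex C d' d'' \<and>
         (\<forall>p q. ss_E1_map C d' p q \<in>
            iso (ss_E C d' d'' 1 p q) (homology (W_chains K L f (p + 1)) simplicial_boundary q)) \<and>
         (\<forall>p\<ge>1. \<forall>q. \<forall>\<xi>\<in>carrier (ss_E C d' d'' 1 p q).
            ss_E1_map C d' (p - 1) q (ss_d C d' d'' 1 p q \<xi>) =
              homology_map (W_chains K L f p) simplicial_boundary q (rho (p + 1) q)
                (ss_E1_map C d' p q \<xi>)) \<and>
         converges_to (ss_E_infinity C d' d'')
           (homology (simplicial_chains (vertices ` L)) simplicial_boundary))
   \<and> (let C = (\<lambda>p q. D_alt_chains K L f (Suc q) p);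
          d' = (\<lambda>p q. simplicial_boundary p);
          d'' = (\<lambda>p q. eps (Suc q) p)
      in double_complex C d' d'' \<and>
         (\<forall>p q. ss_E1_map C d' p q \<in>
            iso (ss_E C d' d'' 1 p q) (homology (D_alt_chains K L f (p + 1)) simplicial_boundary q)) \<and>
         (\<forall>p\<ge>1. \<forall>q. \<forall>\<xi>\<in>carrier (ss_E C d' d'' 1 p q).
            ss_E1_map C d' (p - 1) q (ss_d C d' d'' 1 p q \<xi>) =
              homology_map (D_alt_chains K L f p) simplicial_boundary q (eps (p + 1) q)
                (ss_E1_map C d' p q \<xi>)) \<and>
         converges_to (ss_E_infinity C d' d'')
           (homology (simplicial_chains (vertices ` L)) simplicial_boundary))"
proof -
  interpret finite_simplicial_map K L f
    using assms by unfold_locales auto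
  interpret W: augmented_complex WC "\<lambda>p q. simplicial_boundary p" "\<lambda>p q. rho (Suc q) p"
    TC simplicial_boundary "\<lambda>n. augment f" by (rule augmented_W)
  interpret A: augmented_complex AC "\<lambda>p q. simplicial_boundary p" "\<lambda>p q. eps (Suc q) p"
    TC simplicial_boundary "\<lambda>n. augment f" by (rule augmented_A)
  have target: "simplicial_chains (vertices ` L) = TC" by (simp add: simplicial_chains_def fun_eq_iff)
  have W_column: "W_chains K L f (p + 1) = (\<lambda>n. WC n p)" for p
    by (simp add: fun_eq_iff W_chains_eq)
  have D_column: "D_alt_chains K L f (p + 1) = (\<lambda>n. AC n p)" for p
    by (simp add: fun_eq_iff D_alt_chains_eq)
  \<comment> \<open>The target of the differential is column p - 1, which consists of chains on
    p-fold points; p >= 1 makes the truncated subtraction exact.\<close>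
  have W_pred: "W_chains K L f p = (\<lambda>n. WC n (p - 1))" if "p \<ge> 1" for p
    using W_column[of "p - 1"] that by simp
  have D_pred: "D_alt_chains K L f p = (\<lambda>n. AC n (p - 1))" if "p \<ge> 1" for p
    using D_column[of "p - 1"] that by simp
  show ?thesis
    unfolding Let_def W_chains_eq D_alt_chains_eq target W_column D_column
    using W.double_complex W.ss_E1_iso W.ss_d1_eq W.converges_to_target
      A.double_complex A.ss_E1_iso A.ss_d1_eq A.converges_to_target
    by (auto simp: W_pred D_pred)
qed

end
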